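(* Let $G$ be a group such that $\gamma_5(G)$ has no element of order $2$. Then $R_3(G)$ is a subgroup of $G$.
   Context: For elements $a,b$ of a group $G$, set $[a,b]=a^{-1}b^{-1}ab$, $[a,_0 b]=a$ and $[a,_n b]=[[a,_{n-1}b],b]$ for $n\ge 1$. An element $x\in G$ is called right $n$-Engel if $[x,_n g]=1$ for all $g\in G$; $R_n(G)$ denotes the set of all right $n$-Engel elements of $G$. For a positive integer $k$, $\gamma_k(G)$ denotes the $k$th term of the lower central series of $G$ (with $\gamma_1(G)=G$). *)

theory Defs
  imports "HOL-Algebra.Generated_Groups" "HOL-Algebra.Multiplicative_Group"
begin

text \<open>The commutator convention is \<open>[a, b] = a\<inverse> b\<inverse> a b\<close>; note that the library's
  \<^const>\<open>derived\<close> uses \<open>a b a\<inverse> b\<inverse>\<close> instead.\<close>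

definition commutator :: "('a, 'b) monoid_scheme \<Rightarrow> 'a \<Rightarrow> 'a \<Rightarrow> 'a" where
  "commutator G a b = inv\<^bsub>G\<^esub> a \<otimes>\<^bsub>G\<^esub> inv\<^bsub>G\<^esub> b \<otimes>\<^bsub>G\<^esub> a \<otimes>\<^bsub>G\<^esub> b"

text \<open>\<open>engel_commutator G a n b\<close> is the left-normed commutator \<open>[a, b, \<dots>, b]\<close>
  with \<open>n\<close> copies of \<open>b\<close>.\<close>

primrec engel_commutator :: "('a, 'b) monoid_scheme \<Rightarrow> 'a \<Rightarrow> nat \<Rightarrow> 'a \<Rightarrow> 'a" where
  "engel_commutator G a 0 b = a"
| "engel_commutator G a (Suc n) b = commutator G (engel_commutator G a n b) b"

definition right_engel :: "('a, 'b) monoid_scheme \<Rightarrow> nat \<Rightarrow> 'a set" where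
  "right_engel G n = {x \<in> carrier G. \<forall>g \<in> carrier G. engel_commutator G x n g = \<one>\<^bsub>G\<^esub>}"

text \<open>The series is indexed from 1; the value at index 0 is a dummy.\<close>

fun lower_central :: "('a, 'b) monoid_scheme \<Rightarrow> nat \<Rightarrow> 'a set" where
  "lower_central G 0 = carrier G"
| "lower_central G (Suc 0) = carrier G"
| "lower_central G (Suc (Suc k)) =
     generate G {commutator G a b | a b. a \<in> lower_central G (Suc k) \<and> b \<in> carrier G}"

end

theory Submission
  imports Defs
begin

text \<open>Closure under products and inverses is tested on one element \<open>x\<close> at a time, so for right
  3-Engel elements \<open>a\<close>, \<open>b\<close> everything takes place in the subgroup \<open>H\<close> generated by \<open>a\<close>, \<open>b\<close>
  and \<open>x\<close>. Expanding the Engel identity at the conjugates of \<open>a\<close> shows that \<open>[a, x, x]\<close> commutes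
  with \<open>[a, x]\<close>, which settles inverses, and that modulo the centre the conjugates of \<open>a\<close> generate
  a group of class at most 2. As \<open>x\<close> acts unipotently on it, \<open>a\<close> and \<open>b\<close> lie in the
  hypercentre and \<open>H\<close> is nilpotent. On the last nontrivial term of the lower central series
  left-normed commutators are multilinear, and the linearised Engel identities become a linear system
  over the integers. In weight 6 its elimination needs division by powers of 2 only, so
  \<open>\<gamma>\<^sub>6(H) = 1\<close> because \<open>\<gamma>\<^sub>5(H)\<close> has no involutions. In class 5 the same elimination
  annihilates the commutators by which \<open>[ab, x, x, x]\<close> differs from \<open>[a, x, x, x][b, x, x, x]\<close>.\<close>

section \<open>Commutator calculus\<close>

text \<open>The hypothesis excludes involutions in weight 5 only, whereas the commutators of
  conjugates of \<open>a\<close> that obstruct the argument have weight 4 and are merely shown to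
  have order dividing 2 or 4. They are not shown to vanish but to be central: in weight 4, a square
  root of an element that centralizes a right 3-Engel element centralizes it as well. Hence the
  detour through the central quotient. The Engel identity is exploited through one device. If
  \<open>c\<close> commutes with \<open>a\<close>, then \<open>[a; c * x] = [a; x]\<close>, so the
  identities at \<open>x\<close> and at \<open>c * x\<close> concern the same commutator, and
  comparing them yields new commuting pairs. Commutators are multilinear only where the next term of
  the series is trivial. This is why nilpotency has to precede all linear algebra, and why the
  series is collapsed downwards from its unknown end. The elimination itself is finite: a commutator
  of weight above 6 is its first six entries, a word in two Engel letters and one arbitrary letter,
  followed by an inert tail.\<close>

text \<open>Groups are types here and subgroups are sets; a group given by a carrier enters through its
  Cayley representation in the type of permutations.\<close>
class mgroup = monoid_mult +
  fixes minv :: "'a \<Rightarrow> 'a"  ("_\<^sup>-" [1000] 1000)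
  assumes minv_left [simp]: "x\<^sup>- * x = 1"
begin

lemma minv_left_assoc [simp]: "x\<^sup>- * (x * y) = y"
  by (simp flip: mult.assoc)

lemma mult_left_cancel_iff [simp]: "x * y = x * z \<longleftrightarrow> y = z"
  by (metis minv_left_assoc)

lemma minv_right [simp]: "x * x\<^sup>- = 1"
proof -
  have "x\<^sup>- * (x * x\<^sup>-) = x\<^sup>- * 1"
    by simp
  then show ?thesis
    by (simp only: mult_left_cancel_iff)
qed

lemma minv_right_assoc [simp]: "x * (x\<^sup>- * y) = y"
  by (simp flip: mult.assoc)

lemma mult_right_cancel_iff [simp]: "y * x = z * x \<longleftrightarrow> y = z"
  by (metis minv_right mult.assoc mult_1_right)

lemma minv_unique: "x * y = 1 \<Longrightarrow> x\<^sup>- = y"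
  by (metis minv_left_assoc mult_1_right)

lemma minv_minv [simp]: "x\<^sup>-\<^sup>- = x"
  by (rule minv_unique) simp

lemma minv_one [simp]: "1\<^sup>- = 1"
  by (rule minv_unique) simp

lemma minv_mult [simp]: "(x * y)\<^sup>- = y\<^sup>- * x\<^sup>-"
  by (rule minv_unique) (simp add: mult.assoc)

lemma minv_eq_iff [simp]: "x\<^sup>- = y\<^sup>- \<longleftrightarrow> x = y"
  by (metis minv_minv)

lemma minv_eq_1_iff [simp]: "x\<^sup>- = 1 \<longleftrightarrow> x = 1"
  by (metis minv_minv minv_one)

lemma eq_minv_mult_iff: "x = y\<^sup>- * z \<longleftrightarrow> y * x = z"
  by (metis minv_left_assoc minv_right_assoc)

lemma eq_mult_minv_iff: "x = z * y\<^sup>- \<longleftrightarrow> x * y = z"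
  by (metis minv_left minv_right mult.assoc mult_1_right)

lemma mult_eq_self_iff [simp]: "x * y = x \<longleftrightarrow> y = 1"
  by (metis mult_1_right mult_left_cancel_iff)

definition cj :: "'a \<Rightarrow> 'a \<Rightarrow> 'a"  (infixl "\<up>" 75)
  where "x \<up> g = g\<^sup>- * x * g"

definition cm :: "'a \<Rightarrow> 'a \<Rightarrow> 'a"  ("[_; _]")
  where "[x; y] = x\<^sup>- * y\<^sup>- * x * y"

lemma cj_mult [simp]: "(x * y) \<up> g = (x \<up> g) * (y \<up> g)"
  by (simp add: cj_def mult.assoc)

lemma cj_minv [simp]: "x\<^sup>- \<up> g = (x \<up> g)\<^sup>-"
  by (simp add: cj_def mult.assoc)

lemma cj_one [simp]: "1 \<up> g = 1"
  by (simp add: cj_def)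

lemma cj_by_one [simp]: "x \<up> 1 = x"
  by (simp add: cj_def)

lemma cj_by_mult: "x \<up> (g * h) = x \<up> g \<up> h"
  by (simp add: cj_def mult.assoc)

lemma cj_cj_minv [simp]: "x \<up> g \<up> g\<^sup>- = x" "x \<up> g\<^sup>- \<up> g = x"
  by (simp_all add: cj_def mult.assoc)

lemma cj_inject [simp]: "x \<up> g = y \<up> g \<longleftrightarrow> x = y"
  by (metis cj_cj_minv(1))

lemma cj_self [simp]: "x \<up> x = x"
  by (simp add: cj_def mult.assoc)

lemma cj_cm: "[x; y] \<up> g = [x \<up> g; y \<up> g]"
  by (simp add: cm_def)

lemma cj_cj: "x \<up> y \<up> g = (x \<up> g) \<up> (y \<up> g)"
  by (simp add: cj_def mult.assoc)

lemma cj_eq_mult_cm: "x \<up> g = x * [x; g]"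
  by (simp add: cj_def cm_def mult.assoc)

lemma cm_eq_cj: "[x; g] = x\<^sup>- * x \<up> g"
  by (simp add: cj_def cm_def mult.assoc)

lemma cm_minv: "[x; y]\<^sup>- = [y; x]"
  by (simp add: cm_def mult.assoc)

lemma cm_one [simp]: "[x; 1] = 1" "[1; x] = 1" "[x; x] = 1"
  by (simp_all add: cm_def mult.assoc)

lemma cm_mult_left: "[x * y; z] = [x; z] \<up> y * [y; z]"
  by (simp add: cm_def cj_def mult.assoc)

lemma cm_mult_right: "[x; y * z] = [x; z] * [x; y] \<up> z"
  by (simp add: cm_def cj_def mult.assoc)

lemma cj_fix_iff: "x \<up> g = x \<longleftrightarrow> x * g = g * x"
  by (metis cj_def cj_self eq_minv_mult_iff mult.assoc)

lemma cj_fix_sym: "x \<up> g = x \<Longrightarrow> g \<up> x = g"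
  by (simp add: cj_fix_iff)

lemma cm_eq_1_iff: "[x; g] = 1 \<longleftrightarrow> x \<up> g = x"
  by (simp add: cm_eq_cj) (metis cm_eq_cj cm_one(1) eq_minv_mult_iff mult_1_right)

lemma cj_fix_minv: "x \<up> g = x \<Longrightarrow> x \<up> g\<^sup>- = x"
  by (metis cj_cj_minv(1))

text \<open>\<open>[x; g]\<close> is the quotient of \<open>g\<close> by \<open>g \<up> x\<close>,
  so commuting with it amounts to commuting with \<open>g \<up> x\<close>. In this form an Engel
  condition is easily conjugated.\<close>

lemma cm_cm_eq_1_iff: "[[x; g]; g] = 1 \<longleftrightarrow> g \<up> (g \<up> x) = g"
proof -
  have "[x; g] = (g \<up> x)\<^sup>- * g"
    by (simp add: cm_def cj_def mult.assoc)
  then show ?thesis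
    by (auto simp add: cm_eq_1_iff dest: cj_fix_sym)
qed

text \<open>Both sides say that \<open>g\<close> commutes with a conjugate of itself, by
  \<open>x\<^sup>-\<close> and by \<open>x\<close>; conjugation by \<open>x\<close> carries one to
  the other, and commuting is symmetric.\<close>

lemma cm_cm_minv_iff: "[[x\<^sup>-; g]; g] = 1 \<longleftrightarrow> [[x; g]; g] = 1"
proof -
  have "g \<up> (g \<up> x\<^sup>-) = g \<longleftrightarrow> (g \<up> x) \<up> g = g \<up> x"
    by (metis cj_cj cj_cj_minv(2) cj_inject)
  also have "\<dots> \<longleftrightarrow> g \<up> (g \<up> x) = g"
    by (auto dest: cj_fix_sym)
  finally show ?thesis
    unfolding cm_cm_eq_1_iff .
qed

end

text \<open>The premises \<open>e1\<close> to \<open>e3\<close> are the Engel identity at those \<open>g\<close> for which \<open>[a; g] = u\<close> or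
  \<open>[b; g] = u\<^sup>-\<close>.\<close>
lemma pair_aux:
  fixes a b :: "'a::mgroup"
  defines "u \<equiv> [a; b]"
  defines "s \<equiv> [u; a]" and "t \<equiv> [u; b]"
  defines "z \<equiv> s\<^sup>- * s \<up> b"
  assumes sa: "s \<up> a = s" and tb: "t \<up> b = t"
    and e1: "[u; a * b] \<up> (a * b) = [u; a * b]"
    and e2: "[u; a\<^sup>- * b] \<up> (a\<^sup>- * b) = [u; a\<^sup>- * b]"
    and e3: "[u; b * a] \<up> (b * a) = [u; b * a]"
    and d1: "[s; u] \<up> a = [s; u]"
    and d2: "[t; u] \<up> b = [t; u]"
  shows "s \<up> b = s * z" "t \<up> a = t * z" "z \<up> a = z" "z \<up> b = z" "z * z = 1"
    "s \<up> u = s" "t \<up> u = t" "s \<up> t = s"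
proof -
  have ua: "u \<up> a = u * s" and ub: "u \<up> b = u * t"
    by (simp_all add: s_def t_def cj_eq_mult_cm)
  have sb: "s \<up> b = s * z"
    by (simp add: z_def)
  have uai: "u \<up> a\<^sup>- = u * s\<^sup>-"
  proof -
    have "(u * s\<^sup>-) \<up> a = u" by (simp add: ua sa mult.assoc)
    then show ?thesis by (metis cj_cj_minv(1))
  qed
  have ubi: "u \<up> b\<^sup>- = u * t\<^sup>-"
  proof -
    have "(u * t\<^sup>-) \<up> b = u" by (simp add: ub tb mult.assoc)
    then show ?thesis by (metis cj_cj_minv(1))
  qed
  have tbi: "t \<up> b\<^sup>- = t" using tb by (rule cj_fix_minv)
  have sai: "s \<up> a\<^sup>- = s" using sa by (rule cj_fix_minv)
  have sbi: "(s * z) \<up> b\<^sup>- = s" by (metis sb cj_cj_minv(1))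
  \<comment> \<open>Conjugating by \<open>b\<^sup>-\<close>, which fixes \<open>t\<close> and sends
    \<open>s * z\<close> to \<open>s\<close>, leaves a relation about conjugation by
    \<open>a\<close> alone.\<close>
  have A1: "(t * (s * z)) \<up> a = t * s"
  proof -
    have "[u; a * b] = t * (s * z)"
      by (simp add: cm_eq_cj cj_by_mult ua ub sb mult.assoc)
    with e1 have "(t * (s * z)) \<up> a \<up> b \<up> b\<^sup>- = (t * (s * z)) \<up> b\<^sup>-"
      by (simp only: cj_by_mult)
    moreover have "(t * (s * z)) \<up> b\<^sup>- = t * s"
      using tbi sbi by (metis cj_mult)
    ultimately show ?thesis by (simp only: cj_cj_minv)
  qed
  have A2: "(t * s\<^sup>-) \<up> a = t * (s * z)\<^sup>-"
  proof -
    have "[u; a\<^sup>- * b] = t * (s * z)\<^sup>-"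
      by (simp add: cm_eq_cj cj_by_mult uai ub sb mult.assoc)
    with e2 have "(t * (s * z)\<^sup>-) \<up> a\<^sup>- \<up> b \<up> b\<^sup>- = (t * (s * z)\<^sup>-) \<up> b\<^sup>-"
      by (simp only: cj_by_mult)
    moreover have "(t * (s * z)\<^sup>-) \<up> b\<^sup>- = t * s\<^sup>-"
      using tbi sbi by (metis cj_mult cj_minv)
    ultimately show ?thesis by (metis cj_cj_minv)
  qed
  have ta: "t \<up> a = t * z\<^sup>-"
    using A2 by (simp add: sa) (metis eq_mult_minv_iff minv_left minv_minv mult.assoc mult_1_right)
  have za: "z \<up> a = s\<^sup>- * z * s"
    using A1 by (simp add: sa ta mult.assoc) (metis eq_minv_mult_iff mult.assoc)
  have B1: "(s * t \<up> a) \<up> b = s * t"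
  proof -
    have "[u; b * a] = s * t \<up> a"
      by (simp add: cm_eq_cj cj_by_mult ua ub mult.assoc)
    with e3 have "(s * t \<up> a) \<up> b \<up> a \<up> a\<^sup>- = (s * t \<up> a) \<up> a\<^sup>-"
      by (simp only: cj_by_mult)
    then show ?thesis by (simp add: sai)
  qed
  have zb: "z \<up> b = t\<^sup>- * z * t"
    using B1 by (simp add: ta sb tb mult.assoc) (metis cj_cj_minv eq_minv_mult_iff eq_mult_minv_iff minv_minv minv_mult mult.assoc)
  \<comment> \<open>This is \<open>a * b = b * a * u\<close>. Applied to \<open>s\<close>,
    \<open>t\<close> and \<open>u\<close> it expresses the action of \<open>u\<close> in terms of
    the known actions of \<open>a\<close> and \<open>b\<close>.\<close>
  have comm: "x \<up> a \<up> b = x \<up> b \<up> a \<up> u" for x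
    by (simp add: u_def cm_def cj_def mult.assoc)
  have C1: "(z * s) \<up> u = s * z"
    using comm[of s] by (simp add: sa sb za mult.assoc)
  have C2: "(t * z\<^sup>-) \<up> u = z\<^sup>- * t"
    using comm[of t] by (simp add: ta tb zb mult.assoc)
  have su: "s \<up> u = t * s * z * t\<^sup>- * z"
  proof -
    have "u * t * (s * z) = u * (s \<up> u) * ((t * z\<^sup>-) \<up> u)"
      using comm[of u] by (simp add: ua ub sb ta tb mult.assoc)
    then show ?thesis unfolding C2
      by (simp add: mult.assoc)
  qed
  have sua: "s \<up> u \<up> a = s \<up> u"
    using d1 sa by (simp add: cj_eq_mult_cm[of s u])
  have zs: "s\<^sup>- * z * s = z"
  proof -
    have "s \<up> u \<up> a = t * s * z * t\<^sup>- * (s\<^sup>- * z * s)"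
      by (simp add: su ta sa za mult.assoc)
    with sua su show ?thesis by simp
  qed
  then have zs': "z * s = s * z" by (metis eq_minv_mult_iff mult.assoc)
  have zu: "z \<up> u = s * t * z\<^sup>- * s\<^sup>- * t\<^sup>-"
  proof -
    have "z \<up> u * s \<up> u = s * z"
      using C1 by simp
    then have "z \<up> u = s * z * (s \<up> u)\<^sup>-"
      by (simp only: eq_mult_minv_iff)
    then show ?thesis
      by (simp add: su mult.assoc)
  qed
  have tu: "t \<up> u = z\<^sup>- * t * s * t * z\<^sup>- * s\<^sup>- * t\<^sup>-"
  proof -
    have "t \<up> u * (z \<up> u)\<^sup>- = z\<^sup>- * t"
      using C2 by simp
    then have "t \<up> u = z\<^sup>- * t * (z \<up> u)\<^sup>-\<^sup>-"
      by (simp only: eq_mult_minv_iff)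
    then show ?thesis
      by (simp add: zu mult.assoc)
  qed
  have tub: "t \<up> u \<up> b = t \<up> u"
    using d2 tb by (simp add: cj_eq_mult_cm[of t u])
  have zt: "t\<^sup>- * z * t = z"
  proof -
    have "t \<up> u \<up> b = (t\<^sup>- * z * t)\<^sup>- * (t * s * z * t * (t\<^sup>- * z * t)\<^sup>- * (s * z)\<^sup>- * t\<^sup>-)"
      by (simp add: tu tb sb zb mult.assoc)
    also have "\<dots> = (t\<^sup>- * z * t)\<^sup>- * (t * s * t * z\<^sup>- * s\<^sup>- * t\<^sup>-)"
      by (simp add: mult.assoc)
    finally have "(t\<^sup>- * z * t)\<^sup>- * (t * s * t * z\<^sup>- * s\<^sup>- * t\<^sup>-) = z\<^sup>- * (t * s * t * z\<^sup>- * s\<^sup>- * t\<^sup>-)"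
      using tub tu by (simp add: mult.assoc)
    then show ?thesis by (metis mult_right_cancel_iff minv_eq_iff)
  qed
  have zt': "z * t = t * z" using zt by (metis eq_minv_mult_iff mult.assoc)
  have za': "z \<up> a = z" and zb': "z \<up> b = z" using za zb zs zt by simp_all
  have zu': "z \<up> u = z"
    unfolding u_def cm_def cj_by_mult using za' zb' by (simp add: cj_fix_minv)
  have su': "s \<up> u = s" using C1 zu' zs' by simp
  have tu': "t \<up> u = t"
    using C2 zu' zt by (simp add: mult.assoc) (metis eq_minv_mult_iff mult.assoc mult_right_cancel_iff zt')
  have st: "s \<up> t = s"
  proof -
    have "u \<up> s = u" using su' by (rule cj_fix_sym)
    then have "(u \<up> b) \<up> (s \<up> b) = u \<up> b" by (simp flip: cj_cj)
    then have "(s * z) \<up> (u * t) = s * z" unfolding ub sb by (rule cj_fix_sym)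
    moreover have "z \<up> (u * t) = z" using zu' zt' by (simp add: cj_by_mult cj_fix_iff[of z t])
    ultimately have "s \<up> (u * t) = s" by simp
    then show ?thesis by (simp add: cj_by_mult su')
  qed
  \<comment> \<open>\<open>su\<close> becomes \<open>s \<up> u * t = t * s * (z * z)\<close>; as
    \<open>s\<close> commutes with \<open>u\<close> and \<open>t\<close>, only the square of
    \<open>z\<close> remains.\<close>
  have z2: "z * z = 1"
  proof -
    have "t\<^sup>- * z = z * t\<^sup>-"
      by (simp only: eq_mult_minv_iff zt)
    then have "s \<up> u * t = t * s * (z * z)"
      by (simp add: su mult.assoc)
    then show ?thesis
      using st by (simp add: su' cj_fix_iff)
  qed
  then have zi: "z\<^sup>- = z" by (rule minv_unique)
  show "s \<up> b = s * z" "t \<up> a = t * z" "z \<up> a = z" "z \<up> b = z" "z * z = 1"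
    "s \<up> u = s" "t \<up> u = t" "s \<up> t = s"
    using sb ta zi za' zb' z2 su' tu' st by simp_all
qed

section \<open>The lower central series\<close>

text \<open>Indexed from 1; \<open>lcs S 0\<close> is empty.\<close>
inductive lcs :: "'a::mgroup set \<Rightarrow> nat \<Rightarrow> 'a \<Rightarrow> bool" for S where
  lcs_base: "x \<in> S \<Longrightarrow> lcs S (Suc 0) x"
| lcs_cm: "lcs S n x \<Longrightarrow> g \<in> S \<Longrightarrow> lcs S (Suc n) [x; g]"
| lcs_mult: "lcs S n x \<Longrightarrow> lcs S n y \<Longrightarrow> lcs S n (x * y)"
| lcs_minv: "lcs S n x \<Longrightarrow> lcs S n (x\<^sup>-)"

locale subgrp =
  fixes S :: "'a::mgroup set"
  assumes one_mem [simp]: "1 \<in> S"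
    and mult_mem [simp]: "x \<in> S \<Longrightarrow> y \<in> S \<Longrightarrow> x * y \<in> S"
    and minv_mem [simp]: "x \<in> S \<Longrightarrow> x\<^sup>- \<in> S"
begin

lemma cj_mem [simp]: "x \<in> S \<Longrightarrow> g \<in> S \<Longrightarrow> x \<up> g \<in> S"
  by (simp add: cj_def)

lemma cm_mem [simp]: "x \<in> S \<Longrightarrow> g \<in> S \<Longrightarrow> [x; g] \<in> S"
  by (simp add: cm_def)

lemma lcs_mem: "lcs S n x \<Longrightarrow> x \<in> S"
  by (induction rule: lcs.induct) auto

lemma lcs_pos: "lcs S n x \<Longrightarrow> 0 < n"
  by (induction rule: lcs.induct) auto

lemma lcs_cj: "lcs S n x \<Longrightarrow> g \<in> S \<Longrightarrow> lcs S n (x \<up> g)"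
  by (induction rule: lcs.induct) (auto simp: cj_cm intro: lcs.intros)

lemma lcs_Suc: "lcs S n x \<Longrightarrow> n = Suc m \<Longrightarrow> 0 < m \<Longrightarrow> lcs S m x"
proof (induction arbitrary: m rule: lcs.induct)
  case (lcs_cm n x g)
  then show ?case
    by (auto simp: cm_eq_cj intro!: lcs.lcs_mult lcs.lcs_minv lcs_cj)
qed (auto intro: lcs.intros)

lemma lcs_le:
  assumes "lcs S n x" "0 < m" "m \<le> n"
  shows "lcs S m x"
  using assms(3,1)
proof (induction n rule: dec_induct)
  case (step n)
  then show ?case
    using assms(2) lcs_Suc[of "Suc n" x n] by simp
qed

lemma lcs_one: "0 < n \<Longrightarrow> lcs S n 1"
proof (induction n rule: nat_induct_non_zero)
  case 1
  then show ?case by (simp add: lcs_base)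
next
  case (Suc n)
  then have "lcs S (Suc n) [1; 1]"
    by (intro lcs_cm) auto
  then show ?case by simp
qed

lemma hall_witt:
  "[[x; y\<^sup>-]; z] \<up> y * [[y; z\<^sup>-]; x] \<up> z * [[z; x\<^sup>-]; y] \<up> x = 1"
  by (simp add: cm_def cj_def mult.assoc)

lemma cm_minv_right: "[x; y\<^sup>-] = [x; y]\<^sup>- \<up> y\<^sup>-"
  by (simp add: cm_def cj_def mult.assoc)

lemma cm_minv_left: "[x\<^sup>-; y] = [x; y]\<^sup>- \<up> x\<^sup>-"
  by (simp add: cm_def cj_def mult.assoc)

lemma lcs_cm_swap: "lcs S n [x; y] \<Longrightarrow> lcs S n [y; x]"
  by (metis cm_minv lcs_minv)

text \<open>The three subgroups argument: Hall-Witt writes a commutator with \<open>[w; g]\<close>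
  as a product of conjugates of commutators into which \<open>w\<close> and \<open>g\<close> enter
  separately, and these are covered by the induction hypothesis for \<open>w\<close> and by
  \<open>lcs_cm\<close> for \<open>g\<close>.\<close>

lemma lcs_cm_add: "lcs S j y \<Longrightarrow> lcs S i x \<Longrightarrow> lcs S (i + j) [x; y]"
proof (induction arbitrary: i x rule: lcs.induct)
  case (lcs_base y)
  then show ?case by (simp add: lcs_cm)
next
  case (lcs_cm j w g)
  note w = \<open>lcs S j w\<close> and g = \<open>g \<in> S\<close> and x = \<open>lcs S i x\<close>
  have wS: "w \<in> S" and xS: "x \<in> S"
    using w x by (auto dest: lcs_mem)
  have "lcs S (i + j) [x; w\<^sup>-]"
    unfolding cm_minv_right using lcs_cm.IH[OF x] wS by (intro lcs_cj lcs_minv) auto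
  then have 1: "lcs S (Suc (i + j)) [[x; w\<^sup>-]; g\<^sup>-]"
    using g by (intro lcs.lcs_cm) auto
  have "lcs S (Suc i) [x\<^sup>-; g\<^sup>-]"
    using x g by (intro lcs.lcs_cm lcs_minv) auto
  then have "lcs S (Suc i) [g\<^sup>-; x\<^sup>-]"
    by (rule lcs_cm_swap)
  then have 2: "lcs S (Suc (i + j)) [[g\<^sup>-; x\<^sup>-]; w]"
    using lcs_cm.IH by fastforce
  have "[[w; g]; x] \<up> g\<^sup>- * [[g\<^sup>-; x\<^sup>-]; w] \<up> x * [[x; w\<^sup>-]; g\<^sup>-] \<up> w = 1"
    using hall_witt[of w "g\<^sup>-" x] by simp
  then have "[[w; g]; x] \<up> g\<^sup>- * ([[g\<^sup>-; x\<^sup>-]; w] \<up> x * [[x; w\<^sup>-]; g\<^sup>-] \<up> w) = 1"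
    by (simp only: mult.assoc)
  then have "([[w; g]; x] \<up> g\<^sup>-)\<^sup>- = [[g\<^sup>-; x\<^sup>-]; w] \<up> x * [[x; w\<^sup>-]; g\<^sup>-] \<up> w"
    by (rule minv_unique)
  then have "[[w; g]; x]\<^sup>- = ([[g\<^sup>-; x\<^sup>-]; w] \<up> x * [[x; w\<^sup>-]; g\<^sup>-] \<up> w) \<up> g"
    by (metis cj_minv cj_cj_minv(2))
  moreover have "lcs S (Suc (i + j)) \<dots>"
    using 1 2 wS xS g by (intro lcs_cj lcs_mult)
  ultimately show ?case
    by (simp add: cm_minv)
next
  case (lcs_mult j y z)
  then show ?case
    unfolding cm_mult_right by (intro lcs.lcs_mult lcs_cj) (auto dest: lcs_mem)
next
  case (lcs_minv j y)
  then show ?case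
    unfolding cm_minv_right by (intro lcs_cj lcs.lcs_minv) (auto dest: lcs_mem)
qed

section \<open>Right 3-Engel elements and pairs of them\<close>

definition R3 :: "'a set" where
  "R3 = {a \<in> S. \<forall>g \<in> S. [[[a; g]; g]; g] = 1}"

lemma R3_mem: "a \<in> R3 \<Longrightarrow> a \<in> S"
  by (simp add: R3_def)

lemma R3_D: "a \<in> R3 \<Longrightarrow> g \<in> S \<Longrightarrow> [[[a; g]; g]; g] = 1"
  by (simp add: R3_def)

lemma R3_fix: "a \<in> R3 \<Longrightarrow> g \<in> S \<Longrightarrow> [[a; g]; g] \<up> g = [[a; g]; g]"
  using R3_D cm_eq_1_iff by blast

lemma R3_cj:
  assumes "a \<in> R3" "h \<in> S"
  shows "a \<up> h \<in> R3"
proof -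
  have "[[[a \<up> h; g]; g]; g] = 1" if "g \<in> S" for g
  proof -
    have "[[[a; g \<up> h\<^sup>-]; g \<up> h\<^sup>-]; g \<up> h\<^sup>-] \<up> h = 1"
      using R3_D[OF assms(1), of "g \<up> h\<^sup>-"] that assms(2) by simp
    then show ?thesis
      by (simp only: cj_cm cj_cj_minv)
  qed
  then show ?thesis
    using assms by (simp add: R3_def)
qed

text \<open>These relations make \<open>a\<close> and \<open>b\<close> generate a group of class at
  most 4 whose last term is generated by \<open>z\<close>. Here \<open>z\<close> has weight 4, out
  of direct reach of a hypothesis on weight 5.\<close>

lemma R3_pair:
  assumes a: "a \<in> R3" and b: "b \<in> R3"
  defines "u \<equiv> [a; b]"
  defines "s \<equiv> [u; a]" and "t \<equiv> [u; b]"
  defines "z \<equiv> [s; b]"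
  shows "u \<up> a = u * s" "u \<up> b = u * t" "s \<up> a = s" "t \<up> b = t"
    "s \<up> b = s * z" "t \<up> a = t * z" "z \<up> a = z" "z \<up> b = z" "z * z = 1"
    "s \<up> u = s" "t \<up> u = t" "s \<up> t = s"
proof -
  have aS: "a \<in> S" and bS: "b \<in> S"
    using a b by (auto dest: R3_mem)
  have uS: "u \<in> S" using aS bS by (simp add: u_def)
  \<comment> \<open>Each \<open>g\<close> with the same commutator \<open>[a; g]\<close> gives
    another relation for the same \<open>u\<close>; commutators inverse to \<open>u\<close> serve as
    well by \<open>cm_cm_minv_iff\<close>.\<close>
  have A: "[[u; g]; g] = 1" if "[a; g] = u" "g \<in> S" for g
    using R3_D[OF a \<open>g \<in> S\<close>] that by simp
  have B: "[[u; g]; g] = 1" if "[b; g] = u\<^sup>-" "g \<in> S" for g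
    using R3_D[OF b \<open>g \<in> S\<close>] that by (simp add: cm_cm_minv_iff)
  have As: "[[s; g]; g] = 1" if "[a; g] = s\<^sup>-" "g \<in> S" for g
    using R3_D[OF a \<open>g \<in> S\<close>] that by (simp add: cm_cm_minv_iff)
  have Bt: "[[t; g]; g] = 1" if "[b; g] = t\<^sup>-" "g \<in> S" for g
    using R3_D[OF b \<open>g \<in> S\<close>] that by (simp add: cm_cm_minv_iff)
  have ba: "[b; a] = u\<^sup>-" and au: "[a; u] = s\<^sup>-" and bu: "[b; u] = t\<^sup>-"
    by (simp_all add: u_def s_def t_def cm_minv)
  have inv1: "[x; x\<^sup>-] = 1" for x :: 'a
    by (simp add: cm_def)
  have sa: "s \<up> a = s"
    using B[OF ba aS] by (simp add: s_def cm_eq_1_iff)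
  have tb: "t \<up> b = t"
    using A[of b] bS by (simp add: t_def u_def cm_eq_1_iff)
  \<comment> \<open>\<open>a * u\<close> and \<open>u\<close> have the same commutator with
    \<open>a\<close>. Since \<open>s\<close> commutes with \<open>a\<close>, also
    \<open>[s; a * u] = [s; u]\<close>, and comparing the two Engel identities cancels the action of
    \<open>u\<close>.\<close>
  have d1: "[s; u] \<up> a = [s; u]"
  proof -
    have e: "[s; a * u] = [s; u]"
      using sa by (simp add: cm_mult_right cm_eq_1_iff[of s a, THEN iffD2])
    have "[s; u] \<up> u = [s; u]"
      using As[OF au uS] by (simp add: cm_eq_1_iff)
    moreover have "[s; u] \<up> a \<up> u = [s; u]"
    proof -
      have "[[s; a * u]; a * u] = 1"
        by (rule As) (use aS uS au in \<open>simp_all add: cm_mult_right\<close>)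
      then show ?thesis
        by (simp only: e cm_eq_1_iff cj_by_mult)
    qed
    ultimately show ?thesis by (metis cj_inject)
  qed
  have d2: "[t; u] \<up> b = [t; u]"
  proof -
    have e: "[t; b * u] = [t; u]"
      using tb by (simp add: cm_mult_right cm_eq_1_iff[of t b, THEN iffD2])
    have "[t; u] \<up> u = [t; u]"
      using Bt[OF bu uS] by (simp add: cm_eq_1_iff)
    moreover have "[t; u] \<up> b \<up> u = [t; u]"
    proof -
      have "[[t; b * u]; b * u] = 1"
        by (rule Bt) (use bS uS bu in \<open>simp_all add: cm_mult_right\<close>)
      then show ?thesis
        by (simp only: e cm_eq_1_iff cj_by_mult)
    qed
    ultimately show ?thesis by (metis cj_inject)
  qed
  have e1: "[u; a * b] \<up> (a * b) = [u; a * b]" and e2: "[u; a\<^sup>- * b] \<up> (a\<^sup>- * b) = [u; a\<^sup>- * b]"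
    unfolding cm_eq_1_iff[symmetric]
    by (rule A; use aS bS in \<open>simp add: cm_mult_right inv1 u_def\<close>)+
  have e3: "[u; b * a] \<up> (b * a) = [u; b * a]"
    unfolding cm_eq_1_iff[symmetric]
    by (rule B) (use aS bS ba in \<open>simp_all add: cm_mult_right\<close>)
  have z': "z = s\<^sup>- * s \<up> b"
    by (simp add: z_def cm_eq_cj)
  note P = pair_aux[of a b, folded u_def, folded s_def t_def, OF sa tb e1 e2 e3 d1 d2]
  show "u \<up> a = u * s" "u \<up> b = u * t"
    by (simp_all add: s_def t_def cj_eq_mult_cm)
  show "s \<up> a = s" "t \<up> b = t" using sa tb .
  show "s \<up> b = s * z" "t \<up> a = t * z" "z \<up> a = z" "z \<up> b = z" "z * z = 1"
    "s \<up> u = s" "t \<up> u = t" "s \<up> t = s"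
    using P[folded z'] by blast+
qed

end

section \<open>Conjugates of a right 3-Engel element\<close>

lemma mult_minv_cancel_right [simp]: "(x::'a::mgroup) * y * y\<^sup>- = x" "x * y\<^sup>- * y = x"
  by (simp_all add: mult.assoc)

lemma cj_invI: "(y::'a::mgroup) \<up> g = x \<Longrightarrow> x \<up> g\<^sup>- = y"
  by auto

text \<open>\<open>p\<close>, \<open>q\<close>, \<open>r\<close> are consecutive conjugates of
  \<open>a\<close> under \<open>x\<close>. The elements \<open>a * x\<close>,
  \<open>a\<^sup>- * x\<close> and \<open>a * (a * x)\<close> have the same commutator
  \<open>v\<close> with \<open>a\<close> as \<open>x\<close> has, and the Engel identities at them
  determine how \<open>a\<close> acts on \<open>e'\<close>, \<open>U\<close> and
  \<open>t\<close>.\<close>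

lemma engel_shift:
  fixes a x :: "'a::mgroup"
  defines "p \<equiv> a" and "q \<equiv> a \<up> x" and "r \<equiv> a \<up> x \<up> x" and "v \<equiv> a\<^sup>- * a \<up> x"
  defines "t \<equiv> [v; x]" and "u \<equiv> [p; q]" and "U \<equiv> [q; r]"
  defines "e \<equiv> [u; p]" and "e' \<equiv> [U; q]"
  assumes tx: "t \<up> x = t"
    and g1: "[v; a * x] \<up> (a * x) = [v; a * x]"
    and g2: "[v; a\<^sup>- * x] \<up> (a\<^sup>- * x) = [v; a\<^sup>- * x]"
    and g3: "[v; a * (a * x)] \<up> (a * (a * x)) = [v; a * (a * x)]"
    and ep: "e \<up> p = e" and eq: "e \<up> q = e" and ue: "u \<up> e = u"
  shows "e' \<up> p = e'" "U \<up> p = U * e'\<^sup>-" "t \<up> p = t * u\<^sup>- * U * e'\<^sup>-"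
proof -
  have px: "p \<up> x = q" and qx: "q \<up> x = r" and ux: "u \<up> x = U" and ex: "e \<up> x = e'"
    by (simp_all add: p_def q_def r_def u_def U_def e_def e'_def cj_cm)
  have tx': "t \<up> x\<^sup>- = t" using tx by (rule cj_fix_minv)
  have v: "v = p\<^sup>- * q" by (simp add: v_def p_def q_def)
  have up: "u \<up> p = u * e" by (simp add: e_def cj_eq_mult_cm)
  have qp: "q \<up> p = q * u\<^sup>-" by (simp add: u_def cm_minv cj_eq_mult_cm[of q p])
  have vx: "v \<up> x = v * t" by (simp add: t_def cj_eq_mult_cm)
  have eu: "e * u = u * e" using ue by (simp add: cj_fix_iff)
  have eu': "e * u\<^sup>- = u\<^sup>- * e"
    using ue by (metis cj_fix_sym cj_fix_minv cj_fix_iff)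
  \<comment> \<open>The Engel identity at \<open>h * x\<close> with the final \<open>x\<close>
    stripped off by means of \<open>t \<up> x = t\<close>. It is used for \<open>h\<close> equal to
    \<open>p\<close>, its inverse and its square.\<close>
  have inv: "(t * s \<up> x) \<up> h = t * s"
    if s: "v \<up> h = v * s" and g: "[v; h * x] \<up> (h * x) = [v; h * x]" for h s
  proof -
    have "[v; h * x] = t * s \<up> x"
      by (simp add: cm_eq_cj cj_by_mult s vx mult.assoc)
    with g have "(t * s \<up> x) \<up> h \<up> x \<up> x\<^sup>- = (t * s \<up> x) \<up> x\<^sup>-"
      by (simp only: cj_by_mult)
    then show ?thesis
      by (simp only: cj_cj_minv cj_mult tx')
  qed
  have vp: "v \<up> p = v * u\<^sup>-"
    by (simp add: v qp mult.assoc)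
  define U' where "U' = U \<up> p"
  have 1: "t \<up> p = t * u\<^sup>- * U'"
  proof -
    have "(t * u\<^sup>- \<up> x) \<up> p = t * u\<^sup>-"
      using vp g1 by (intro inv) (simp_all add: p_def)
    then show ?thesis
      by (simp add: ux U'_def eq_mult_minv_iff[symmetric])
  qed
  have U': "U' = u * U * e'\<^sup>- * u\<^sup>-"
  proof -
    have "(v * (u * e\<^sup>-)) \<up> p = v"
      by (simp add: vp up ep mult.assoc)
    then have "v \<up> p\<^sup>- = v * (u * e\<^sup>-)"
      by (rule cj_invI)
    then have "(t * (u * e\<^sup>-) \<up> x) \<up> p\<^sup>- = t * (u * e\<^sup>-)"
      using g2 by (intro inv) (simp_all add: p_def)
    then have "t * (u * e\<^sup>-) \<up> x = (t * (u * e\<^sup>-)) \<up> p"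
      by (metis cj_cj_minv(2))
    then have "U * e'\<^sup>- = u\<^sup>- * (U' * u)"
      by (simp add: ux ex 1 up ep mult.assoc)
    then show ?thesis
      by (metis eq_minv_mult_iff eq_mult_minv_iff mult.assoc)
  qed
  have 2: "(U * e') \<up> p = u * U * u\<^sup>-"
  proof -
    have "v \<up> (p * p) = v * (u\<^sup>- * (u * e)\<^sup>-)"
      by (simp add: cj_by_mult vp up mult.assoc)
    then have "(t * (u\<^sup>- * (u * e)\<^sup>-) \<up> x) \<up> (p * p) = t * (u\<^sup>- * (u * e)\<^sup>-)"
      using g3 by (intro inv) (simp_all add: p_def mult.assoc)
    then have "U' * (u * e)\<^sup>- * ((U * e') \<up> p \<up> p)\<^sup>- = (u * e)\<^sup>-"
      by (simp add: cj_by_mult 1 ux ex up U'_def[symmetric] mult.assoc)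
    then have "(U * e') \<up> p \<up> p = (u * e) * U' * (u * e)\<^sup>-"
      by (metis eq_mult_minv_iff minv_left_assoc minv_right_assoc mult.assoc minv_minv minv_mult)
    also have "\<dots> = (u * U * u\<^sup>-) \<up> p"
      by (simp add: up U'_def)
    finally show ?thesis by (simp only: cj_inject)
  qed
  have "e' \<up> p = U'\<^sup>- * (u * U * u\<^sup>-)"
    using 2 by (simp add: U'_def eq_minv_mult_iff)
  then have e'p: "e' \<up> p = u * e' * u\<^sup>-"
    by (simp add: U' mult.assoc)
  have e'q: "e' \<up> q = e'"
    using ep by (metis ex px cj_cj)
  \<comment> \<open>\<open>p * u\<close> is the conjugate of \<open>p\<close> by \<open>q\<close>,
    so its action can also be computed along \<open>q\<^sup>- * p * q\<close>.\<close>
  have pu: "p * u = q\<^sup>- * p * q"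
    by (simp add: u_def cm_def mult.assoc)
  have "e' \<up> (p * u) = e'"
    by (simp add: cj_by_mult e'p) (simp add: cj_def mult.assoc)
  then have "e' \<up> q\<^sup>- \<up> p \<up> q = e'"
    by (simp only: pu cj_by_mult)
  then have "e' \<up> p = e' \<up> q\<^sup>-"
    using e'q cj_fix_minv[OF e'q] by (metis cj_cj_minv(1))
  then show e'p': "e' \<up> p = e'"
    using cj_fix_minv[OF e'q] by simp
  have Uq: "U \<up> q = U * e'" by (simp add: e'_def cj_eq_mult_cm)
  have Uq': "U \<up> q\<^sup>- = U * e'\<^sup>-"
    by (rule cj_invI) (simp add: Uq e'q)
  have "U \<up> (p * u) = U * e'\<^sup>-"
    by (simp add: cj_by_mult U'_def[symmetric] U') (simp add: cj_def mult.assoc)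
  then have "(U * e'\<^sup>-) \<up> p \<up> q = U * e'\<^sup>-"
    by (simp only: pu cj_by_mult Uq')
  then have "(U * e'\<^sup>-) \<up> p = (U * e'\<^sup>-) \<up> q\<^sup>-"
    by (metis cj_cj_minv(1))
  then show U'': "U \<up> p = U * e'\<^sup>-"
    using cj_fix_minv[OF e'q] by (simp add: Uq' e'p')
  show "t \<up> p = t * u\<^sup>- * U * e'\<^sup>-"
    using 1 U'' by (simp add: U'_def mult.assoc)
qed

lemma cj_swap: "(x::'a::mgroup) * g = g * x \<up> g"
  by (simp add: cj_def mult.assoc)

text \<open>The word \<open>t\<close> is \<open>[[a; x]; x]\<close> written in the conjugates
  \<open>p = a\<close>, \<open>q = a \<up> x\<close>, \<open>r = a \<up> x \<up> x\<close>.
  Conjugating it by \<open>p\<close> brings in \<open>[p; r]\<close> through its last letter, and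
  comparison with the known action of \<open>p\<close> on \<open>t\<close> solves for that
  commutator.\<close>

lemma engel_W:
  fixes p q r :: "'a::mgroup"
  defines "u \<equiv> [p; q]" and "U \<equiv> [q; r]" and "t \<equiv> q\<^sup>- * p * q\<^sup>- * r"
  assumes act: "u \<up> p = u * e" "u \<up> q = u * f" "u \<up> r = u * f\<^sup>-"
      "e \<up> p = e" "e \<up> q = e" "e \<up> r = e" "f \<up> p = f" "f \<up> q = f" "f \<up> r = f"
    and t: "t \<up> p = t * u\<^sup>- * U * c\<^sup>-"
    and ef: "e \<up> f = e" and uf: "u \<up> f = u" and ue: "u \<up> e = u"
  shows "[p; r] = c * U\<^sup>- * u * u * u * e * f\<^sup>- * f\<^sup>- * f\<^sup>- * f\<^sup>- * f\<^sup>-"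
proof -
  define W where "W = [p; r]"
  have qp: "q \<up> p = q * u\<^sup>-" by (simp add: u_def cm_minv cj_eq_mult_cm[of q p])
  have rp: "r \<up> p = r * W\<^sup>-" by (simp add: W_def cm_minv cj_eq_mult_cm[of r p])
  have uq': "u \<up> q\<^sup>- = u * f\<^sup>-" by (rule cj_invI) (simp add: act)
  have fq': "f \<up> q\<^sup>- = f" "e \<up> q\<^sup>- = e" by (simp_all add: act cj_fix_minv)
  have "t \<up> p = u * (q\<^sup>- * p) * u * (q\<^sup>- * r) * W\<^sup>-"
    by (simp add: t_def qp rp mult.assoc)
  also have "\<dots> = q\<^sup>- * p * ((u \<up> (q\<^sup>- * p)) * u) * (q\<^sup>- * r) * W\<^sup>-"
    by (simp only: cj_swap[of u "q\<^sup>- * p"] mult.assoc)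
  also have "\<dots> = q\<^sup>- * p * ((u \<up> (q\<^sup>- * p)) * u * (q\<^sup>- * r)) * W\<^sup>-"
    by (simp only: mult.assoc)
  also have "\<dots> = q\<^sup>- * p * (q\<^sup>- * r * ((u \<up> (q\<^sup>- * p)) * u) \<up> (q\<^sup>- * r)) * W\<^sup>-"
    by (simp only: cj_swap[of "(u \<up> (q\<^sup>- * p)) * u" "q\<^sup>- * r"])
  also have "\<dots> = t * (((u \<up> (q\<^sup>- * p)) * u) \<up> (q\<^sup>- * r)) * W\<^sup>-"
    by (simp add: t_def mult.assoc)
  finally have "u\<^sup>- * U * c\<^sup>- = (((u \<up> (q\<^sup>- * p)) * u) \<up> (q\<^sup>- * r)) * W\<^sup>-"
    unfolding t by (simp add: mult.assoc)
  then have "W = (c * U\<^sup>- * u) * (((u \<up> (q\<^sup>- * p)) * u) \<up> (q\<^sup>- * r))"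
    by (metis eq_mult_minv_iff eq_minv_mult_iff minv_mult minv_minv mult.assoc)
  also have "((u \<up> (q\<^sup>- * p)) * u) \<up> (q\<^sup>- * r) = u * f\<^sup>- * f\<^sup>- * e * f\<^sup>- * (u * f\<^sup>- * f\<^sup>-)"
    by (simp add: cj_by_mult uq' fq' act mult.assoc)
  also have "\<dots> = u * u * e * f\<^sup>- * f\<^sup>- * f\<^sup>- * f\<^sup>- * f\<^sup>-"
  proof -
    have 1: "f\<^sup>- * u = u * f\<^sup>-" using uf by (metis cj_fix_iff cj_fix_minv)
    have 2: "e * u = u * e" using ue by (metis cj_fix_iff)
    have 3: "f\<^sup>- * e = e * f\<^sup>-" using ef by (metis cj_fix_iff cj_fix_minv)
    have c1: "f\<^sup>- * (u * y) = u * (f\<^sup>- * y)" for y by (metis 1 mult.assoc)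
    have c2: "e * (u * y) = u * (e * y)" for y by (metis 2 mult.assoc)
    have c3: "f\<^sup>- * (e * y) = e * (f\<^sup>- * y)" for y by (metis 3 mult.assoc)
    show ?thesis by (simp add: mult.assoc 1 2 3 c1 c2 c3)
  qed
  finally show ?thesis
    by (simp add: W_def mult.assoc)
qed

text \<open>Sorting rules for the simplifier, to be instantiated with each commuting pair; the
  versions with \<open>z\<close> let a factor pass inside longer products.\<close>

lemma cj_fix_rules:
  fixes x y :: "'a::mgroup"
  assumes "x \<up> y = x"
  shows "x * y = y * x" "x * (y * z) = y * (x * z)"
    "x\<^sup>- * y = y * x\<^sup>-" "x\<^sup>- * (y * z) = y * (x\<^sup>- * z)"
    "x * y\<^sup>- = y\<^sup>- * x" "x * (y\<^sup>- * z) = y\<^sup>- * (x * z)"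
    "x\<^sup>- * y\<^sup>- = y\<^sup>- * x\<^sup>-" "x\<^sup>- * (y\<^sup>- * z) = y\<^sup>- * (x\<^sup>- * z)"
proof -
  have 1: "x * y = y * x" using assms by (simp add: cj_fix_iff)
  have "x\<^sup>- \<up> y = x\<^sup>-" using assms by simp
  then have 2: "x\<^sup>- * y = y * x\<^sup>-" by (simp only: cj_fix_iff)
  have "x \<up> y\<^sup>- = x" using assms by (rule cj_fix_minv)
  then have 3: "x * y\<^sup>- = y\<^sup>- * x" by (simp only: cj_fix_iff)
  have "x\<^sup>- \<up> y\<^sup>- = x\<^sup>-" using \<open>x \<up> y\<^sup>- = x\<close> by simp
  then have 4: "x\<^sup>- * y\<^sup>- = y\<^sup>- * x\<^sup>-" by (simp only: cj_fix_iff)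
  show "x * y = y * x" "x * (y * z) = y * (x * z)"
    "x\<^sup>- * y = y * x\<^sup>-" "x\<^sup>- * (y * z) = y * (x\<^sup>- * z)"
    "x * y\<^sup>- = y\<^sup>- * x" "x * (y\<^sup>- * z) = y\<^sup>- * (x * z)"
    "x\<^sup>- * y\<^sup>- = y\<^sup>- * x\<^sup>-" "x\<^sup>- * (y\<^sup>- * z) = y\<^sup>- * (x\<^sup>- * z)"
    by (simp_all only: 1 2 3 4 flip: mult.assoc)
qed

lemma cj_fix_cm: "x \<up> g = x \<Longrightarrow> x \<up> h = x \<Longrightarrow> x \<up> [g; h] = (x::'a::mgroup)"
  by (simp add: cm_def cj_by_mult cj_fix_minv)

lemma cj_fix_cj: "(x::'a::mgroup) \<up> g = x \<Longrightarrow> x \<up> h \<up> (g \<up> h) = x \<up> h"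
  by (simp flip: cj_cj)

text \<open>The torsion condition is placed on the series of \<open>S\<close> itself, so that the
  locale can be used for a subgroup generated by three elements.\<close>

locale engel_grp = subgrp +
  assumes tf2: "lcs S 5 z \<Longrightarrow> z * z = 1 \<Longrightarrow> z = 1"
begin

lemma tf4:
  assumes "lcs S 5 z" "z * (z * (z * z)) = 1"
  shows "z = 1"
proof -
  have "z * z * (z * z) = 1" using assms(2) by (simp add: mult.assoc)
  then have "z * z = 1" using tf2[OF lcs_mult[OF assms(1) assms(1)]] by simp
  then show ?thesis by (rule tf2[OF assms(1)])
qed

lemma lcs_3_conj:
  assumes "a \<in> S" "x \<in> S"
  shows "lcs S 3 [a; a \<up> x]"
proof -
  have "lcs S (1 + Suc 1) [a; [a; x]]"
    using assms by (intro lcs_cm_add lcs_cm) (auto intro: lcs_base)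
  moreover have "[a; a \<up> x] = [a; [a; x]]"
    by (simp add: cj_eq_mult_cm[of a x] cm_mult_right)
  ultimately show ?thesis by (simp add: numeral_3_eq_3)
qed

lemma lcs_4_conj:
  assumes "a \<in> S" "x \<in> S" "g \<in> S"
  shows "lcs S 4 [[a; a \<up> x]; g]"
  using lcs_cm[OF lcs_3_conj[OF assms(1,2)] assms(3)] by simp

text \<open>For a pair of conjugates every commutator gains one weight, as
  \<open>[a; a \<up> x] = [a; [a; x]]\<close>. The element \<open>z\<close> of
  \<open>R3_pair\<close> then lies in weight 5, where a trivial square makes it trivial.\<close>

lemma R3_conj_pair:
  assumes a: "a \<in> R3" and x: "x \<in> S"
  defines "q \<equiv> a \<up> x"
  defines "u \<equiv> [a; q]"
  defines "e \<equiv> [u; a]" and "f \<equiv> [u; q]"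
  shows "u \<up> a = u * e" "u \<up> q = u * f" "e \<up> a = e" "e \<up> q = e" "f \<up> a = f" "f \<up> q = f"
    "u \<up> e = u" "f \<up> u = f"
proof -
  have q: "q \<in> R3" unfolding q_def using a x by (rule R3_cj)
  have aS: "a \<in> S" "q \<in> S" using a q by (auto dest: R3_mem)
  note P = R3_pair[OF a q, folded u_def, folded e_def f_def]
  have "lcs S (Suc 4) [e; q]"
    unfolding e_def u_def q_def using aS x by (intro lcs_cm lcs_4_conj) auto
  then have "lcs S 5 [e; q]"
    by simp
  then have "[e; q] = 1"
    using P(9) by (rule tf2)
  then show "u \<up> a = u * e" "u \<up> q = u * f" "e \<up> a = e" "e \<up> q = e" "f \<up> a = f" "f \<up> q = f"
    "u \<up> e = u" "f \<up> u = f"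
    using P by (simp_all add: cj_fix_sym)
qed

lemma R3_shift:
  assumes a: "a \<in> R3" and x: "x \<in> S"
  defines "q \<equiv> a \<up> x" and "r \<equiv> a \<up> x \<up> x" and "t \<equiv> [[a; x]; x]"
  defines "u \<equiv> [a; q]" and "U \<equiv> [q; r]"
  defines "e' \<equiv> [U; q]"
  shows "e' \<up> a = e'" "U \<up> a = U * e'\<^sup>-" "t \<up> a = t * u\<^sup>- * U * e'\<^sup>-"
proof -
  have aS: "a \<in> S" using a by (rule R3_mem)
  have v: "[a; x] = a\<^sup>- * a \<up> x" by (rule cm_eq_cj)
  have inv1: "[y; y\<^sup>-] = 1" for y :: 'a
    by (simp add: cm_def)
  have w: "[a; a * x] = [a; x]" "[a; a\<^sup>- * x] = [a; x]" "[a; a * (a * x)] = [a; x]"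
    by (simp_all add: cm_mult_right inv1)
  have "[[a; x]; a * x] \<up> (a * x) = [[a; x]; a * x]"
    "[[a; x]; a\<^sup>- * x] \<up> (a\<^sup>- * x) = [[a; x]; a\<^sup>- * x]"
    "[[a; x]; a * (a * x)] \<up> (a * (a * x)) = [[a; x]; a * (a * x)]"
    using R3_fix[OF a, of "a * x"] R3_fix[OF a, of "a\<^sup>- * x"] R3_fix[OF a, of "a * (a * x)"] aS x
    by (simp_all only: w mult_mem minv_mem)
  note g = this[unfolded v]
  note cp = R3_conj_pair[OF a x]
  show "e' \<up> a = e'" "U \<up> a = U * e'\<^sup>-" "t \<up> a = t * u\<^sup>- * U * e'\<^sup>-"
    unfolding e'_def U_def u_def t_def q_def r_def v
    using R3_fix[OF a x, unfolded v] g cp(3,4,7) by (rule engel_shift)+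
qed

text \<open>A priori there are four elements of weight 4: \<open>e\<close>,
  \<open>f = [u; q]\<close> and their conjugates by \<open>x\<close>. Computing
  \<open>[a; r]\<close> once from the side of \<open>a\<close> and once from the side of
  \<open>r\<close> relates their powers. Combinations such as \<open>f\<^sup>- * e'\<close> are
  commutators with \<open>k\<close>, so they have weight 5 and vanish with their fourth powers; all
  four elements turn out to be \<open>e\<close> or its inverse.\<close>

lemma R3_conj_center:
  assumes a: "a \<in> R3" and x: "x \<in> S"
  defines "q \<equiv> a \<up> x" and "r \<equiv> a \<up> x \<up> x" and "t \<equiv> [[a; x]; x]"
  defines "u \<equiv> [a; q]" and "U \<equiv> [q; r]"
  defines "e \<equiv> [u; a]"
  shows "e \<up> a = e" "e \<up> q = e" "e \<up> r = e"
    "u \<up> a = u * e" "u \<up> q = u * e\<^sup>-" "u \<up> r = u * e" "e \<up> x = e\<^sup>-"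
    "[a; r] = U\<^sup>- * u * u * u * e * e * e * e * e"
    "[a; r] = u\<^sup>- * U * U * U * e * e * e * e * e"
    "t \<up> a = t * u\<^sup>- * U * e" "U \<up> a = U * e" "U \<up> r = U * e"
    "e \<up> u = e" "e \<up> U = e" "u \<up> U = u"
proof -
  have aS: "a \<in> S" using a by (rule R3_mem)
  define f where "f = [u; q]"
  define e' where "e' = e \<up> x"
  define f' where "f' = f \<up> x"
  define p1 where "p1 = a \<up> x\<^sup>-"
  define h where "h = [u\<^sup>-; q]"
  have ax: "a \<up> x = q" and qx: "q \<up> x = r" and ux: "u \<up> x = U" and p1x: "p1 \<up> x = a"
    by (simp_all add: q_def r_def u_def U_def p1_def cj_cm)
  have e'_eq: "e' = [U; q]" by (simp add: e'_def e_def cj_cm ux ax)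
  note cp = R3_conj_pair[OF a x, folded q_def, folded u_def, folded e_def f_def]
  note sh = R3_shift[OF a x, folded q_def r_def t_def, folded u_def U_def, folded e'_eq]
  have x': "x\<^sup>- \<in> S" using x by simp
  note cp' = R3_conj_pair[OF a x', folded p1_def]
  note sh' = R3_shift[OF a x', folded p1_def]
  have tx: "t \<up> x = t" unfolding t_def using R3_fix[OF a x] .
  have t1: "t = q\<^sup>- * a * q\<^sup>- * r"
    unfolding t_def cm_eq_cj[of "[a; x]" x] by (simp add: cm_eq_cj[of a x] ax qx mult.assoc)
  \<comment> \<open>Since \<open>x\<close> fixes \<open>t\<close>, its word may be shifted by
    \<open>x\<^sup>-\<close>. An element commuting with three neighbouring conjugates thus commutes
    with \<open>t\<close>, and hence with the next conjugate.\<close>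
  have t2: "t = a\<^sup>- * p1 * a\<^sup>- * q"
  proof -
    have "t = t \<up> x\<^sup>-" using tx by (metis cj_cj_minv(1))
    also have "\<dots> = a\<^sup>- * p1 * a\<^sup>- * q"
    proof (rule cj_invI)
      show "(a\<^sup>- * p1 * a\<^sup>- * q) \<up> x = t" by (simp add: t1 ax qx p1x)
    qed
    finally show ?thesis .
  qed
  have r_word: "r = q * a\<^sup>- * q * t" by (simp add: t1 mult.assoc)
  have p1_word: "p1 = a * t * q\<^sup>- * a" by (simp add: t2 mult.assoc)
  have hf: "h = f\<^sup>-"
  proof -
    have "h = u * (u \<up> q)\<^sup>-" by (simp add: h_def cm_eq_cj)
    also have "\<dots> = u * (f\<^sup>- * u\<^sup>-)" by (simp add: cp(2))
    also have "\<dots> = f\<^sup>-" by (simp add: cj_fix_rules[OF cp(8)])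
    finally show ?thesis .
  qed
  have h_eq: "h = [[a; p1]; a] \<up> x"
    by (simp add: h_def u_def cj_cm p1x ax cm_minv)
  have hr: "h \<up> r = h"
  proof -
    have "[[p1; p1 \<up> x\<^sup>-]; p1] = h \<up> x\<^sup>- \<up> x\<^sup>-"
      by (simp add: h_eq cj_cm p1_def)
    then have "h \<up> x\<^sup>- \<up> x\<^sup>- \<up> a = h \<up> x\<^sup>- \<up> x\<^sup>-"
      using sh'(1) by simp
    from cj_fix_cj[OF cj_fix_cj[OF this, of x], of x] show ?thesis
      by (simp add: ax qx)
  qed
  have fr: "f \<up> r = f" using hr by (simp add: hf)
  have e_p1: "e \<up> p1 = e"
  proof -
    have "e' \<up> x\<^sup>- \<up> (a \<up> x\<^sup>-) = e' \<up> x\<^sup>-"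
      using sh(1) by (rule cj_fix_cj)
    then show ?thesis by (simp add: e'_def p1_def)
  qed
  have et: "e \<up> t = e"
    unfolding t2 cj_by_mult using cp(3,4) e_p1 by (simp add: cj_fix_minv)
  have er: "e \<up> r = e"
    unfolding r_word cj_by_mult using cp(3,4) et by (simp add: cj_fix_minv)
  have ft: "f \<up> t = f"
    unfolding t1 cj_by_mult using cp(5,6) fr by (simp add: cj_fix_minv)
  have f_p1: "f \<up> p1 = f"
    unfolding p1_word cj_by_mult using cp(5,6) ft by (simp add: cj_fix_minv)
  have e'_fix: "e' \<up> a = e'" "e' \<up> q = e'" "e' \<up> r = e'"
    using sh(1) cj_fix_cj[OF cp(3), of x] cj_fix_cj[OF cp(4), of x] by (simp_all add: ax qx e'_def)
  have f'_fix: "f' \<up> a = f'" "f' \<up> q = f'" "f' \<up> r = f'"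
    using cj_fix_cj[OF f_p1, of x] cj_fix_cj[OF cp(5), of x] cj_fix_cj[OF cp(6), of x]
    by (simp_all add: ax qx f'_def p1x)
  \<comment> \<open>The results for \<open>x\<^sup>-\<close> concern \<open>a\<close>,
    \<open>p1\<close> and \<open>p1 \<up> x\<^sup>-\<close>; conjugation by \<open>x\<close> twice
    turns these into \<open>r\<close>, \<open>q\<close> and \<open>a\<close>.\<close>
  have sh2: "y \<up> a \<up> x \<up> x = y \<up> x \<up> x \<up> r" for y
    by (simp only: cj_cj[of y a x] cj_cj[of _ q x] ax qx)
  have ur: "u \<up> r = u * f\<^sup>-"
  proof -
    have "[p1; p1 \<up> x\<^sup>-] \<up> a = [p1; p1 \<up> x\<^sup>-] * [[p1; p1 \<up> x\<^sup>-]; p1]\<^sup>-"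
      using sh'(2) .
    then have "[p1; p1 \<up> x\<^sup>-] \<up> a \<up> x \<up> x = ([p1; p1 \<up> x\<^sup>-] * [[p1; p1 \<up> x\<^sup>-]; p1]\<^sup>-) \<up> x \<up> x"
      by simp
    then have "[q; a] \<up> r = [q; a] * [[q; a]; q]\<^sup>-"
      by (simp only: sh2 cj_mult cj_minv cj_cm p1x cj_cj_minv ax)
    then have "u\<^sup>- \<up> r = u\<^sup>- * h\<^sup>-"
      by (simp only: h_def u_def cm_minv)
    then have "u \<up> r = h * u"
      by (metis cj_minv minv_minv minv_mult)
    then show ?thesis
      by (simp add: hf cj_fix_rules[OF cp(8)])
  qed
  have Ua: "U \<up> a = U * e'\<^sup>-" by (rule sh(2))
  have Uq: "U \<up> q = U * e'" and Ur: "U \<up> r = U * f'"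
    using arg_cong[OF cp(1), of "\<lambda>y. y \<up> x"] arg_cong[OF cp(2), of "\<lambda>y. y \<up> x"]
    by (simp_all add: cj_cj[of u] ux ax qx e'_def f'_def)
  have fixu: "c \<up> u = c" "c \<up> U = c" if "c \<up> a = c" "c \<up> q = c" "c \<up> r = c" for c
    unfolding u_def U_def using that by (simp_all add: cj_fix_cm)
  have fixe: "c \<up> e = c" "c \<up> f = c" "c \<up> e' = c" if "c \<up> a = c" "c \<up> q = c" "c \<up> r = c" for c
    unfolding e_def f_def e'_eq using that fixu[OF that] by (simp_all add: cj_fix_cm)
  note efix = cp(3,4) er and ffix = cp(5,6) fr
  have uU: "u \<up> U = u"
    unfolding U_def cm_def cj_by_mult
  proof -
    have 1: "u \<up> q\<^sup>- = u * f\<^sup>-" by (rule cj_invI) (simp add: cp(2,6))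
    have 2: "u \<up> r\<^sup>- = u * f" by (rule cj_invI) (simp add: ur fr)
    have 3: "f \<up> q\<^sup>- = f" "f \<up> r\<^sup>- = f" using cp(6) fr by (simp_all add: cj_fix_minv)
    show "u \<up> q\<^sup>- \<up> r\<^sup>- \<up> q \<up> r = u"
      by (simp add: 1 2 3 ur fr cp(2,6))
  qed
  note rules = cj_fix_rules[OF fixu(1)[OF efix]] cj_fix_rules[OF fixu(2)[OF efix]]
    cj_fix_rules[OF fixu(1)[OF ffix]] cj_fix_rules[OF fixu(2)[OF ffix]]
    cj_fix_rules[OF fixu(1)[OF e'_fix]] cj_fix_rules[OF fixu(2)[OF e'_fix]]
    cj_fix_rules[OF fixu(1)[OF f'_fix]] cj_fix_rules[OF fixu(2)[OF f'_fix]]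
    cj_fix_rules[OF fixe(1)[OF ffix]] cj_fix_rules[OF fixe(1)[OF e'_fix]]
    cj_fix_rules[OF fixe(2)[OF e'_fix]] cj_fix_rules[OF fixe(1)[OF f'_fix]]
    cj_fix_rules[OF fixe(2)[OF f'_fix]] cj_fix_rules[OF fixe(3)[OF f'_fix]]
    cj_fix_rules[OF uU]
  define W where "W = [a; r]"
  have W1: "W = e' * U\<^sup>- * u * u * u * e * f\<^sup>- * f\<^sup>- * f\<^sup>- * f\<^sup>- * f\<^sup>-"
    unfolding W_def U_def u_def
    by (rule engel_W) (simp_all add: u_def[symmetric] U_def[symmetric] t1[symmetric] cp efix ffix ur sh fixe(2)[OF efix] cj_fix_sym[OF cp(8)])
  \<comment> \<open>The mirror image of \<open>W1\<close>, with \<open>a\<close> and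
    \<open>r\<close> exchanged, obtained from the results for \<open>x\<^sup>-\<close>.\<close>
  have W2: "W\<^sup>- = f\<^sup>- * u * U\<^sup>- * U\<^sup>- * U\<^sup>- * f'\<^sup>- * e' * e' * e' * e' * e'"
  proof -
    define t' where "t' = q\<^sup>- * r * q\<^sup>- * a"
    have t'_eq: "t' = [[a; x\<^sup>-]; x\<^sup>-] \<up> x \<up> x"
      by (simp add: t'_def cm_eq_cj cj_by_mult ax qx p1x mult.assoc flip: p1_def)
    have "[[a; x\<^sup>-]; x\<^sup>-] \<up> a \<up> x \<up> x = ([[a; x\<^sup>-]; x\<^sup>-] * [a; p1]\<^sup>- * [p1; p1 \<up> x\<^sup>-] *
        [[p1; p1 \<up> x\<^sup>-]; p1]\<^sup>-) \<up> x \<up> x"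
      using sh'(3) by simp
    then have "t' \<up> r = t' * [r; q]\<^sup>- * [q; a] * [[q; a]; q]\<^sup>-"
      by (simp only: sh2 cj_mult cj_minv cj_cm[of a p1] cj_cm[of q] cj_cm[of p1] cj_cm[of "[_; _]" p1]
          cj_cm[of _ q] cj_cm[of _ "p1 \<up> x\<^sup>-"] cj_cm[of _ a] p1x cj_cj_minv ax qx flip: t'_eq)
    then have t'r: "t' \<up> r = t' * [r; q]\<^sup>- * [q; a] * h\<^sup>-"
      by (simp add: h_def u_def cm_minv)
    have rq: "[r; q] = U\<^sup>-" and qa: "[q; a] = u\<^sup>-" and ra: "[r; a] = W\<^sup>-"
      by (simp_all add: U_def u_def W_def cm_minv)
    have "[r; a] = h * [q; a]\<^sup>- * [r; q] * [r; q] * [r; q] * f'\<^sup>- * e'\<^sup>-\<^sup>- * e'\<^sup>-\<^sup>- * e'\<^sup>-\<^sup>- * e'\<^sup>-\<^sup>- * e'\<^sup>-\<^sup>-"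
    proof (rule engel_W)
      show "(q\<^sup>- * r * q\<^sup>- * a) \<up> r = q\<^sup>- * r * q\<^sup>- * a * [r; q]\<^sup>- * [q; a] * h\<^sup>-"
        using t'r by (simp only: t'_def)
    qed (simp_all add: rq Ua Uq Ur e'_fix f'_fix rules fixu[OF e'_fix] fixu[OF f'_fix] cj_fix_sym cj_fix_minv fixe(3)[OF f'_fix])
    then show ?thesis
      by (simp add: rq qa ra hf)
  qed
  have W2': "W = (f\<^sup>- * u * U\<^sup>- * U\<^sup>- * U\<^sup>- * f'\<^sup>- * e' * e' * e' * e' * e')\<^sup>-"
    by (metis W2 minv_minv)
  \<comment> \<open>The two expressions for \<open>W\<close> must respond equally to conjugation by
    \<open>q\<close>, and likewise by \<open>a\<close> and \<open>r\<close> below.\<close>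
  have q1: "f * (f * (f * e'\<^sup>-)) = f\<^sup>- * (e' * (e' * e'))"
  proof -
    have "W\<^sup>- * W \<up> q = f * (f * (f * e'\<^sup>-))"
      unfolding W1 by (simp add: cp(2) Uq efix ffix e'_fix f'_fix rules mult.assoc)
    moreover have "W\<^sup>- * W \<up> q = f\<^sup>- * (e' * (e' * e'))"
      unfolding W2' by (simp add: cp(2) Uq efix ffix e'_fix f'_fix rules mult.assoc)
    ultimately show ?thesis by simp
  qed
  have q2: "e * (e * (e * e')) = e\<^sup>- * (e'\<^sup>- * (e'\<^sup>- * e'\<^sup>-))"
  proof -
    have "W\<^sup>- * W \<up> a = e * (e * (e * e'))"
      unfolding W1 by (simp add: cp(1) Ua efix ffix e'_fix f'_fix rules mult.assoc)
    moreover have "W\<^sup>- * W \<up> a = e\<^sup>- * (e'\<^sup>- * (e'\<^sup>- * e'\<^sup>-))"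
      unfolding W2' by (simp add: cp(1) Ua efix ffix e'_fix f'_fix rules mult.assoc)
    ultimately show ?thesis by simp
  qed
  have q3: "f\<^sup>- * (f\<^sup>- * (f\<^sup>- * f'\<^sup>-)) = f * (f' * (f' * f'))"
  proof -
    have "W\<^sup>- * W \<up> r = f\<^sup>- * (f\<^sup>- * (f\<^sup>- * f'\<^sup>-))"
      unfolding W1 by (simp add: ur Ur efix ffix e'_fix f'_fix rules mult.assoc)
    moreover have "W\<^sup>- * W \<up> r = f * (f' * (f' * f'))"
      unfolding W2' by (simp add: ur Ur efix ffix e'_fix f'_fix rules mult.assoc)
    ultimately show ?thesis by simp
  qed
  \<comment> \<open>\<open>k\<close> has weight 4, so its commutators with \<open>a\<close>,
    \<open>q\<close> and \<open>r\<close> have weight 5 and \<open>tf4\<close> applies to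
    them.\<close>
  define k where "k = u\<^sup>- * U"
  have "k = [u; x]" by (simp add: k_def cm_eq_cj ux)
  then have k4: "lcs S 4 k"
    using aS x by (simp add: u_def q_def lcs_4_conj)
  have qS: "q \<in> S" "r \<in> S" using aS x by (simp_all add: q_def r_def)
  have lk: "lcs S 5 [k; g]" if "g \<in> S" for g
    using lcs_cm[OF k4 that] by (simp add: eval_nat_numeral)
  have kq: "[k; q] = f\<^sup>- * e'" and ka: "[k; a] = e\<^sup>- * e'\<^sup>-" and kr: "[k; r] = f * f'"
    by (simp_all add: k_def cm_eq_cj cp(1,2) ur Ua Uq Ur rules mult.assoc)
  have "[k; q] = 1"
  proof (rule tf4)
    have "f\<^sup>- * (f\<^sup>- * (f\<^sup>- * (f\<^sup>- * (e' * (e' * e'))))) * e' = 1"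
      unfolding q1[symmetric] by (simp add: rules mult.assoc)
    then show "[k; q] * ([k; q] * ([k; q] * [k; q])) = 1"
      unfolding kq by (simp add: rules mult.assoc)
  qed (rule lk[OF qS(1)])
  then have e'1: "e' = f" unfolding kq by (metis minv_unique minv_minv)
  have "[k; a] = 1"
  proof (rule tf4)
    have "e\<^sup>- * (e\<^sup>- * (e\<^sup>- * (e\<^sup>- * (e'\<^sup>- * (e'\<^sup>- * e'\<^sup>-))))) * e'\<^sup>- = 1"
      unfolding q2[symmetric] by (simp add: rules mult.assoc)
    then show "[k; a] * ([k; a] * ([k; a] * [k; a])) = 1"
      unfolding ka by (simp add: rules mult.assoc)
  qed (rule lk[OF aS])
  then have e'2: "e' = e\<^sup>-" unfolding ka by (metis minv_unique minv_minv)
  have "[k; r] = 1"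
  proof (rule tf4)
    have "f * (f * (f * (f * (f' * (f' * f'))))) * f' = 1"
      unfolding q3[symmetric] by (simp add: rules mult.assoc)
    then show "[k; r] * ([k; r] * ([k; r] * [k; r])) = 1"
      unfolding kr by (simp add: rules mult.assoc)
  qed (rule lk[OF qS(2)])
  then have "f' = f\<^sup>-" unfolding kr by (metis minv_unique)
  then have f'1: "f' = e" using e'1 e'2 by (metis minv_minv)
  have f1: "f = e\<^sup>-" using e'1 e'2 by simp
  show "e \<up> a = e" "e \<up> q = e" "e \<up> r = e" using efix .
  show "u \<up> a = u * e" "u \<up> q = u * e\<^sup>-" "u \<up> r = u * e"
    using cp(1,2) ur by (simp_all add: f1)
  show "e \<up> x = e\<^sup>-" using e'2 by (simp add: e'_def)
  note R = cj_fix_rules[OF fixu(1)[OF efix]] cj_fix_rules[OF fixu(2)[OF efix]] cj_fix_rules[OF uU]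
  show "[a; r] = U\<^sup>- * u * u * u * e * e * e * e * e"
    using W1 by (simp add: W_def[symmetric] e'2 f1 f'1 R mult.assoc)
  show "[a; r] = u\<^sup>- * U * U * U * e * e * e * e * e"
    using W2' by (simp add: W_def[symmetric] e'2 f1 f'1 R mult.assoc)
  show "t \<up> a = t * u\<^sup>- * U * e"
    using sh(3) by (simp add: e'2)
  show "U \<up> a = U * e" "U \<up> r = U * e"
    using Ua Ur by (simp_all add: e'2 f'1)
  show "e \<up> u = e" "e \<up> U = e" "u \<up> U = u"
    using fixu[OF efix] uU .
qed

text \<open>\<open>R3_conj_center\<close> for \<open>x * x\<close> gives a second description of the
  action on \<open>W = [a; r]\<close>. It forces \<open>e\<close> to have order dividing 4 and,
  since \<open>[e; x]\<close> has weight 5, order dividing 2. Equating the two formulas for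
  \<open>W\<close> gives the fourth power of \<open>k\<close>.\<close>

lemma R3_struct:
  assumes a: "a \<in> R3" and x: "x \<in> S"
  defines "t \<equiv> [[a; x]; x]" and "u \<equiv> [a; a \<up> x]"
  defines "e \<equiv> [u; a]" and "k \<equiv> [u; x]"
  shows "e * e = 1" "e \<up> a = e" "e \<up> x = e" "k \<up> a = k" "k \<up> x = k" "k * (k * (k * k)) = 1"
    "t \<up> a = t * k * e" "t \<up> [a; x] = t"
proof -
  have aS: "a \<in> S" using a by (rule R3_mem)
  define q where "q = a \<up> x"
  define r where "r = a \<up> x \<up> x"
  define U where "U = [q; r]"
  define W where "W = [a; r]"
  have ax: "a \<up> x = q" and qx: "q \<up> x = r" and ux: "u \<up> x = U"
    by (simp_all add: q_def r_def u_def U_def cj_cm)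
  note C = R3_conj_center[OF a x, folded q_def r_def t_def, folded U_def u_def[folded q_def], folded e_def]
  note rules = cj_fix_rules[OF C(13)] cj_fix_rules[OF C(14)] cj_fix_rules[OF C(15)]
  have ei: "c \<up> y = c \<Longrightarrow> c\<^sup>- \<up> y = c\<^sup>-" for c y by simp
  note D = R3_conj_center[OF a mult_mem[OF x x], unfolded cj_by_mult, folded r_def, folded W_def]
  have Wa: "W \<up> a = W * (e * e)"
    unfolding W_def C(8) by (simp add: C rules mult.assoc)
  have Wr: "W \<up> r = W * (e * e)"
    unfolding W_def C(8) by (simp add: C rules mult.assoc)
  have "[W; a] = e * e" using Wa by (simp add: cm_eq_cj)
  then have "W * (e * e) = W * (e * e)\<^sup>-"
    using D(5) Wr by simp
  then have e4: "e * e = e\<^sup>- * e\<^sup>-" by simp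
  have "[e; x] = 1"
  proof (rule tf2)
    have "lcs S 4 e" unfolding e_def u_def using aS x by (intro lcs_4_conj)
    from lcs_cm[OF this x] show "lcs S 5 [e; x]" by simp
    have "[e; x] = e * e" by (simp add: cm_eq_cj C(7) e4)
    moreover have "e * e * (e * e) = 1" by (subst (2) e4) (simp add: mult.assoc)
    ultimately show "[e; x] * [e; x] = 1" by simp
  qed
  then show ex: "e \<up> x = e" by (simp add: cm_eq_1_iff)
  then have ei: "e\<^sup>- = e" using C(7) by simp
  then show ee: "e * e = 1" using minv_right[of e] by (simp only: ei)
  have ee': "e * (e * y) = y" for y by (metis ee mult.assoc mult_1_left)
  show "e \<up> a = e" by (rule C(1))
  have k: "k = u\<^sup>- * U" by (simp add: k_def cm_eq_cj ux)
  show ka: "k \<up> a = k"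
    by (simp add: k C ei rules mult.assoc ee ee')
  have Uq: "U \<up> q = U * e"
    using arg_cong[OF C(4), of "\<lambda>y. y \<up> x"] by (simp add: cj_cj[of u] ux ax ex)
  have kq: "k \<up> q = k"
    by (simp add: k C Uq ei rules mult.assoc ee ee')
  have kr: "k \<up> r = k"
    by (simp add: k C ei rules mult.assoc ee ee')
  have ku: "e \<up> k = e" by (simp add: k cj_by_mult C cj_fix_minv)
  have "U\<^sup>- * (u * (u * u)) = u\<^sup>- * (U * (U * U))"
    using C(8,9) by (simp add: mult.assoc flip: mult.assoc)
  then have "U\<^sup>- * (u * (u * u)) * (u * (U\<^sup>- * (U\<^sup>- * U\<^sup>-))) = 1"
    by (simp add: rules mult.assoc)
  then have "k\<^sup>- * (k\<^sup>- * (k\<^sup>- * k\<^sup>-)) = 1"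
    by (simp add: k rules mult.assoc)
  then have "(k * (k * (k * k)))\<^sup>- = 1" by (simp add: mult.assoc)
  then show k4: "k * (k * (k * k)) = 1" by (simp only: minv_eq_1_iff)
  show ta: "t \<up> a = t * k * e"
    using C(10) by (simp add: k mult.assoc)
  have tx: "t \<up> x = t" unfolding t_def using R3_fix[OF a x] .
  define k' where "k' = k \<up> x"
  have tq: "t \<up> q = t * k' * e"
    using arg_cong[OF ta, of "\<lambda>y. y \<up> x"] by (simp add: cj_cj[of t] tx ax ex k'_def)
  have ta': "t \<up> a\<^sup>- = t * k\<^sup>- * e"
    by (rule cj_invI) (simp add: ta ka C(1) cj_fix_rules[OF ku] mult.assoc ee)
  have t1: "t = q\<^sup>- * a * q\<^sup>- * r"
    unfolding t_def cm_eq_cj[of "[a; x]" x] by (simp add: cm_eq_cj[of a x] ax qx mult.assoc)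
  have kt: "k \<up> t = k"
    unfolding t1 cj_by_mult by (simp add: ka kq kr cj_fix_minv)
  \<comment> \<open>The word for \<open>t\<close> is solved for its letter \<open>a\<close>, so that
    \<open>k'\<close>, which commutes with \<open>q\<close>, \<open>r\<close> and \<open>t\<close>,
    is seen to commute with \<open>a\<close>.\<close>
  have a_word: "a = q * t * r\<^sup>- * q" by (simp add: t1 mult.assoc)
  have k'q: "k' \<up> q = k'" and k'r: "k' \<up> r = k'" and k't: "k' \<up> t = k'"
    using cj_fix_cj[OF ka, of x] cj_fix_cj[OF kq, of x] cj_fix_cj[OF kt, of x]
    by (simp_all add: k'_def ax qx tx)
  have k'a: "k' \<up> a = k'"
    by (subst a_word) (simp only: cj_by_mult k'q k'r k't cj_fix_minv)
  have "k' \<up> u = k'" "k' \<up> U = k'"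
    using k'a k'q k'r by (simp_all add: u_def[folded q_def] U_def cj_fix_cm)
  then have k'k: "k' \<up> k = k'"
    by (simp add: k cj_by_mult cj_fix_minv)
  note krules = cj_fix_rules[OF k'k]
  have k'4: "k' * (k' * (k' * k')) = 1"
    using arg_cong[OF k4, of "\<lambda>y. y \<up> x"] by (simp add: k'_def)
  have ki4: "k\<^sup>- * (k\<^sup>- * (k\<^sup>- * k\<^sup>-)) = 1"
    using arg_cong[OF k4, of minv] by (simp add: mult.assoc)
  have "[k; x] = 1"
  proof (rule tf4)
    have "lcs S 4 k" unfolding k_def u_def using aS x by (intro lcs_4_conj)
    from lcs_cm[OF this x] show "lcs S 5 [k; x]" by simp
    have kx: "[k; x] = k\<^sup>- * k'" by (simp add: cm_eq_cj k'_def)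
    have "[k; x] * ([k; x] * ([k; x] * [k; x])) =
        k\<^sup>- * (k\<^sup>- * (k\<^sup>- * k\<^sup>-)) * (k' * (k' * (k' * k')))"
      by (simp add: kx krules mult.assoc)
    then show "[k; x] * ([k; x] * ([k; x] * [k; x])) = 1"
      by (simp add: k'4 ki4)
  qed
  then show kx: "k \<up> x = k" by (simp add: cm_eq_1_iff)
  have "t \<up> [a; x] = t \<up> a\<^sup>- \<up> q"
    by (simp add: cm_eq_cj[of a x] ax cj_by_mult)
  also have "\<dots> = t * (k * e) * (k\<^sup>- * e)"
    using kx by (simp add: ta' tq kq C(2) k'_def mult.assoc)
  also have "\<dots> = t"
    by (simp add: mult.assoc cj_fix_rules[OF ku] ee ee')
  finally show "t \<up> [a; x] = t" .
qed

text \<open>Since \<open>c\<close> commutes with \<open>g\<close> and with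
  \<open>v = [a; g]\<close>, these two generate a group of class at most 2. The claim says that
  \<open>g\<close> commutes with its conjugate by \<open>[a\<^sup>-; g]\<close>; conjugation by
  \<open>a\<close> turns the two elements into \<open>g * v\<^sup>-\<close> and
  \<open>g * v\<^sup>- * c\<close>.\<close>

lemma R3_minv:
  assumes a: "a \<in> R3"
  shows "a\<^sup>- \<in> R3"
proof -
  have "[[[a\<^sup>-; g]; g]; g] = 1" if g: "g \<in> S" for g
  proof -
    define v where "v = [a; g]"
    define c where "c = [v; g]"
    have cg: "c \<up> g = c" unfolding c_def v_def using R3_fix[OF a g] .
    have cv: "c \<up> v = c" unfolding c_def v_def using R3_struct(8)[OF a g] .
    note rules = cj_fix_rules[OF cg] cj_fix_rules[OF cv]
    have ga: "g \<up> a = g * v\<^sup>-" by (simp add: v_def cm_minv cj_eq_mult_cm)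
    have gv: "v * g = g * v * c" by (simp add: c_def cm_def mult.assoc)
    have gv': "v * (g * y) = g * (v * (c * y))" for y by (simp add: gv flip: mult.assoc)
    have y: "[a\<^sup>-; g] = a * v\<^sup>- * a\<^sup>-"
      by (simp add: v_def cm_def mult.assoc)
    have "(g * v\<^sup>-) \<up> (v * g * v\<^sup>- * v\<^sup>-) = g * v\<^sup>-"
      unfolding cj_fix_iff by (simp add: gv' rules mult.assoc)
    moreover have "v * g * v\<^sup>- * v\<^sup>- = g \<up> (a * v\<^sup>-)"
      by (simp add: cj_by_mult ga) (simp add: cj_def mult.assoc)
    ultimately have "g \<up> a \<up> (g \<up> [a\<^sup>-; g] \<up> a) = g \<up> a"
      by (simp add: ga[symmetric] y cj_by_mult)
    then have "g \<up> (g \<up> [a\<^sup>-; g]) = g"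
      by (simp flip: cj_cj)
    then show ?thesis by (simp add: cm_cm_eq_1_iff)
  qed
  then show ?thesis
    using R3_mem[OF a] by (simp add: R3_def)
qed

text \<open>The commutator \<open>c = [r; y]\<close> has weight 5 and is inverted by
  \<open>y\<close>. The Engel identity at \<open>y\<close> says that \<open>y\<close> fixes
  \<open>[c; y]\<close>, which is the inverse square of \<open>c\<close>; hence the fourth power of
  \<open>c\<close> is trivial.\<close>

lemma R3_fix_sqrt:
  assumes r: "r \<in> R3" and y: "lcs S 4 y" and fix2: "r \<up> (y * y) = r"
  shows "r \<up> y = r"
proof -
  define c where "c = [r; y]"
  have rS: "r \<in> S" and yS: "y \<in> S" using R3_mem[OF r] lcs_mem[OF y] .
  have "lcs S (1 + 4) c"
    unfolding c_def using y rS by (intro lcs_cm_add) (auto intro: lcs_base)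
  then have c5: "lcs S 5 c" by simp
  have ry: "r \<up> y = r * c" by (simp add: c_def cj_eq_mult_cm)
  have "r * c * c \<up> y = r"
    using fix2 by (simp add: cj_by_mult ry)
  then have cy: "c \<up> y = c\<^sup>-" by (simp add: mult.assoc) (metis minv_unique)
  have "[c; y] \<up> y = [c; y]"
    unfolding c_def using R3_fix[OF r yS] .
  then have "c * c = c\<^sup>- * c\<^sup>-"
    by (simp add: cm_eq_cj cy)
  then have "c * (c * (c * c)) = c * (c * (c\<^sup>- * c\<^sup>-))" by simp
  also have "\<dots> = 1" by (simp add: mult.assoc)
  finally have "c = 1" by (intro tf4[OF c5])
  then show ?thesis by (simp add: ry)
qed

lemma fix_R3_cj:
  assumes "\<forall>r \<in> R3. y \<up> r = y" "w \<in> S"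
  shows "\<forall>r \<in> R3. y \<up> w \<up> r = y \<up> w"
proof
  fix r assume "r \<in> R3"
  then have "y \<up> (r \<up> w\<^sup>-) = y"
    using assms by (simp add: R3_cj)
  from cj_fix_cj[OF this, of w] show "y \<up> w \<up> r = y \<up> w" by simp
qed

text \<open>The second premise puts \<open>y\<close> into the double centralizer of the right 3-Engel
  elements, so that \<open>y\<close> commutes with its conjugates as soon as it centralizes them.\<close>
lemma R3_fix_central:
  assumes y: "lcs S 4 y" and word: "\<And>z. \<forall>r \<in> R3. z \<up> r = z \<Longrightarrow> z \<up> y = z"
    and pow: "\<And>w. w \<in> S \<Longrightarrow> (y * (y * (y * y))) \<up> w = y * (y * (y * y))" and w: "w \<in> S"
  shows "y \<up> w = y"
proof -
  have "y \<up> r = y" if r: "r \<in> R3" for r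
  proof -
    \<comment> \<open>Two square roots are extracted in the centralizer of \<open>r\<close>,
      starting from the central fourth power of \<open>y\<close>.\<close>
    have "r \<up> (y * y * (y * y)) = r"
      using cj_fix_sym[OF pow[OF R3_mem[OF r]]] by (simp add: mult.assoc)
    then have "r \<up> (y * y) = r"
      by (rule R3_fix_sqrt[OF r lcs_mult[OF y y]])
    then have "r \<up> y = r"
      by (rule R3_fix_sqrt[OF r y])
    then show ?thesis by (rule cj_fix_sym)
  qed
  then have yw: "y \<up> w \<up> y = y \<up> w"
    using w by (intro word fix_R3_cj) auto
  define z where "z = y \<up> w"
  have "[y; w] = 1"
  proof (rule tf4)
    show "lcs S 5 [y; w]" using lcs_cm[OF y w] by simp
    have yz: "y\<^sup>- * z = z * y\<^sup>-" "y\<^sup>- * (z * c) = z * (y\<^sup>- * c)" for c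
      by (simp_all add: z_def cj_fix_rules(5,6)[OF yw])
    have "[y; w] * ([y; w] * ([y; w] * [y; w])) = z * (z * (z * z)) * (y * (y * (y * y)))\<^sup>-"
      by (simp add: cm_eq_cj yz mult.assoc flip: z_def)
    also have "z * (z * (z * z)) = y * (y * (y * y))"
      using pow[OF w] by (simp add: z_def)
    finally show "[y; w] * ([y; w] * ([y; w] * [y; w])) = 1"
      by (simp only: minv_right)
  qed
  then show ?thesis by (simp add: cm_eq_1_iff)
qed

text \<open>Both elements are words in conjugates of \<open>a\<close>, have weight 4 and trivial
  fourth power. Their centrality is what allows the class 2 argument to ignore them in the central
  quotient.\<close>

lemma R3_central:
  assumes a: "a \<in> R3" and x: "x \<in> S" and w: "w \<in> S"
  shows "[[a; a \<up> x]; a] \<up> w = [[a; a \<up> x]; a]"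
    and "[[a; a \<up> x]; x] \<up> w = [[a; a \<up> x]; x]"
proof -
  have aS: "a \<in> S" using a by (rule R3_mem)
  note P = R3_struct[OF a x]
  have ax: "a \<up> x \<in> R3" "a \<up> x \<up> x \<in> R3" using a x by (simp_all add: R3_cj)
  show "[[a; a \<up> x]; a] \<up> w = [[a; a \<up> x]; a]" (is "?e \<up> w = _")
  proof (rule R3_fix_central[OF _ _ _ w])
    show "lcs S 4 ?e" using aS x by (intro lcs_4_conj)
    show "z \<up> ?e = z" if "\<forall>r \<in> R3. z \<up> r = z" for z
      using that a ax by (intro cj_fix_cm) auto
    show "(?e * (?e * (?e * ?e))) \<up> v = ?e * (?e * (?e * ?e))" for v
      by (simp add: P(1))
  qed
  show "[[a; a \<up> x]; x] \<up> w = [[a; a \<up> x]; x]" (is "?k \<up> w = _")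
  proof (rule R3_fix_central[OF _ _ _ w])
    show "lcs S 4 ?k" using aS x by (intro lcs_4_conj)
    have k: "?k = [a; a \<up> x]\<^sup>- * [a \<up> x; a \<up> x \<up> x]"
      by (simp add: cm_eq_cj[of "[a; a \<up> x]"] cj_cm)
    show "z \<up> ?k = z" if "\<forall>r \<in> R3. z \<up> r = z" for z
      unfolding k cj_by_mult using that a ax by (simp add: cj_fix_cm cj_fix_minv)
    show "(?k * (?k * (?k * ?k))) \<up> v = ?k * (?k * (?k * ?k))" for v
      by (simp only: P(6) cj_one)
  qed
qed

end

section \<open>Conjugacy classes of class two\<close>

text \<open>The hypotheses on the class \<open>C\<close> below hold for the images of the conjugates of a right
  3-Engel element in the central quotient.\<close>
locale conj_class3 = subgrp +
  fixes C
  assumes C_mem: "p \<in> C \<Longrightarrow> p \<in> S"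
    and C_cj: "p \<in> C \<Longrightarrow> g \<in> S \<Longrightarrow> p \<up> g \<in> C"
    and C_u: "p \<in> C \<Longrightarrow> g \<in> S \<Longrightarrow> [p; p \<up> g] \<up> p = [p; p \<up> g]"
      "p \<in> C \<Longrightarrow> g \<in> S \<Longrightarrow> [p; p \<up> g] \<up> g = [p; p \<up> g]"
    and C_t: "p \<in> C \<Longrightarrow> g \<in> S \<Longrightarrow> [[p; g]; g] \<up> p = [[p; g]; g]"
      "p \<in> C \<Longrightarrow> g \<in> S \<Longrightarrow> [[p; g]; g] \<up> g = [[p; g]; g]"
    and C_tf: "p \<in> C \<Longrightarrow> g \<in> S \<Longrightarrow> h \<in> S \<Longrightarrow>
      [p \<up> g; [p; p \<up> h]] * [p \<up> g; [p; p \<up> h]] = 1 \<Longrightarrow> [p \<up> g; [p; p \<up> h]] = 1"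
begin

text \<open>The commutator of \<open>a\<close> and \<open>a \<up> y\<close> only depends on \<open>a \<up> y\<close>, and
  \<open>a \<up> y = a \<up> (c * y)\<close> for \<open>c\<close> in the centralizer of \<open>a\<close>.\<close>
lemma u_fix_centralizer:
  assumes a: "a \<in> C" and y: "y \<in> S" and c: "c \<in> S" "a \<up> c = a"
  shows "[a; a \<up> y] \<up> c = [a; a \<up> y]"
proof -
  have "[a; a \<up> (c * y)] \<up> (c * y) = [a; a \<up> (c * y)]"
    using a y c by (intro C_u) auto
  then have "[a; a \<up> y] \<up> c \<up> y = [a; a \<up> y] \<up> y"
    using C_u(2)[OF a y] by (simp add: cj_by_mult c)
  then show ?thesis by simp
qed

lemma u_fix_right: "a \<in> C \<Longrightarrow> y \<in> S \<Longrightarrow> [a; a \<up> y] \<up> (a \<up> y) = [a; a \<up> y]"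
  using cj_fix_cj[OF C_u(1)[of a y], of y] C_u(2)[of a y] by simp

text \<open>As \<open>m\<close> commutes with \<open>a\<close>, \<open>m * x\<close> has the same
  commutator \<open>v\<close> with \<open>a\<close> as \<open>x\<close>. Since \<open>t\<close>
  centralizes \<open>a\<close>, it commutes with \<open>m\<close>, so \<open>C_t\<close> at
  \<open>m * x\<close> and at \<open>x\<close> differ only by a conjugate of
  \<open>[a \<up> x; m]\<close>.\<close>

lemma psi_core:
  assumes a: "a \<in> C" and x: "x \<in> S" and y: "y \<in> S"
  defines "m \<equiv> [a; a \<up> y]"
  shows "[a \<up> x; m] \<up> (x * m) = [a \<up> x; m]"
proof -
  define v where "v = [a; x]"
  define t where "t = [v; x]"
  have S: "a \<in> S" "m \<in> S" "t \<in> S" using C_mem[OF a] x y by (simp_all add: m_def t_def v_def)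
  have am: "a \<up> m = a" unfolding m_def using C_u(1)[OF a y] by (rule cj_fix_sym)
  have "a \<up> t = a" unfolding t_def v_def using C_t(1)[OF a x] by (rule cj_fix_sym)
  then have tm: "t \<up> m = t"
    unfolding m_def using u_fix_centralizer[OF a y S(3)] by (intro cj_fix_sym[of _ t])
  have tx: "t \<up> x = t" unfolding t_def v_def using C_t(2)[OF a x] .
  have "[a; m * x] = v"
    using am by (simp add: v_def cm_mult_right cm_eq_1_iff[of a m, THEN iffD2])
  moreover have "[v; m] = [a \<up> x; m]"
    using am by (simp add: v_def cm_eq_cj[of a x] cm_mult_left cm_eq_1_iff[of "a\<^sup>-" m, THEN iffD2])
  ultimately have "[[a; m * x]; m * x] = t * [a \<up> x; m] \<up> x"
    by (simp add: cm_mult_right[of v] t_def)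
  then have "(t * [a \<up> x; m] \<up> x) \<up> m \<up> x = t * [a \<up> x; m] \<up> x"
    using C_t(2)[OF a, of "m * x"] S x by (simp add: cj_by_mult)
  then show ?thesis by (simp add: tm tx cj_by_mult)
qed

text \<open>\<open>\<psi>\<close> does not change when \<open>x\<close> is replaced by
  \<open>c * x\<close> with \<open>c\<close> centralizing \<open>a\<close>; comparing
  \<open>psi_core\<close> for both shows that \<open>c\<close> fixes it. The choice
  \<open>c = m\<close> then separates the action of \<open>x\<close> from that of
  \<open>m\<close>.\<close>

lemma psi_fix:
  assumes a: "a \<in> C" and x: "x \<in> S" and y: "y \<in> S"
  defines "m \<equiv> [a; a \<up> y]"
  defines "\<psi> \<equiv> [a \<up> x; m]"
  shows "c \<in> S \<Longrightarrow> a \<up> c = a \<Longrightarrow> \<psi> \<up> c = \<psi>" and "\<psi> \<up> m = \<psi>" and "\<psi> \<up> x = \<psi>"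
    and "\<psi> \<up> a = \<psi>" and "\<psi> \<up> (a \<up> x) = \<psi>"
proof -
  have S: "a \<in> S" "m \<in> S" using C_mem[OF a] x y by (simp_all add: m_def)
  show 1: "\<psi> \<up> c = \<psi>" if c: "c \<in> S" "a \<up> c = a" for c
  proof -
    have "\<psi> \<up> (c * x * m) = \<psi>"
      unfolding \<psi>_def m_def using psi_core[OF a _ y, of "c * x"] c x by (simp add: cj_by_mult[of a c x])
    moreover have "\<psi> \<up> (x * m) = \<psi>"
      unfolding \<psi>_def m_def using psi_core[OF a x y] .
    ultimately have "\<psi> \<up> c \<up> (x * m) = \<psi> \<up> (x * m)"
      by (simp add: cj_by_mult)
    then show ?thesis by simp
  qed
  have am: "a \<up> m = a" unfolding m_def using C_u(1)[OF a y] by (rule cj_fix_sym)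
  show m: "\<psi> \<up> m = \<psi>" using 1[OF S(2) am] .
  have "\<psi> \<up> x \<up> m = \<psi> \<up> m"
    using psi_core[OF a x y] m by (simp add: \<psi>_def m_def cj_by_mult)
  then show x: "\<psi> \<up> x = \<psi>" by simp
  show aa: "\<psi> \<up> a = \<psi>" using 1[OF S(1)] by simp
  show "\<psi> \<up> (a \<up> x) = \<psi>" using cj_fix_cj[OF aa, of x] x by simp
qed

text \<open>This is \<open>C_t\<close> at \<open>x * h\<close>, conjugated by
  \<open>h\<^sup>-\<close>, which turns \<open>a\<close> into \<open>a * [a; h]\<^sup>-\<close>; all
  factors but the conjugate of \<open>[a \<up> x; h]\<close> cancel. Keeping \<open>h\<close>
  general lets it be a conjugate of \<open>a\<close> as well as the inverse of one.\<close>

lemma psi_square_aux: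
  assumes a: "a \<in> C" and x: "x \<in> S" and h: "h \<in> S"
    and am: "a \<up> [a; h] = a" and mh: "[a; h] \<up> h = [a; h]"
    and ca: "[a \<up> x; [a; h]] \<up> a = [a \<up> x; [a; h]]"
    and cm: "[a \<up> x; [a; h]] \<up> [a; h] = [a \<up> x; [a; h]]"
    and tm: "[[a; x]; x] \<up> [a; h] = [[a; x]; x]"
  shows "[a \<up> x; h] \<up> x \<up> (a * [a; h]\<^sup>-) = [a \<up> x; h] \<up> x"
proof -
  define m where "m = [a; h]"
  define q where "q = a \<up> x"
  define c where "c = [q; m]"
  define n where "n = [q; h]"
  define t where "t = [[a; x]; x]"
  note H = am mh ca cm tm
  note H' = H[folded q_def m_def, folded c_def t_def]
  have ta: "t \<up> a = t" unfolding t_def using C_t(1)[OF a x] .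
  have ah: "a \<up> h = a * m" and qh: "q \<up> h = q * n" by (simp_all add: m_def n_def cj_eq_mult_cm)
  have mh': "m \<up> h\<^sup>- = m" using H'(2) by (rule cj_fix_minv)
  have ah': "a \<up> h\<^sup>- = a * m\<^sup>-" by (rule cj_invI) (simp add: ah H'(2))
  have mq: "m \<up> q = m * c\<^sup>-" by (simp add: c_def cm_minv cj_eq_mult_cm[of m q])
  have a2: "q \<up> x = q * a\<^sup>- * q * t"
    by (simp add: t_def q_def cm_eq_cj cj_by_mult mult.assoc)
  define g where "g = [a; x * h]"
  have g: "g = a\<^sup>- * q * n"
    by (simp add: g_def cm_eq_cj cj_by_mult ah qh mult.assoc flip: q_def)
  have g': "g \<up> h\<^sup>- = m * a\<^sup>- * q"
    by (rule cj_invI) (simp add: g ah qh H'(2) mult.assoc)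
  have "[g; x * h] \<up> a = [g; x * h]"
    unfolding g_def using C_t(1)[OF a, of "x * h"] x h by simp
  from cj_fix_cj[OF this, of "h\<^sup>-"]
  have "[g; x * h] \<up> h\<^sup>- \<up> (a * m\<^sup>-) = [g; x * h] \<up> h\<^sup>-" by (simp only: ah')
  moreover have "[g; x * h] \<up> h\<^sup>- = (m \<up> q)\<^sup>- * t * n \<up> x"
  proof -
    have "[g; x * h] \<up> h\<^sup>- = (g \<up> h\<^sup>-)\<^sup>- * g \<up> x"
      by (simp add: cm_eq_cj cj_by_mult)
    also have "g \<up> x = q\<^sup>- * (q \<up> x) * n \<up> x" by (simp add: g q_def)
    also have "(g \<up> h\<^sup>-)\<^sup>- * (q\<^sup>- * (q \<up> x) * n \<up> x) = q\<^sup>- * (a * m\<^sup>- * a\<^sup>-) * q * t * n \<up> x"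
      by (simp add: g' a2 mult.assoc)
    also have "a * m\<^sup>- * a\<^sup>- = m\<^sup>-"
      using H'(1) cj_fix_rules(5)[of a m] by (simp add: mult.assoc)
    finally show ?thesis by (simp add: cj_def[of m q] mult.assoc)
  qed
  ultimately have "(m \<up> q)\<^sup>- \<up> (a * m\<^sup>-) * t \<up> (a * m\<^sup>-) * n \<up> x \<up> (a * m\<^sup>-) = (m \<up> q)\<^sup>- * t * n \<up> x"
    by (simp only: cj_mult)
  moreover have "(m \<up> q)\<^sup>- \<up> (a * m\<^sup>-) = (m \<up> q)\<^sup>-" "t \<up> (a * m\<^sup>-) = t"
    using H' ta by (simp_all add: cj_by_mult mq cj_fix_minv cj_fix_sym)
  ultimately show ?thesis by (simp add: n_def q_def m_def mult.assoc)
qed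

text \<open>With \<open>r = a \<up> y\<close> and its inverse as \<open>h\<close>,
  \<open>n \<up> x\<close> is fixed by \<open>a * m\<^sup>-\<close> and \<open>a * m\<close>, hence
  by the square of \<open>a\<close>. So \<open>[a; n \<up> x]\<close> has trivial square, and it has
  the shape covered by \<open>C_tf\<close>.\<close>

lemma psi_square:
  assumes a: "a \<in> C" and x: "x \<in> S" and y: "y \<in> S"
  shows "[a; [a \<up> x \<up> x; a \<up> y \<up> x]] = 1"
proof -
  define m where "m = [a; a \<up> y]"
  define q where "q = a \<up> x"
  define r where "r = a \<up> y"
  define n where "n = [q; r]"
  define t where "t = [[a; x]; x]"
  have S: "a \<in> S" "m \<in> S" "t \<in> S" "q \<in> S" "r \<in> S" using C_mem[OF a] x y by (simp_all add: m_def t_def q_def r_def)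
  have q: "q \<in> C" unfolding q_def using a x by (rule C_cj)
  have am: "a \<up> m = a" unfolding m_def using C_u(1)[OF a y] by (rule cj_fix_sym)
  have at: "a \<up> t = a" unfolding t_def using C_t(1)[OF a x] by (rule cj_fix_sym)
  then have tm: "t \<up> m = t"
    unfolding m_def using u_fix_centralizer[OF a y S(3)] by (intro cj_fix_sym[of _ t])
  have mr: "m \<up> r = m" unfolding m_def r_def using a y by (rule u_fix_right)
  have r_q: "r = q \<up> (x\<^sup>- * y)" by (simp add: q_def r_def cj_by_mult)
  have nr: "n \<up> r = n" unfolding n_def r_q using q x y by (intro u_fix_right) auto
  note P = psi_fix[OF a x y, folded q_def m_def]
  have 1: "n \<up> x \<up> (a * m\<^sup>-) = n \<up> x"
    using psi_square_aux[OF a x S(5)] am mr P(2,4) tm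
    by (simp add: q_def[symmetric] t_def[symmetric] n_def[symmetric] m_def[folded r_def, symmetric])
  have mi: "[a; r\<^sup>-] = m\<^sup>-" and ni: "[q; r\<^sup>-] = n\<^sup>-"
    using mr nr by (simp_all add: cm_minv_right cj_fix_minv m_def r_def[symmetric] n_def)
  have ci: "[q; m\<^sup>-] = [q; m]\<^sup>-"
    using P(2) by (simp add: cm_minv_right cj_fix_minv)
  have 2: "n \<up> x \<up> (a * m) = n \<up> x"
    using psi_square_aux[OF a x minv_mem[OF S(5)]] am mr P(2,4) tm
    by (simp add: q_def[symmetric] t_def[symmetric] mi ni ci cj_fix_minv)
  have "(a * m\<^sup>-) * (a * m) = a * a"
    by (simp add: mult.assoc cj_fix_rules(1,2)[OF am])
  then have 3: "n \<up> x \<up> (a * a) = n \<up> x"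
    using 1 2 by (metis cj_by_mult)
  define p where "p = a \<up> x \<up> x"
  define F where "F = [a; n \<up> x]"
  have p: "p \<in> C" unfolding p_def using a x by (simp add: C_cj)
  \<comment> \<open>Seen from \<open>p\<close>, the elements \<open>a\<close> and
    \<open>r \<up> x\<close> are the conjugates by \<open>g\<close> and \<open>h\<close>.\<close>
  define g where "g = x\<^sup>- * x\<^sup>-"
  define h where "h = x\<^sup>- * x\<^sup>- * y * x"
  have gh: "g \<in> S" "h \<in> S" using x y by (simp_all add: g_def h_def)
  have pg: "p \<up> g = a" and ph: "p \<up> h = r \<up> x" by (simp_all add: p_def g_def h_def r_def cj_by_mult)
  have nx: "n \<up> x = [p; p \<up> h]" unfolding ph by (simp add: n_def p_def q_def cj_cm)
  have F: "F = [p \<up> g; [p; p \<up> h]]" by (simp add: F_def pg nx)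
  have Fa: "F \<up> a = F"
    using psi_fix(5)[OF p gh] by (simp only: F pg)
  have "(a * a) \<up> (n \<up> x) = a * a" using 3 by (rule cj_fix_sym)
  then have "a * F * (a * F) = a * a"
    by (simp add: F_def cj_eq_mult_cm[of a "n \<up> x"])
  then have "F * F = 1"
    using cj_fix_rules[OF Fa] by (simp add: mult.assoc)
  then have "F = 1" unfolding F using p gh by (intro C_tf)
  then show ?thesis unfolding F_def n_def by (simp add: cj_cm q_def r_def)
qed

text \<open>\<open>psi_square\<close> read from \<open>a \<up> x \<up> x\<close>, with
  \<open>x\<^sup>-\<close> in place of \<open>x\<close>.\<close>

lemma psi_square':
  assumes a: "a \<in> C" and x: "x \<in> S" and y: "y \<in> S"
  shows "[a \<up> (x * x); [a; a \<up> y]] = 1"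
proof -
  have "[a \<up> x \<up> x; [a \<up> x \<up> x \<up> x\<^sup>- \<up> x\<^sup>-; a \<up> x \<up> x \<up> (x\<^sup>- * x\<^sup>- * y * x) \<up> x\<^sup>-]] = 1"
    using a x y by (intro psi_square) (auto intro: C_cj)
  then show ?thesis by (simp add: cj_by_mult)
qed

text \<open>\<open>a \<up> (x * x)\<close> is the word \<open>q * a\<^sup>- * q * t\<close>.
  Conjugation by \<open>m\<close> fixes it, \<open>a\<close> and \<open>t\<close>, but multiplies
  each of the two letters \<open>q\<close> by \<open>\<psi>\<close>; so the square of
  \<open>\<psi>\<close> is trivial.\<close>

lemma psi_eq_1:
  assumes a: "a \<in> C" and x: "x \<in> S" and y: "y \<in> S"
  shows "[a \<up> x; [a; a \<up> y]] = 1"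
proof -
  define m where "m = [a; a \<up> y]"
  define q where "q = a \<up> x"
  define \<psi> where "\<psi> = [q; m]"
  define t where "t = [[a; x]; x]"
  have S: "a \<in> S" "m \<in> S" "t \<in> S" using C_mem[OF a] x y by (simp_all add: m_def t_def)
  note P = psi_fix[OF a x y, folded q_def m_def, folded \<psi>_def]
  have am: "a \<up> m = a" unfolding m_def using C_u(1)[OF a y] by (rule cj_fix_sym)
  have at: "a \<up> t = a" unfolding t_def using C_t(1)[OF a x] by (rule cj_fix_sym)
  then have tm: "t \<up> m = t"
    unfolding m_def using u_fix_centralizer[OF a y S(3)] by (intro cj_fix_sym[of _ t])
  have qm: "q \<up> m = q * \<psi>" by (simp add: \<psi>_def cj_eq_mult_cm)
  have a2: "a \<up> (x * x) = q * a\<^sup>- * q * t"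
    by (simp add: t_def q_def cm_eq_cj cj_by_mult mult.assoc)
  have "(q * a\<^sup>- * q * t) \<up> m = q * a\<^sup>- * q * t * (\<psi> * \<psi>)"
    by (simp add: am tm qm mult.assoc cj_fix_rules[OF P(4)] cj_fix_rules[OF P(5)] cj_fix_rules[OF P(1)[OF S(3) at]])
  moreover have "a \<up> (x * x) \<up> m = a \<up> (x * x)"
    using psi_square'[OF a x y] by (simp add: cm_eq_1_iff m_def)
  ultimately have "\<psi> * \<psi> = 1" unfolding a2 by simp
  then show ?thesis
    using C_tf[OF a x y] by (simp add: \<psi>_def q_def m_def)
qed

end

section \<open>Hypercentral elements\<close>

inductive gen :: "'a::mgroup set \<Rightarrow> 'a \<Rightarrow> bool" for X where
  gen_base: "x \<in> X \<Longrightarrow> gen X x"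
| gen_one: "gen X 1"
| gen_mult: "gen X x \<Longrightarrow> gen X y \<Longrightarrow> gen X (x * y)"
| gen_minv: "gen X x \<Longrightarrow> gen X (x\<^sup>-)"

text \<open>The upper central series of \<open>S\<close>.\<close>

primrec zc :: "'a::mgroup set \<Rightarrow> nat \<Rightarrow> 'a set" where
  "zc S 0 = {1}"
| "zc S (Suc k) = {z \<in> S. \<forall>g \<in> S. [z; g] \<in> zc S k}"

context subgrp
begin

lemma gen_mem: "gen X y \<Longrightarrow> X \<subseteq> S \<Longrightarrow> y \<in> S"
  by (induction rule: gen.induct) auto

lemma gen_cj: "gen X y \<Longrightarrow> (\<And>x. x \<in> X \<Longrightarrow> gen X (x \<up> g)) \<Longrightarrow> gen X (y \<up> g)"
  by (induction rule: gen.induct) (auto intro: gen.intros)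

lemma gen_fix: "gen X y \<Longrightarrow> (\<And>x. x \<in> X \<Longrightarrow> z \<up> x = z) \<Longrightarrow> z \<up> y = z"
  by (induction rule: gen.induct) (auto simp: cj_by_mult cj_fix_minv)

lemma zc_one: "1 \<in> zc S k"
  by (induction k) auto

lemma zc_cj: "z \<in> zc S k \<Longrightarrow> g \<in> S \<Longrightarrow> z \<up> g \<in> zc S k"
proof (induction k arbitrary: z)
  case (Suc k)
  have "[z \<up> g; h] \<in> zc S k" if h: "h \<in> S" for h
  proof -
    have "[z; h \<up> g\<^sup>-] \<in> zc S k" using Suc.prems h by simp
    then have "[z; h \<up> g\<^sup>-] \<up> g \<in> zc S k" using Suc.prems(2) by (rule Suc.IH)
    then show ?thesis by (simp add: cj_cm)
  qed
  then show ?case using Suc.prems by simp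
qed simp

lemma zc_mult_minv: "(\<forall>z \<in> zc S k. \<forall>y \<in> zc S k. z * y \<in> zc S k) \<and> (\<forall>z \<in> zc S k. z\<^sup>- \<in> zc S k)"
proof (induction k)
  case (Suc k)
  then have mult: "z * y \<in> zc S k" if "z \<in> zc S k" "y \<in> zc S k" for z y
    using that by blast
  from Suc have minv: "z\<^sup>- \<in> zc S k" if "z \<in> zc S k" for z
    using that by blast
  show ?case
    by (auto simp: cm_mult_left cm_minv_left intro!: mult minv zc_cj)
qed simp

lemma zc_mult: "z \<in> zc S k \<Longrightarrow> y \<in> zc S k \<Longrightarrow> z * y \<in> zc S k"
  and zc_minv: "z \<in> zc S k \<Longrightarrow> z\<^sup>- \<in> zc S k"
  using zc_mult_minv by blast+

lemma zc_Suc: "z \<in> zc S k \<Longrightarrow> z \<in> zc S (Suc k)"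
  by (induction k arbitrary: z) auto

lemma zc_le: "k \<le> l \<Longrightarrow> z \<in> zc S k \<Longrightarrow> z \<in> zc S l"
  by (induction l rule: dec_induct) (auto dest: zc_Suc simp del: zc.simps)

definition Zw :: "'a set" where
  "Zw = (\<Union>k. zc S k)"

lemma Zw_one [simp]: "1 \<in> Zw"
  by (auto simp: Zw_def intro: zc_one)

lemma Zw_cj: "z \<in> Zw \<Longrightarrow> g \<in> S \<Longrightarrow> z \<up> g \<in> Zw"
  by (auto simp: Zw_def intro: zc_cj)

lemma Zw_minv: "z \<in> Zw \<Longrightarrow> z\<^sup>- \<in> Zw"
  by (auto simp: Zw_def intro: zc_minv)

lemma Zw_mult:
  assumes "z \<in> Zw" "y \<in> Zw"
  shows "z * y \<in> Zw"
proof -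
  obtain k l where "z \<in> zc S k" "y \<in> zc S l"
    using assms by (auto simp: Zw_def)
  then have "z \<in> zc S (max k l)" "y \<in> zc S (max k l)"
    using zc_le[of k "max k l"] zc_le[of l "max k l"] by auto
  then show ?thesis
    unfolding Zw_def by (blast intro: zc_mult)
qed

text \<open>\<open>zc S k\<close> is a normal subgroup, so commutators with products and inverses of
  the generators stay inside it.\<close>

lemma zc_gen:
  assumes S: "S = Collect (gen {a, b, x})" and z: "z \<in> S"
    and "[z; a] \<in> zc S k" "[z; b] \<in> zc S k" "[z; x] \<in> zc S k"
  shows "z \<in> zc S (Suc k)"
proof -
  have abx: "{a, b, x} \<subseteq> S" unfolding S by (auto intro: gen_base)
  have "[z; g] \<in> zc S k" if "gen {a, b, x} g" for g
    using that
  proof (induction rule: gen.induct)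
    case (gen_mult g h)
    then show ?case
      using gen_mem[OF gen_mult(2) abx] by (auto simp: cm_mult_right intro!: zc_mult zc_cj)
  next
    case (gen_minv g)
    then show ?case
      using gen_mem[OF gen_minv(1) abx] by (auto simp: cm_minv_right intro!: zc_minv zc_cj)
  qed (use assms(3-5) in \<open>auto intro: zc_one\<close>)
  moreover have "gen {a, b, x} g" if "g \<in> S" for g using that S by blast
  ultimately show ?thesis using z by simp
qed

lemma Zw_gen:
  assumes S: "S = Collect (gen {a, b, x})" and z: "z \<in> S"
    and w: "[z; a] \<in> Zw" "[z; b] \<in> Zw" "[z; x] \<in> Zw"
  shows "z \<in> Zw"
proof -
  obtain k l m where "[z; a] \<in> zc S k" "[z; b] \<in> zc S l" "[z; x] \<in> zc S m"
    using w by (auto simp: Zw_def)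
  then have "z \<in> zc S (Suc (max k (max l m)))"
    by (intro zc_gen[OF S z]) (rule zc_le[rotated], assumption, simp)+
  then show ?thesis unfolding Zw_def by blast
qed

end

lemma subgrp_gen: "subgrp (Collect (gen X))"
  by unfold_locales (auto intro: gen.intros)

text \<open>To be applied to the central quotient, once as it stands and once with \<open>a\<close>
  and \<open>b\<close> exchanged; therefore unipotency is only asked for the conjugates of
  \<open>a\<close>.\<close>

locale class2_pair = subgrp +
  fixes a b x
  assumes S_gen: "S = Collect (gen {a, b, x})"
    and class2_a: "g \<in> S \<Longrightarrow> h \<in> S \<Longrightarrow> k \<in> S \<Longrightarrow> a \<up> g \<up> [a \<up> h; a \<up> k] = a \<up> g"
    and class2_b: "g \<in> S \<Longrightarrow> h \<in> S \<Longrightarrow> k \<in> S \<Longrightarrow> b \<up> g \<up> [b \<up> h; b \<up> k] = b \<up> g"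
    and unipotent: "g \<in> S \<Longrightarrow> [[[a \<up> g; x]; x]; x] = 1"
begin

lemma abx [simp]: "a \<in> S" "b \<in> S" "x \<in> S"
  by (subst S_gen, auto intro: gen_base)+

section \<open>The normal closure of a generator\<close>

abbreviation "ncl y \<equiv> gen {y \<up> g | g. g \<in> S}"

lemma ncl_mem: "ncl y n \<Longrightarrow> y \<in> S \<Longrightarrow> n \<in> S"
  by (rule gen_mem) auto

lemma ncl_cj: "ncl y n \<Longrightarrow> g \<in> S \<Longrightarrow> ncl y (n \<up> g)"
proof (erule gen_cj)
  fix z assume "z \<in> {y \<up> g |g. g \<in> S}" "g \<in> S"
  then obtain h where "h \<in> S" "z = y \<up> h" by auto
  then have "z \<up> g = y \<up> (h * g)" "h * g \<in> S" using \<open>g \<in> S\<close> by (auto simp: cj_by_mult)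
  then show "ncl y (z \<up> g)" by (auto intro: gen_base)
qed

lemma ncl_cm: "ncl y n \<Longrightarrow> g \<in> S \<Longrightarrow> ncl y [n; g]"
  unfolding cm_eq_cj by (intro gen_mult gen_minv ncl_cj)

lemma ncl_cm': "ncl y n \<Longrightarrow> g \<in> S \<Longrightarrow> ncl y [g; n]"
  using gen_minv[OF ncl_cm] by (simp only: cm_minv)

lemma ncl_conj: "g \<in> S \<Longrightarrow> ncl y (y \<up> g)"
  by (rule gen_base) blast

lemma ncl_self: "ncl y y"
proof (rule gen_base)
  have "y = y \<up> 1 \<and> 1 \<in> S" by simp
  then show "y \<in> {y \<up> g |g. g \<in> S}" by blast
qed

text \<open>The identity is extended from conjugates to products one entry at a time. Each stage is
  quantified over all \<open>n\<close>, since centrality is what makes the commutator multiplicative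
  in the next entry.\<close>

lemma class2:
  assumes base: "\<And>g h k. g \<in> S \<Longrightarrow> h \<in> S \<Longrightarrow> k \<in> S \<Longrightarrow> y \<up> g \<up> [y \<up> h; y \<up> k] = y \<up> g"
    and n: "ncl y n1" "ncl y n2" "ncl y n3"
  shows "n1 \<up> [n2; n3] = n1"
proof -
  have 1: "[y \<up> h; y \<up> k] \<up> n = [y \<up> h; y \<up> k]" if "h \<in> S" "k \<in> S" "ncl y n" for h k n
    using that(3) by (rule gen_fix) (use base that in \<open>auto intro: cj_fix_sym\<close>)
  have 2: "\<forall>n. ncl y n \<longrightarrow> [m; y \<up> k] \<up> n = [m; y \<up> k]" if m: "ncl y m" and k: "k \<in> S" for m k
    using m
  proof (induction rule: gen.induct)
    case (gen_base z)
    then show ?case using 1[OF _ k] by auto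
  next
    case (gen_mult z w)
    then show ?case by (simp add: cm_mult_left)
  next
    case (gen_minv z)
    then show ?case by (simp add: cm_minv_left gen.gen_minv)
  qed simp
  have "\<forall>n. ncl y n \<longrightarrow> [n2; n3] \<up> n = [n2; n3]"
    using n(3)
  proof (induction rule: gen.induct)
    case (gen_base z)
    then show ?case using 2[OF n(2)] by auto
  next
    case (gen_mult z w)
    then show ?case by (simp add: cm_mult_right)
  next
    case (gen_minv z)
    then show ?case by (simp add: cm_minv_right gen.gen_minv)
  qed simp
  then show ?thesis using n(1) by (simp add: cj_fix_sym)
qed

lemmas class2_A = class2[OF class2_a] and class2_B = class2[OF class2_b]

text \<open>The derived subgroup of the normal closure of \<open>a\<close>, central in it by
  \<open>A2_fix\<close>.\<close>

definition A2 :: "'a \<Rightarrow> bool" where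
  "A2 = gen {[a \<up> g; a \<up> h] | g h. g \<in> S \<and> h \<in> S}"

lemma A2_ncl: "A2 z \<Longrightarrow> ncl a z"
  unfolding A2_def
proof (induction rule: gen.induct)
  case (gen_base z)
  then obtain g h where "g \<in> S" "h \<in> S" "z = [a \<up> g; a \<up> h]" by auto
  then show ?case by (simp add: ncl_cm ncl_conj)
qed (auto intro: gen.intros)

lemma A2_fix: "A2 z \<Longrightarrow> ncl a n \<Longrightarrow> z \<up> n = z"
  unfolding A2_def
proof (induction rule: gen.induct)
  case (gen_base z)
  then obtain g h where z: "g \<in> S" "h \<in> S" "z = [a \<up> g; a \<up> h]" by auto
  then have "ncl a (a \<up> g)" "ncl a (a \<up> h)" by (simp_all add: ncl_conj)
  then show ?case unfolding z using gen_base(2) by (intro cj_fix_sym[OF class2_A])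
qed (auto intro: gen.intros)

lemma A2_one: "A2 1" and A2_mult: "A2 y \<Longrightarrow> A2 z \<Longrightarrow> A2 (y * z)" and A2_minv: "A2 y \<Longrightarrow> A2 (y\<^sup>-)"
  unfolding A2_def by (auto intro: gen.intros)

lemma A2_cj: "A2 z \<Longrightarrow> g \<in> S \<Longrightarrow> A2 (z \<up> g)"
  unfolding A2_def
proof (erule gen_cj)
  fix y assume "y \<in> {[a \<up> g; a \<up> h] |g h. g \<in> S \<and> h \<in> S}" "g \<in> S"
  then obtain k l where "k \<in> S" "l \<in> S" "y = [a \<up> k; a \<up> l]" by auto
  then have "y \<up> g = [a \<up> (k * g); a \<up> (l * g)]" "k * g \<in> S" "l * g \<in> S"
    using \<open>g \<in> S\<close> by (auto simp: cj_by_mult cj_cm)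
  then show "gen {[a \<up> g; a \<up> h] |g h. g \<in> S \<and> h \<in> S} (y \<up> g)" by (auto intro!: gen_base)
qed

lemma A2_cm: "A2 z \<Longrightarrow> g \<in> S \<Longrightarrow> A2 [z; g]"
  unfolding cm_eq_cj by (intro A2_mult A2_minv A2_cj)

lemma A2_ncl_cm: "ncl a n \<Longrightarrow> ncl a m \<Longrightarrow> A2 [n; m]"
proof -
  have 1: "A2 [n; a \<up> h]" if "ncl a n" "h \<in> S" for n h
    using that(1)
  proof (induction rule: gen.induct)
    case (gen_base z)
    then show ?case using that(2) unfolding A2_def by (auto intro!: gen.gen_base)
  next
    case (gen_mult z w)
    then have "w \<in> S" by (simp add: ncl_mem[of a])
    then show ?case unfolding cm_mult_left using gen_mult by (intro A2_mult A2_cj)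
  next
    case (gen_minv z)
    then have "z\<^sup>- \<in> S" by (simp add: ncl_mem[of a])
    then show ?case unfolding cm_minv_left using gen_minv by (intro A2_minv A2_cj)
  qed (simp add: A2_one)
  assume n: "ncl a n"
  show "A2 [n; m]" if "ncl a m"
    using that
  proof (induction rule: gen.induct)
    case (gen_base z)
    then show ?case using 1[OF n] by auto
  next
    case (gen_mult z w)
    then have "w \<in> S" by (simp add: ncl_mem[of a])
    then show ?case unfolding cm_mult_right using gen_mult by (intro A2_mult A2_cj)
  next
    case (gen_minv z)
    then have "z\<^sup>- \<in> S" by (simp add: ncl_mem[of a])
    then show ?case unfolding cm_minv_right using gen_minv by (intro A2_minv A2_cj)
  qed (simp add: A2_one)
qed

text \<open>In additive language the \<open>m\<close>-th power of \<open>x - 1\<close>, acting on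
  the abelian group \<open>A2\<close> and on the normal closure of \<open>a\<close> modulo
  \<open>A2\<close>.\<close>

definition D :: "nat \<Rightarrow> 'a \<Rightarrow> 'a" where
  "D m = (\<lambda>y. [y; x]) ^^ m"

lemma D_0 [simp]: "D 0 z = z"
  by (simp add: D_def)

lemma D_Suc: "D (Suc m) z = D m [z; x]"
  by (simp add: D_def funpow_Suc_right del: funpow.simps)

lemma D_Suc': "D (Suc m) z = [D m z; x]"
  by (simp add: D_def)

lemma D_one [simp]: "D m 1 = 1"
  by (induction m) (simp_all add: D_Suc)

lemma D_ncl: "ncl y z \<Longrightarrow> ncl y (D m z)"
  by (induction m) (auto simp: D_Suc' intro: ncl_cm)

lemma D_A2: "A2 z \<Longrightarrow> A2 (D m z)"
  by (induction m) (auto simp: D_Suc' intro: A2_cm)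

lemma D_add: "D (m + n) z = D m (D n z)"
  by (simp add: D_def funpow_add)

lemma D_mult_A2:
  assumes "A2 y" "ncl a z"
  shows "D m (z * y) = D m z * D m y"
proof (induction m)
  case (Suc m)
  have "ncl a [D m z; x]"
    using assms(2) by (intro ncl_cm D_ncl) auto
  then have "D m y \<up> [D m z; x] = D m y"
    by (rule A2_fix[OF D_A2[OF assms(1)]])
  then have "[D m z; x] \<up> D m y = [D m z; x]"
    by (rule cj_fix_sym)
  then show ?case by (simp add: D_Suc' Suc cm_mult_left)
qed simp

lemma D_mult_ncl:
  assumes "ncl a y" "ncl a z"
  shows "\<exists>c. A2 c \<and> D m (y * z) = D m y * D m z * c"
proof (induction m)
  case 0
  then show ?case using A2_one by force
next
  case (Suc m)
  then obtain c where c: "A2 c" "D m (y * z) = D m y * D m z * c" by blast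
  define u v where "u = D m y" and "v = D m z"
  have uv: "ncl a u" "ncl a v" using assms by (auto simp: u_def v_def intro: D_ncl)
  have "D (Suc m) (y * z) = D 1 (u * v * c)"
    by (simp add: D_Suc' c u_def v_def)
  also have "\<dots> = D 1 (u * v) * D 1 c"
    using c uv by (intro D_mult_A2) (auto intro: gen_mult)
  also have "D 1 (u * v) = [u; x] \<up> v * [v; x]"
    by (simp add: D_Suc' cm_mult_left)
  also have "\<dots> = [u; x] * [[u; x]; v] * [v; x]"
    by (simp add: cj_eq_mult_cm[of "[u; x]" v])
  also have "[u; x] * [[u; x]; v] * [v; x] = [u; x] * [v; x] * [[u; x]; v]"
    using A2_fix[OF A2_ncl_cm[OF ncl_cm[OF uv(1)] uv(2)] ncl_cm[OF uv(2)]]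
    by (simp add: cj_fix_iff mult.assoc)
  finally have "D (Suc m) (y * z) = D (Suc m) y * D (Suc m) z * ([[u; x]; v] * D 1 c)"
    by (simp add: D_Suc' u_def v_def mult.assoc)
  moreover have "A2 ([[u; x]; v] * D 1 c)"
    using uv c by (intro A2_mult D_A2 A2_ncl_cm ncl_cm) auto
  ultimately show ?case by blast
qed

lemma D3_ncl: "ncl a z \<Longrightarrow> A2 (D 3 z)"
proof (induction rule: gen.induct)
  case (gen_base z)
  then obtain g where "g \<in> S" "z = a \<up> g" by auto
  then have "D 3 z = 1" using unipotent by (simp add: numeral_3_eq_3 D_Suc')
  then show ?case by (simp add: A2_one)
next
  case (gen_mult y z)
  then show ?case using D_mult_ncl[of y z 3] A2_mult by auto
next
  case (gen_minv y)
  obtain c where c: "A2 c" "D 3 (y * y\<^sup>-) = D 3 y * D 3 (y\<^sup>-) * c"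
    using D_mult_ncl[of y "y\<^sup>-" 3] gen_minv by (auto intro: gen.gen_minv)
  then have "D 3 y * (D 3 (y\<^sup>-) * c) = 1" by (simp add: mult.assoc)
  then have "(D 3 y)\<^sup>- = D 3 (y\<^sup>-) * c" by (rule minv_unique)
  then have "D 3 (y\<^sup>-) = (D 3 y)\<^sup>- * c\<^sup>-" by (simp add: mult.assoc)
  then show ?case using gen_minv c by (simp add: A2_mult A2_minv)
qed (simp add: A2_one)

text \<open>A Leibniz rule: \<open>[[p; q]; x]\<close> is a product of commutators in which at least
  one entry has been replaced by its commutator with \<open>x\<close>. Three such replacements kill
  a conjugate of \<open>a\<close>, and among five some entry receives three.\<close>

lemma D_cm_conj:
  assumes "g \<in> S" "h \<in> S"
  shows "i + j + m \<ge> 5 \<Longrightarrow> D m [D i (a \<up> g); D j (a \<up> h)] = 1"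
proof (induction m arbitrary: i j)
  case 0
  have D3: "D n (a \<up> k) = 1" if "k \<in> S" "n \<ge> 3" for k n
  proof -
    have "D 3 (a \<up> k) = 1" using unipotent[OF that(1)] by (simp add: numeral_3_eq_3 D_Suc')
    then show ?thesis using D_add[of "n - 3" 3 "a \<up> k"] that(2) by simp
  qed
  from 0 have "i \<ge> 3 \<or> j \<ge> 3" by linarith
  then show ?case using D3 assms by auto
next
  case (Suc m)
  define p q where "p = D i (a \<up> g)" and "q = D j (a \<up> h)"
  have pq: "ncl a p" "ncl a q"
    using assms by (auto simp: p_def q_def intro!: D_ncl ncl_conj)
  define p' q' where "p' = [p; x]" and "q' = [q; x]"
  have pq': "ncl a p'" "ncl a q'" using pq by (auto simp: p'_def q'_def intro: ncl_cm)
  note A = A2_ncl_cm[OF pq(1) pq(2)] A2_ncl_cm[OF pq(1) pq'(2)] A2_ncl_cm[OF pq'(1) pq(2)] A2_ncl_cm[OF pq'(1) pq'(2)]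
  have "[p; q] \<up> x = [p * p'; q * q']"
    by (simp only: cj_cm cj_eq_mult_cm[of p x] cj_eq_mult_cm[of q x] p'_def q'_def)
  also have "\<dots> = [p; q'] * [p'; q'] * ([p; q] * [p'; q])"
    using A2_fix[OF A(1)] A2_fix[OF A(2)] A2_fix[OF A(3)] pq pq'
    by (simp add: cm_mult_left cm_mult_right)
  also have "\<dots> = [p; q] * ([p; q'] * [p'; q'] * [p'; q])"
    using cj_fix_rules[OF A2_fix[OF A(2) A2_ncl[OF A(1)]]] cj_fix_rules[OF A2_fix[OF A(4) A2_ncl[OF A(1)]]]
    by (simp add: mult.assoc)
  finally have "[[p; q]; x] = [p; q'] * [p'; q'] * [p'; q]"
    by (simp add: cm_eq_cj[of "[p; q]" x])
  then have "D (Suc m) [p; q] = D m ([p; q'] * [p'; q'] * [p'; q])"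
    by (simp add: D_Suc)
  also have "\<dots> = D m [p; q'] * D m [p'; q'] * D m [p'; q]"
    using A by (simp add: D_mult_A2 A2_ncl gen_mult A2_mult)
  also have "\<dots> = 1"
    using Suc.IH[of i "Suc j"] Suc.IH[of "Suc i" "Suc j"] Suc.IH[of "Suc i" j] Suc.prems
    by (simp add: D_Suc' p'_def q'_def p_def q_def)
  finally show ?case by (simp add: p_def q_def)
qed

lemma D5_A2: "A2 z \<Longrightarrow> D 5 z = 1"
proof -
  assume z: "A2 z"
  have "A2 z \<and> D 5 z = 1"
    using z unfolding A2_def
  proof (induction rule: gen.induct)
    case (gen_base z)
    then obtain g h where gh: "g \<in> S" "h \<in> S" "z = [a \<up> g; a \<up> h]" by auto
    then have "D 5 z = 1" using D_cm_conj[OF gh(1,2), of 0 0 5] by simp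
    then show ?case using gen_base by (simp add: gen.gen_base)
  next
    case (gen_mult y z)
    then show ?case using D_mult_A2[of z y 5] A2_ncl unfolding A2_def by (auto intro: gen.gen_mult)
  next
    case (gen_minv y)
    then have "D 5 (y * y\<^sup>-) = D 5 y * D 5 (y\<^sup>-)"
      using D_mult_A2[of "y\<^sup>-" y 5] A2_ncl unfolding A2_def by (auto intro: gen.gen_minv)
    then show ?case using gen_minv by (auto intro: gen.gen_minv)
  qed (simp add: gen_one)
  then show ?thesis ..
qed

text \<open>Induction on powers of \<open>[_; x]\<close> proves the claim for elements that conjugates of \<open>b\<close> map into the
  hypercentre; since the normal closure of \<open>b\<close> has class 2, three such commutators already vanish.\<close>
lemma hypercentral_step:
  assumes Y: "\<And>z. Y z \<Longrightarrow> ncl a z" "\<And>z g. Y z \<Longrightarrow> g \<in> S \<Longrightarrow> Y (z \<up> g)"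
      "\<And>z y. Y z \<Longrightarrow> Y y \<Longrightarrow> Y (z * y)" "\<And>z. Y z \<Longrightarrow> Y (z\<^sup>-)"
    and Ya: "\<And>z. Y z \<Longrightarrow> [z; a] \<in> Zw" and YD: "\<And>z. Y z \<Longrightarrow> D m z \<in> Zw"
    and z: "Y z"
  shows "z \<in> Zw"
proof -
  have Ycm: "Y [z; g]" if "Y z" "g \<in> S" for z g
    unfolding cm_eq_cj using that by (intro Y)
  have YS: "Y z \<Longrightarrow> z \<in> S" for z by (rule ncl_mem[OF Y(1)]) auto
  have V: "z \<in> Zw" if z: "Y z" and B: "\<And>\<beta>. ncl b \<beta> \<Longrightarrow> [z; \<beta>] \<in> Zw" for z
  proof -
    have "D n z \<in> Zw \<Longrightarrow> Y z \<Longrightarrow> (\<forall>\<beta>. ncl b \<beta> \<longrightarrow> [z; \<beta>] \<in> Zw) \<Longrightarrow> z \<in> Zw" for n z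
    proof (induction n arbitrary: z)
      case (Suc n)
      have "[[z; x]; \<beta>] \<in> Zw" if \<beta>: "ncl b \<beta>" for \<beta>
      proof -
        have \<beta>S: "\<beta> \<in> S" using \<beta> by (auto intro: ncl_mem)
        have zS: "z \<in> S" using YS[OF Suc.prems(2)] .
        have "[z; \<beta> \<up> x\<^sup>-] \<in> Zw" using Suc.prems(3) ncl_cj[OF \<beta>, of "x\<^sup>-"] by simp
        then have "[z; \<beta> \<up> x\<^sup>-] \<up> x \<in> Zw" by (rule Zw_cj) simp
        then have 1: "[z \<up> x; \<beta>] \<in> Zw" by (simp add: cj_cm)
        have "[z; \<beta>]\<^sup>- \<up> z\<^sup>- \<in> Zw" using Suc.prems(3) \<beta> zS by (intro Zw_cj Zw_minv) auto
        then have 2: "[z\<^sup>-; \<beta>] \<in> Zw" by (simp only: cm_minv_left)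
        have "[z\<^sup>-; \<beta>] \<up> (z \<up> x) * [z \<up> x; \<beta>] \<in> Zw"
          using 1 2 zS by (intro Zw_mult Zw_cj) auto
        then show ?thesis by (simp only: cm_eq_cj[of z x] cm_mult_left)
      qed
      moreover have "D n [z; x] \<in> Zw" "Y [z; x]"
        using Suc.prems(1,2) by (simp_all add: D_Suc Ycm)
      ultimately have "[z; x] \<in> Zw"
        using Suc.IH by blast
      moreover have "[z; b] \<in> Zw"
        using Suc.prems(3) ncl_self by blast
      ultimately show ?case
        using Zw_gen[OF S_gen YS[OF Suc.prems(2)] Ya[OF Suc.prems(2)]] by blast
    qed simp
    then show ?thesis using YD[OF z] z B by blast
  qed
  have B2: "[[[z; \<beta>]; \<gamma>]; \<delta>] = 1" if "Y z" "ncl b \<beta>" "ncl b \<gamma>" "ncl b \<delta>" for z \<beta> \<gamma> \<delta>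
  proof -
    have "ncl b [z; \<beta>]" using that YS by (simp add: ncl_cm')
    then have "\<delta> \<up> [[z; \<beta>]; \<gamma>] = \<delta>" using that by (intro class2_B)
    then show ?thesis by (simp add: cm_eq_1_iff[of _ \<delta>] cj_fix_sym)
  qed
  have bS: "ncl b \<beta> \<Longrightarrow> \<beta> \<in> S" for \<beta>
    by (rule ncl_mem) auto
  \<comment> \<open>\<open>V\<close> removes one outer commutator with the normal closure of
    \<open>b\<close> at a time, starting from \<open>B2\<close>.\<close>
  have 1: "[[z; \<beta>]; \<gamma>] \<in> Zw" if "ncl b \<beta>" "ncl b \<gamma>" for \<beta> \<gamma>
    by (rule V) (simp_all add: Ycm z bS that B2)
  have 2: "[z; \<beta>] \<in> Zw" if "ncl b \<beta>" for \<beta>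
    by (rule V) (simp_all add: Ycm z bS that 1)
  show ?thesis by (rule V[OF z 2])
qed

lemma A2_hypercentral: "A2 z \<Longrightarrow> z \<in> Zw"
proof (rule hypercentral_step[of A2 5])
  show "[z; a] \<in> Zw" if "A2 z" for z
    using A2_fix[OF that ncl_self] by (simp add: cm_eq_1_iff[of z a, THEN iffD2])
qed (auto simp: D5_A2 intro: A2_ncl A2_cj A2_mult A2_minv)

text \<open>Modulo \<open>A2\<close>, already known to be hypercentral, the normal closure is
  abelian and threefold commutation with \<open>x\<close> is trivial; these are the two inputs of
  \<open>hypercentral_step\<close>.\<close>

lemma ncl_hypercentral: "ncl a z \<Longrightarrow> z \<in> Zw"
  by (rule hypercentral_step[of "ncl a" 3])
    (auto intro: A2_hypercentral D3_ncl A2_ncl_cm ncl_self ncl_cj gen_mult gen_minv)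

lemma a_hypercentral: "a \<in> Zw"
  by (rule ncl_hypercentral[OF ncl_self])

end

section \<open>Nilpotency\<close>

typedef 'a sym = "{f :: 'a \<Rightarrow> 'a. bij f}"
  by (rule exI[of _ id]) simp

setup_lifting type_definition_sym

instantiation sym :: (type) mgroup
begin

lift_definition one_sym :: "'a sym" is id by simp

text \<open>The order of composition makes right translation and conjugation homomorphisms.\<close>
lift_definition times_sym :: "'a sym \<Rightarrow> 'a sym \<Rightarrow> 'a sym" is "\<lambda>f g. g \<circ> f"
  by (rule bij_comp)

lift_definition minv_sym :: "'a sym \<Rightarrow> 'a sym" is "\<lambda>f. inv_into UNIV f"
  by (rule bij_imp_bij_inv)

instance
  by standard (transfer, auto simp: fun_eq_iff bij_is_surj surj_f_inv_f)+

end

text \<open>The default \<open>id\<close> makes the function total, as the lifting to permutations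
  requires.\<close>

lift_definition sym_restrict :: "'a set \<Rightarrow> ('a \<Rightarrow> 'a) \<Rightarrow> 'a sym" is
  "\<lambda>X f. if bij_betw f X X then (\<lambda>y. if y \<in> X then f y else y) else id"
proof -
  fix X and f :: "'a \<Rightarrow> 'a"
  have "bij_betw (\<lambda>y. if y \<in> X then f y else y) (X \<union> - X) (X \<union> - X)" if f: "bij_betw f X X"
  proof (rule bij_betw_combine)
    show "bij_betw (\<lambda>y. if y \<in> X then f y else y) X X"
      using f by (simp cong: bij_betw_cong)
    show "bij_betw (\<lambda>y. if y \<in> X then f y else y) (- X) (- X)"
      by (rule bij_betw_cong[THEN iffD2, of _ _ id]) auto
  qed auto
  then show "bij (if bij_betw f X X then (\<lambda>y. if y \<in> X then f y else y) else id)"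
    by simp
qed

lemma sym_restrict_mult:
  assumes "bij_betw f X X" "bij_betw g X X" "\<And>y. y \<in> X \<Longrightarrow> h y = g (f y)"
  shows "sym_restrict X h = sym_restrict X f * sym_restrict X g"
proof -
  have "bij_betw h X X"
    using bij_betw_trans[OF assms(1,2)] assms(3) by (simp add: o_def cong: bij_betw_cong)
  then show ?thesis
    using assms by transfer (auto simp: fun_eq_iff bij_betw_apply)
qed

lemma sym_restrict_eq_1_iff:
  assumes "bij_betw f X X"
  shows "sym_restrict X f = 1 \<longleftrightarrow> (\<forall>y \<in> X. f y = y)"
  using assms by transfer (auto simp: fun_eq_iff)

lemma sym_restrict_eq_iff:
  assumes "bij_betw f X X" "bij_betw g X X"
  shows "sym_restrict X f = sym_restrict X g \<longleftrightarrow> (\<forall>y \<in> X. f y = g y)"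
  using assms by transfer (auto simp: fun_eq_iff)

text \<open>Conjugation represents the quotient of \<open>S\<close> by its centre inside the type of
  permutations.\<close>
definition inn :: "'a::mgroup set \<Rightarrow> 'a \<Rightarrow> 'a sym" where
  "inn S g = sym_restrict S (\<lambda>y. y \<up> g)"

lemma (in subgrp) bij_betw_cj: "g \<in> S \<Longrightarrow> bij_betw (\<lambda>y. y \<up> g) S S"
  by (rule bij_betw_byWitness[where f' = "\<lambda>y. y \<up> g\<^sup>-"]) auto

locale subgrp_hom = subgrp S for S :: "'a::mgroup set" +
  fixes \<phi> :: "'a \<Rightarrow> 'b::mgroup"
  assumes hom_mult: "x \<in> S \<Longrightarrow> y \<in> S \<Longrightarrow> \<phi> (x * y) = \<phi> x * \<phi> y"
begin

lemma hom_one [simp]: "\<phi> 1 = 1"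
  by (metis hom_mult mult_1_left mult_eq_self_iff one_mem)

lemma hom_minv: "x \<in> S \<Longrightarrow> \<phi> (x\<^sup>-) = (\<phi> x)\<^sup>-"
  using hom_mult[of x "x\<^sup>-"] by (metis hom_one minv_mem minv_right minv_unique)

lemma hom_cj: "x \<in> S \<Longrightarrow> g \<in> S \<Longrightarrow> \<phi> (x \<up> g) = \<phi> x \<up> \<phi> g"
  by (simp add: cj_def hom_mult hom_minv)

lemma hom_cm: "x \<in> S \<Longrightarrow> g \<in> S \<Longrightarrow> \<phi> [x; g] = [\<phi> x; \<phi> g]"
  by (simp add: cm_def hom_mult hom_minv)

lemma subgrp_image: "subgrp (\<phi> ` S)"
proof
  show "1 \<in> \<phi> ` S" by (rule image_eqI[of _ _ 1]) simp_all
qed (auto simp flip: hom_mult hom_minv)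

lemma image_gen:
  assumes "S = Collect (gen X)"
  shows "\<phi> ` S = Collect (gen (\<phi> ` X))"
proof -
  have 1: "gen (\<phi> ` X) (\<phi> y)" if "gen X y" for y
    using that
  proof (induction rule: gen.induct)
    case (gen_mult x y)
    moreover have "x \<in> S" "y \<in> S" using gen_mult assms by auto
    ultimately show ?case by (auto simp: hom_mult intro: gen.gen_mult)
  next
    case (gen_minv x)
    moreover have "x \<in> S" using gen_minv assms by auto
    ultimately show ?case by (auto simp: hom_minv intro: gen.gen_minv)
  qed (auto intro: gen.intros)
  interpret im: subgrp "\<phi> ` S" by (rule subgrp_image)
  have "\<phi> ` X \<subseteq> \<phi> ` S" using assms by (auto intro: gen_base)
  then have "gen (\<phi> ` X) y \<Longrightarrow> y \<in> \<phi> ` S" for y by (rule im.gen_mem[rotated])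
  then show ?thesis using 1 assms by blast
qed

text \<open>A kernel inside the centre costs one step of the upper central series.\<close>

lemma zc_pullback:
  assumes ker: "\<And>z. z \<in> S \<Longrightarrow> \<phi> z = 1 \<Longrightarrow> z \<in> zc S 1"
  shows "z \<in> S \<Longrightarrow> \<phi> z \<in> zc (\<phi> ` S) k \<Longrightarrow> z \<in> zc S (Suc k)"
proof (induction k arbitrary: z)
  case 0
  then show ?case using ker[of z] by simp
next
  case (Suc k)
  have "[z; g] \<in> zc S (Suc k)" if "g \<in> S" for g
    using Suc.prems that by (intro Suc.IH) (auto simp: hom_cm)
  then show ?case using Suc.prems(1) by simp
qed

end

lemma (in subgrp) subgrp_hom_inn: "subgrp_hom S (inn S)"
  by unfold_locales (auto simp: inn_def intro!: sym_restrict_mult bij_betw_cj cj_by_mult)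

lemma (in subgrp) inn_eq_1_iff: "g \<in> S \<Longrightarrow> inn S g = 1 \<longleftrightarrow> (\<forall>y \<in> S. g \<up> y = g)"
  by (auto simp: inn_def sym_restrict_eq_1_iff bij_betw_cj cj_fix_sym)

section \<open>Nilpotency through the central quotient\<close>

context engel_grp
begin

interpretation inn: subgrp_hom S "inn S" by (rule subgrp_hom_inn)

text \<open>\<open>R3_struct\<close> gives the relations up to factors that
  \<open>R3_central\<close> makes trivial in the quotient. For \<open>C_tf\<close>, an element of
  weight 4 whose square is central is itself central by \<open>R3_fix_central\<close>, being a word
  in conjugates of \<open>a\<close>.\<close>

lemma inn_conj_class3:
  assumes a: "a \<in> R3"
  shows "conj_class3 (inn S ` S) {inn S (a \<up> g) | g. g \<in> S}"
proof -
  have aS: "a \<in> S" using a by (rule R3_mem)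
  have P: "p \<in> S" "p \<in> R3" if "p = a \<up> g" "g \<in> S" for p g
    using R3_cj[OF a \<open>g \<in> S\<close>] that R3_mem by auto
  interpret im: subgrp "inn S ` S" by (rule inn.subgrp_image)
  show ?thesis
  proof
    fix p g assume "p \<in> {inn S (a \<up> g) | g. g \<in> S}"
    then obtain k where k: "k \<in> S" "p = inn S (a \<up> k)" by auto
    define q where "q = a \<up> k"
    have q: "q \<in> S" "q \<in> R3" "p = inn S q"
      using P[OF _ k(1)] k by (auto simp: q_def)
    show "p \<in> inn S ` S" using q by auto
    assume "g \<in> inn S ` S"
    then obtain h where h: "h \<in> S" "g = inn S h" by auto
    have "p \<up> g = inn S (a \<up> (k * h))"
      using k h aS by (simp add: cj_by_mult inn.hom_cj)
    then show "p \<up> g \<in> {inn S (a \<up> g) | g. g \<in> S}"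
      using k h by auto
    note st = R3_struct[OF q(2) h(1)] and ce = R3_central[OF q(2) h(1)]
    have one: "inn S z = 1" if "z \<in> S" "\<And>w. w \<in> S \<Longrightarrow> z \<up> w = z" for z
      using that by (simp add: inn_eq_1_iff)
    have "inn S [[q; q \<up> h]; q] = 1" and "inn S [[q; q \<up> h]; h] = 1"
      using q h ce by (auto intro!: one)
    then have ek: "[[p; p \<up> g]; p] = 1" "[[p; p \<up> g]; g] = 1"
      using q h by (simp_all add: inn.hom_cm inn.hom_cj)
    then show "[p; p \<up> g] \<up> p = [p; p \<up> g]" "[p; p \<up> g] \<up> g = [p; p \<up> g]"
      by (simp_all add: cm_eq_1_iff)
    have "inn S ([[q; h]; h] \<up> q) =
        inn S ([[q; h]; h] * [[q; q \<up> h]; h] * [[q; q \<up> h]; q])"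
      by (simp only: st(7))
    then have "[[p; g]; g] \<up> p = [[p; g]; g] * [[p; p \<up> g]; g] * [[p; p \<up> g]; p]"
      using q h by (simp add: inn.hom_cm inn.hom_cj inn.hom_mult)
    then show "[[p; g]; g] \<up> p = [[p; g]; g]"
      by (simp add: ek)
    have "inn S ([[q; h]; h] \<up> h) = inn S [[q; h]; h]"
      by (simp only: R3_fix[OF q(2) h(1)])
    then show "[[p; g]; g] \<up> g = [[p; g]; g]"
      using q h by (simp add: inn.hom_cm inn.hom_cj)
    fix g' assume "g' \<in> inn S ` S"
    then obtain h' where h': "h' \<in> S" "g' = inn S h'" by auto
    define y where "y = [q \<up> h; [q; q \<up> h']]"
    have yS: "y \<in> S" using q h h' by (simp add: y_def)
    have iy: "inn S y = [p \<up> g; [p; p \<up> g']]"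
      using q h h' by (simp add: y_def inn.hom_cm inn.hom_cj)
    assume "[p \<up> g; [p; p \<up> g']] * [p \<up> g; [p; p \<up> g']] = 1"
    then have "inn S (y * y) = 1" using yS by (simp add: inn.hom_mult iy)
    then have yy: "(y * y) \<up> w = y * y" if "w \<in> S" for w
      using yS that by (simp add: inn_eq_1_iff del: cj_mult)
    have R: "q \<up> h \<in> R3" "q \<up> h' \<in> R3" using q h h' by (simp_all add: R3_cj)
    have "y \<up> w = y" if w: "w \<in> S" for w
    proof (rule R3_fix_central[OF _ _ _ w])
      have "lcs S (Suc 0 + 3) y"
        unfolding y_def using q h h' by (intro lcs_cm_add lcs_3_conj lcs_base) auto
      then show "lcs S 4 y" by simp
      show "z \<up> y = z" if "\<forall>r \<in> R3. z \<up> r = z" for z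
        unfolding y_def using that q R by (intro cj_fix_cm) auto
      have "(y * y * (y * y)) \<up> v = y * y * (y * y)" if "v \<in> S" for v
        using yy[OF that] by (simp only: cj_mult[of "y * y"])
      then show "(y * (y * (y * y))) \<up> v = y * (y * (y * y))" if "v \<in> S" for v
        using that by (simp only: mult.assoc)
    qed
    then have "inn S y = 1" using yS by (simp add: inn_eq_1_iff)
    then show "[p \<up> g; [p; p \<up> g']] = 1" by (simp only: iy)
  qed
qed

text \<open>\<open>psi_eq_1\<close> with the conjugate by \<open>h\<close> as base point; the other
  two are reached from it by \<open>h\<^sup>- * g\<close> and \<open>h\<^sup>- * k\<close>.\<close>

lemma inn_class2:
  assumes a: "a \<in> R3" and g: "g \<in> inn S ` S" "h \<in> inn S ` S" "k \<in> inn S ` S"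
  shows "inn S a \<up> g \<up> [inn S a \<up> h; inn S a \<up> k] = inn S a \<up> g"
proof -
  interpret c: conj_class3 "inn S ` S" "{inn S (a \<up> g) | g. g \<in> S}"
    using a by (rule inn_conj_class3)
  have "inn S a = inn S (a \<up> 1)" by simp
  then have "inn S a \<in> {inn S (a \<up> g) | g. g \<in> S}" using one_mem by blast
  then have p: "inn S a \<up> h \<in> {inn S (a \<up> g) | g. g \<in> S}"
    using g by (intro c.C_cj)
  have "[inn S a \<up> h \<up> (h\<^sup>- * g); [inn S a \<up> h; inn S a \<up> h \<up> (h\<^sup>- * k)]] = 1"
    using g by (intro c.psi_eq_1[OF p]) auto
  then show ?thesis by (simp add: cj_by_mult cm_eq_1_iff)
qed

lemma R3_hypercentral:
  assumes S: "S = Collect (gen {a, b, x})" and a: "a \<in> R3" and b: "b \<in> R3"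
  shows "a \<in> Zw"
proof -
  interpret c: class2_pair "inn S ` S" "inn S a" "inn S b" "inn S x"
  proof (intro class2_pair.intro inn.subgrp_image class2_pair_axioms.intro)
    show "inn S ` S = Collect (gen {inn S a, inn S b, inn S x})"
      using inn.image_gen[OF S] by simp
    have x: "x \<in> S" unfolding S by (auto intro: gen_base)
    fix g assume "g \<in> inn S ` S"
    then obtain h where h: "h \<in> S" "g = inn S h" by auto
    have ah: "a \<up> h \<in> R3" "a \<in> S" "a \<up> h \<in> S" using a h R3_cj R3_mem by blast+
    have "inn S [[[a \<up> h; x]; x]; x] = 1"
      using R3_D[OF ah(1) x] by simp
    then show "[[[inn S a \<up> g; inn S x]; inn S x]; inn S x] = 1"
      using ah x h by (simp add: inn.hom_cm inn.hom_cj)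
  qed (use a b in \<open>simp_all add: inn_class2\<close>)
  obtain k where "inn S a \<in> zc (inn S ` S) k"
    using c.a_hypercentral unfolding c.Zw_def by blast
  moreover have "z \<in> zc S 1" if "z \<in> S" "inn S z = 1" for z
    using that by (simp add: inn_eq_1_iff cm_eq_1_iff)
  ultimately show ?thesis
    using inn.zc_pullback R3_mem[OF a] unfolding Zw_def by blast
qed

text \<open>Once \<open>a\<close> and \<open>b\<close> lie in \<open>zc S m\<close>, the commutators
  of \<open>x\<close> with all three generators do, so \<open>x\<close> lies one step higher and the
  upper central series reaches all of \<open>S\<close>.\<close>

lemma nilpotent:
  assumes S: "S = Collect (gen {a, b, x})" and a: "a \<in> R3" and b: "b \<in> R3"
  shows "\<exists>c. \<forall>z. lcs S (Suc c) z \<longrightarrow> z = 1"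
proof -
  have S': "S = Collect (gen {b, a, x})" using S by (simp add: insert_commute)
  have x: "x \<in> S" unfolding S by (auto intro: gen_base)
  obtain k l where "a \<in> zc S k" "b \<in> zc S l"
    using R3_hypercentral[OF S a b] R3_hypercentral[OF S' b a] by (auto simp: Zw_def)
  then obtain m where m: "a \<in> zc S m" "b \<in> zc S m"
    using zc_le[of k "max k l" a] zc_le[of l "max k l" b] by auto
  have "x \<in> zc S (Suc m)"
  proof (rule zc_gen[OF S x])
    have "[a; x]\<^sup>- \<in> zc S m" "[b; x]\<^sup>- \<in> zc S m"
      using zc_Suc[OF m(1)] zc_Suc[OF m(2)] x by (auto intro: zc_minv)
    then show "[x; a] \<in> zc S m" "[x; b] \<in> zc S m" by (simp_all only: cm_minv)
    show "[x; x] \<in> zc S m" by (simp add: zc_one)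
  qed
  then have base: "y \<in> zc S (Suc m)" if "y \<in> {a, b, x}" for y
    using that m zc_Suc by blast
  have "y \<in> zc S (Suc m)" if "gen {a, b, x} y" for y
    using that by (induction rule: gen.induct) (auto intro: base zc_mult zc_minv zc_one simp del: zc.simps)
  then have all: "y \<in> zc S (Suc m)" if "y \<in> S" for y using that S by blast
  \<comment> \<open>The lower central series is counted from 1, hence the second
    \<open>Suc\<close>.\<close>
  have "z \<in> zc S (Suc (Suc m) - n)" if "lcs S n z" "n \<le> Suc (Suc m)" for n z
    using that
  proof (induction rule: lcs.induct)
    case (lcs_cm n z g)
    then have "z \<in> zc S (Suc (Suc m - n))" by (simp add: Suc_diff_le del: zc.simps)
    then show ?case using lcs_cm by simp
  qed (auto intro: all zc_mult zc_minv simp del: zc.simps)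
  from this[of "Suc (Suc m)"] show ?thesis by (intro exI[of _ "Suc m"]) simp
qed

end

section \<open>Multilinear calculus on the last term\<close>

definition zp :: "'a::mgroup \<Rightarrow> int \<Rightarrow> 'a" where
  "zp g c = (if c \<ge> 0 then g ^ nat c else g\<^sup>- ^ nat (- c))"

lemma zp_0 [simp]: "zp g 0 = 1" and zp_1 [simp]: "zp g 1 = g" and zp_m1 [simp]: "zp g (- 1) = g\<^sup>-"
  by (simp_all add: zp_def)

lemma zp_succ: "zp g (c + 1) = zp g c * (g::'a::mgroup)"
proof (cases "c \<ge> 0")
  case True
  then have "nat (c + 1) = Suc (nat c)" by simp
  then show ?thesis using True by (simp add: zp_def power_Suc2 del: power_Suc)
next
  case False
  define m where "m = nat (- (c + 1))"
  have "zp g c = g\<^sup>- ^ Suc m" "zp g (c + 1) = g\<^sup>- ^ m"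
    using False by (auto simp: zp_def m_def Suc_nat_eq_nat_zadd1 simp del: power_Suc)
  then show ?thesis by (simp add: power_Suc2 mult.assoc del: power_Suc)
qed

lemma zp_pred: "zp g (c - 1) = zp g c * (g::'a::mgroup)\<^sup>-"
  using zp_succ[of g "c - 1"] by (simp add: mult.assoc)

lemma zp_add: "zp g (c + d) = zp g c * zp (g::'a::mgroup) d"
proof (induction d rule: int_induct[where k = 0])
  case (step1 i)
  then show ?case by (metis zp_succ add.assoc mult.assoc)
next
  case (step2 i)
  have "zp g (c + (i - 1)) = zp g (c + i - 1)" by (simp add: algebra_simps)
  then show ?case using step2 by (simp only: zp_pred mult.assoc)
qed simp

lemma zp_minus: "zp g (- c) = (zp (g::'a::mgroup) c)\<^sup>-"
  by (metis add.right_inverse minv_unique zp_0 zp_add)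

lemma zp_one [simp]: "zp 1 c = (1::'a::mgroup)"
  by (simp add: zp_def)

lemma zp_mem:
  assumes "g \<in> A" "1 \<in> A" "\<And>x y. x \<in> A \<Longrightarrow> y \<in> A \<Longrightarrow> x * y \<in> A" "\<And>x. x \<in> A \<Longrightarrow> x\<^sup>- \<in> A"
  shows "zp g c \<in> (A :: 'a::mgroup set)"
proof -
  have "x ^ m \<in> A" if "x \<in> A" for x m
    using that by (induction m) (auto intro: assms)
  then show ?thesis using assms by (simp add: zp_def)
qed

text \<open>The entries come before the argument so that \<open>T u\<close> is a map, which turns
  into a homomorphism in high weight.\<close>

abbreviation T :: "'a::mgroup list \<Rightarrow> 'a \<Rightarrow> 'a" where
  "T u p \<equiv> foldl cm p u"

lemma T_one [simp]: "T u (1::'a::mgroup) = 1"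
  by (induction u) simp_all

text \<open>Entries may themselves be commutators, so the weight \<open>k\<close> is recorded
  separately from the length of the list.\<close>

inductive tail :: "'a::mgroup set \<Rightarrow> 'a list \<Rightarrow> nat \<Rightarrow> bool" for S where
  tail_Nil: "tail S [] 0"
| tail_Cons: "lcs S j g \<Longrightarrow> tail S u k \<Longrightarrow> tail S (g # u) (j + k)"

type_synonym word = "nat list"
type_synonym vec = "(int \<times> word) list"

definition neg :: "vec \<Rightarrow> vec" where
  "neg = map (\<lambda>(c, w). (- c, w))"

definition scale :: "int \<Rightarrow> vec \<Rightarrow> vec" where
  "scale d = map (\<lambda>(c, w). (d * c, w))"

definition wrap :: "word \<Rightarrow> word \<Rightarrow> vec \<Rightarrow> vec" where
  "wrap p r = map (\<lambda>(c, w). (c, p @ w @ r))"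

text \<open>The associative expansion of the left-normed Lie monomial of a word.\<close>
primrec asc_acc :: "vec \<Rightarrow> word \<Rightarrow> vec" where
  "asc_acc V [] = V"
| "asc_acc V (l # w) = asc_acc (wrap [] [l] V @ neg (wrap [l] [] V)) w"

definition asc :: "word \<Rightarrow> vec" where
  "asc w = asc_acc [(1, [hd w])] (tl w)"

lemma asc_acc_snoc: "asc_acc V (w @ [l]) = wrap [] [l] (asc_acc V w) @ neg (wrap [l] [] (asc_acc V w))"
  by (induction w arbitrary: V) simp_all

lemma asc_snoc: "w \<noteq> [] \<Longrightarrow> asc (w @ [l]) = wrap [] [l] (asc w) @ neg (wrap [l] [] (asc w))"
  by (simp add: asc_def asc_acc_snoc)

text \<open>The bound on \<open>n\<close> places the last term inside the fifth one, so that factors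
  2 can be divided out there.\<close>

locale engel_top = engel_grp +
  fixes n :: nat and \<rho> :: "nat \<Rightarrow> 'a"
  assumes n5: "5 \<le> n" and kill: "lcs S (Suc n) z \<Longrightarrow> z = 1"
    and \<rho>_mem [simp]: "\<rho> l \<in> S" and \<rho>_R3: "\<rho> 0 \<in> R3" "\<rho> 1 \<in> R3"
begin

definition \<Gamma> :: "'a set" where "\<Gamma> = {z. lcs S n z}"

lemma \<Gamma>_commute: "x \<in> \<Gamma> \<Longrightarrow> y \<in> S \<Longrightarrow> x * y = y * x"
  using lcs_cm[of S n x y] kill[of "[x; y]"] by (simp add: \<Gamma>_def cm_eq_1_iff cj_fix_iff)

lemma \<Gamma>_mem: "x \<in> \<Gamma> \<Longrightarrow> x \<in> S"
  by (auto simp: \<Gamma>_def dest: lcs_mem)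

lemma \<Gamma>_one [simp]: "1 \<in> \<Gamma>" and \<Gamma>_mult [simp]: "x \<in> \<Gamma> \<Longrightarrow> y \<in> \<Gamma> \<Longrightarrow> x * y \<in> \<Gamma>"
  and \<Gamma>_minv [simp]: "x \<in> \<Gamma> \<Longrightarrow> x\<^sup>- \<in> \<Gamma>"
  using n5 by (auto simp: \<Gamma>_def intro: lcs_mult lcs_minv lcs_one)

lemma \<Gamma>_zp [simp]: "x \<in> \<Gamma> \<Longrightarrow> zp x c \<in> \<Gamma>"
  by (rule zp_mem) auto

lemma \<Gamma>_comm: "x \<in> \<Gamma> \<Longrightarrow> y \<in> \<Gamma> \<Longrightarrow> x * y = y * x"
  by (simp add: \<Gamma>_commute \<Gamma>_mem)

lemma \<Gamma>_left_comm: "x \<in> \<Gamma> \<Longrightarrow> y \<in> \<Gamma> \<Longrightarrow> x * (y * z) = y * (x * z)"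
  by (metis \<Gamma>_comm mult.assoc)

lemma \<Gamma>_sqrt:
  assumes "x \<in> \<Gamma>" "x * x = 1"
  shows "x = 1"
  using assms n5 lcs_le[of n x 5] by (auto simp: \<Gamma>_def intro: tf2)

lemma \<Gamma>_power2: "x \<in> \<Gamma> \<Longrightarrow> x ^ (2 ^ k) = 1 \<Longrightarrow> x = 1"
proof (induction k)
  case (Suc k)
  define y where "y = x ^ 2 ^ k"
  have "x ^ m \<in> \<Gamma>" for m using Suc.prems by (induction m) auto
  then have "y \<in> \<Gamma>" by (simp add: y_def)
  moreover have "y * y = 1" using Suc.prems(2) by (simp add: y_def power2_eq_square mult_2 power_add)
  ultimately have "y = 1" by (rule \<Gamma>_sqrt)
  then show ?case using Suc by (simp add: y_def)
qed simp

lemma zp_mult: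
  assumes "x \<in> \<Gamma>" "y \<in> \<Gamma>"
  shows "zp (x * y) c = zp x c * zp y c"
proof (induction c rule: int_induct[where k = 0])
  case (step1 i)
  then show ?case using assms by (simp add: zp_succ mult.assoc \<Gamma>_left_comm[of x "zp y i"])
next
  case (step2 i)
  then show ?case using assms by (simp add: zp_pred mult.assoc \<Gamma>_left_comm \<Gamma>_comm)
qed simp

section \<open>Left-normed commutators as homomorphisms\<close>

lemma T_lcs: "tail S u k \<Longrightarrow> lcs S m p \<Longrightarrow> lcs S (m + k) (T u p)"
proof (induction arbitrary: m p rule: tail.induct)
  case (tail_Cons j g u k)
  have "lcs S (m + j) [p; g]"
    using tail_Cons by (intro lcs_cm_add)
  from tail_Cons.IH[OF this] show ?case by (simp add: add.assoc)
qed simp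

lemma T_kill: "tail S u k \<Longrightarrow> lcs S m p \<Longrightarrow> n < m + k \<Longrightarrow> T u p = 1"
  using T_lcs[of u k m p] lcs_le[of "m + k" "T u p" "Suc n"] by (auto intro: kill)

text \<open>\<open>[p * p'; g]\<close> differs from the product of the two commutators only by
  \<open>[[p; g]; p']\<close>, whose weight is larger by \<open>m\<close>, so that
  \<open>T u\<close> sends it beyond weight \<open>n\<close>.\<close>

lemma T_hom:
  "tail S u k \<Longrightarrow> lcs S m p \<Longrightarrow> lcs S m p' \<Longrightarrow> n \<le> m + k \<Longrightarrow> T u (p * p') = T u p * T u p'"
proof (induction arbitrary: m p p' rule: tail.induct)
  case (tail_Cons j g u k)
  have l: "lcs S (m + j) [p; g]" "lcs S (m + j) [p'; g]"
    using tail_Cons by (auto intro: lcs_cm_add)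
  have l2: "lcs S (m + j + m) [[p; g]; p']"
    using tail_Cons l by (intro lcs_cm_add)
  have m: "0 < m" using tail_Cons lcs_pos by blast
  have l3: "lcs S (m + j) [[p; g]; p']"
    by (rule lcs_le[OF l2]) (use m in \<open>auto\<close>)
  have nk: "n \<le> m + j + k" using tail_Cons by simp
  have "T (g # u) (p * p') = T u ([p; g] * [[p; g]; p'] * [p'; g])"
    by (simp add: cm_mult_left cj_eq_mult_cm[of "[p; g]" p'])
  also have "\<dots> = T u [p; g] * T u [[p; g]; p'] * T u [p'; g]"
    using l l3 nk by (simp add: tail_Cons.IH[of "m + j"] lcs_mult)
  also have "T u [[p; g]; p'] = 1"
    using tail_Cons.hyps(2) l2 by (rule T_kill) (use nk m in \<open>auto\<close>)
  finally show ?case by simp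
qed simp

lemma T_minv:
  assumes "tail S u k" "lcs S m p" "n \<le> m + k"
  shows "T u (p\<^sup>-) = (T u p)\<^sup>-"
  using T_hom[OF assms(1,2) lcs_minv[OF assms(2)] assms(3)] by (metis T_one minv_right minv_unique)

lemma T_cj:
  assumes "tail S u k" "lcs S m p" "n \<le> m + k" "h \<in> S"
  shows "T u (p \<up> h) = T u p"
proof -
  have "lcs S (Suc m) [p; h]" using assms by (intro lcs_cm)
  then have "T u [p; h] = 1" "lcs S m [p; h]"
    using T_kill[OF assms(1)] assms lcs_pos lcs_Suc by auto
  then show ?thesis
    using T_hom[OF assms(1,2) _ assms(3)] by (simp add: cj_eq_mult_cm)
qed

lemma T_hom_right:
  assumes "tail S u k" "lcs S i p" "lcs S j g" "lcs S j h" "n \<le> i + j + k"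
  shows "T u [p; g * h] = T u [p; g] * T u [p; h]"
proof -
  have l: "lcs S (i + j) [p; g]" "lcs S (i + j) [p; h]"
    using assms by (auto intro: lcs_cm_add)
  have hS: "h \<in> S" using assms lcs_mem by blast
  have "T u [p; g * h] = T u [p; h] * T u ([p; g] \<up> h)"
    unfolding cm_mult_right using assms l hS by (intro T_hom) (auto intro: lcs_cj)
  also have "T u ([p; g] \<up> h) = T u [p; g]"
    using assms l hS by (intro T_cj)
  also have "T u [p; h] * T u [p; g] = T u [p; g] * T u [p; h]"
  proof -
    have "T u [p; g] \<in> \<Gamma>" "T u [p; h] \<in> \<Gamma>"
      unfolding \<Gamma>_def using T_lcs[OF assms(1) l(1)] T_lcs[OF assms(1) l(2)] assms(5) n5
      by (auto intro: lcs_le)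
    then show ?thesis by (rule \<Gamma>_comm[OF _ _, rotated])
  qed
  finally show ?thesis .
qed

lemma T_minv_right:
  assumes "tail S u k" "lcs S i p" "lcs S j g" "n \<le> i + j + k"
  shows "T u [p; g\<^sup>-] = (T u [p; g])\<^sup>-"
  using T_hom_right[OF assms(1-3) lcs_minv[OF assms(3)] assms(4)]
  by (simp add: minv_unique)

text \<open>Hall-Witt with conjugations and inverses made harmless by the homomorphism property.
  Additively it is the Jacobi identity, \<open>[p, [q, l]] = [p, q, l] - [p, l, q]\<close>.\<close>

lemma T_jacobi:
  assumes u: "tail S u k" and p: "lcs S i p" and q: "lcs S j q" and l: "lcs S m l"
    and n: "n \<le> i + j + m + k"
  shows "T u [p; [q; l]] = T (l # u) [p; q] * (T (q # u) [p; l])\<^sup>-"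
proof -
  have S: "p \<in> S" "q \<in> S" "l \<in> S" using p q l by (auto dest: lcs_mem)
  have tl: "tail S (l # u) (m + k)" "tail S (q # u) (j + k)" "tail S (p # q # u) (i + (j + k))"
    using u p q l by (auto intro: tail.intros)
  have pq: "lcs S (i + j) [p; q\<^sup>-]" and lp: "lcs S (m + i) [l\<^sup>-; p\<^sup>-]" and ql: "lcs S (j + m) [q; l]"
    using p q l by (auto intro: lcs_cm_add lcs_minv)
  define X Y Z where "X = [[q; l]; p]" and "Y = [[l\<^sup>-; p\<^sup>-]; q]" and "Z = [[p; q\<^sup>-]; l\<^sup>-]"
  have XYZ: "lcs S (i + j + m) X" "lcs S (i + j + m) Y" "lcs S (i + j + m) Z"
    using lcs_cm_add[OF p ql] lcs_cm_add[OF q lp] lcs_cm_add[OF lcs_minv[OF l] pq]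
    by (simp_all add: X_def Y_def Z_def ac_simps)
  have "X \<up> l\<^sup>- * (Y \<up> p * Z \<up> q) = 1"
    using hall_witt[of q "l\<^sup>-" p] by (simp add: X_def Y_def Z_def mult.assoc)
  then have "T u (X \<up> l\<^sup>- * (Y \<up> p * Z \<up> q)) = 1" by simp
  then have "T u (X \<up> l\<^sup>-) * (T u (Y \<up> p) * T u (Z \<up> q)) = 1"
    using u XYZ S n by (simp add: T_hom[where m = "i + j + m"] lcs_cj lcs_mult)
  then have 1: "T u X * (T u Y * T u Z) = 1"
    using u XYZ S n by (simp add: T_cj[where m = "i + j + m"])
  have 2: "T u X = (T u [p; [q; l]])\<^sup>-"
  proof -
    have "lcs S (i + j + m) [p; [q; l]]"
      using lcs_cm_add[OF ql p] by (simp add: ac_simps)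
    then show ?thesis
      using T_minv[OF u, of "i + j + m" "[p; [q; l]]"] n by (simp add: X_def cm_minv)
  qed
  have lpl: "lcs S (m + i) [p; l]"
    using lcs_cm_add[OF l p] by (simp add: ac_simps)
  have 3: "T u Y = (T (q # u) [p; l])\<^sup>-"
  proof -
    have "T u Y = T (q # u) [l\<^sup>-; p\<^sup>-]" by (simp add: Y_def)
    also have "\<dots> = (T (q # u) [l\<^sup>-; p])\<^sup>-"
      using tl(2) lcs_minv[OF l] p by (rule T_minv_right[of _ _ m _ i]) (use n in simp)
    also have "T (q # u) [l\<^sup>-; p] = T (p # q # u) (l\<^sup>-)" by simp
    also have "\<dots> = (T (p # q # u) l)\<^sup>-"
      using tl(3) l by (rule T_minv) (use n in simp)
    also have "T (p # q # u) l = T (q # u) ([p; l]\<^sup>-)" by (simp add: cm_minv)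
    also have "\<dots> = (T (q # u) [p; l])\<^sup>-"
      using tl(2) lpl by (rule T_minv) (use n in simp)
    finally show ?thesis by simp
  qed
  have 4: "T u Z = T (l # u) [p; q]"
  proof -
    have "T u Z = (T u [[p; q\<^sup>-]; l])\<^sup>-"
      unfolding Z_def using u pq l n by (rule T_minv_right)
    also have "T u [[p; q\<^sup>-]; l] = T (l # u) [p; q\<^sup>-]" by simp
    also have "\<dots> = (T (l # u) [p; q])\<^sup>-"
      using tl(1) p q by (rule T_minv_right) (use n in simp)
    finally show ?thesis by simp
  qed
  have "T (l # u) [p; q] \<in> \<Gamma>" "T (q # u) [p; l] \<in> \<Gamma>"
    unfolding \<Gamma>_def using T_lcs[OF tl(1) lcs_cm_add[OF q p]] T_lcs[OF tl(2) lpl] n n5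
    by (auto elim!: lcs_le)
  then show ?thesis
    using 1 unfolding 2 3 4 by (simp add: \<Gamma>_comm eq_minv_mult_iff[symmetric])
qed

section \<open>Evaluation of formal combinations of words\<close>

definition val :: "(word \<Rightarrow> 'a) \<Rightarrow> vec \<Rightarrow> 'a" where
  "val f V = foldr (\<lambda>(c, w) y. zp (f w) c * y) V 1"

lemma val_Nil [simp]: "val f [] = 1" and val_Cons [simp]: "val f ((c, w) # V) = zp (f w) c * val f V"
  by (simp_all add: val_def)

lemma val_append [simp]: "val f (V @ W) = val f V * val f W"
  by (induction V) (auto simp: mult.assoc)

lemma val_wrap: "val f (wrap p r V) = val (\<lambda>w. f (p @ w @ r)) V"
  by (induction V) (auto simp: wrap_def)

lemma val_\<Gamma>: "(\<And>c w. (c, w) \<in> set V \<Longrightarrow> f w \<in> \<Gamma>) \<Longrightarrow> val f V \<in> \<Gamma>"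
proof (induction V)
  case (Cons a V)
  obtain c w where a: "a = (c, w)" by (cases a)
  have "f w \<in> \<Gamma>" "val f V \<in> \<Gamma>" using Cons by (auto simp: a)
  then show ?case by (simp add: a)
qed simp

lemma val_scale:
  "(\<And>c w. (c, w) \<in> set V \<Longrightarrow> f w \<in> \<Gamma>) \<Longrightarrow> val f (scale d V) = zp (val f V) d"
proof (induction V)
  case (Cons a V)
  obtain c w where a: "a = (c, w)" by (cases a)
  have fw: "f w \<in> \<Gamma>" using Cons.prems by (auto simp: a)
  have V: "val f V \<in> \<Gamma>" using Cons.prems by (auto intro!: val_\<Gamma>)
  have "zp (f w) (d * c) = zp (zp (f w) c) d"
  proof (induction d rule: int_induct[where k = 0])
    case (step1 i)
    then show ?case by (simp add: zp_succ zp_add algebra_simps)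
  next
    case (step2 i)
    have "zp (f w) ((i - 1) * c) = zp (f w) (i * c) * (zp (f w) c)\<^sup>-"
      by (simp add: algebra_simps flip: zp_minus zp_add)
    then show ?case using step2 by (simp add: zp_pred)
  qed simp
  moreover have "val f (scale d V) = zp (val f V) d"
    using Cons.prems by (intro Cons.IH) auto
  ultimately show ?case
    using fw V by (simp add: a scale_def zp_mult)
qed (simp add: scale_def)

lemma val_neg:
  assumes "\<And>c w. (c, w) \<in> set V \<Longrightarrow> f w \<in> \<Gamma>"
  shows "val f (neg V) = (val f V)\<^sup>-"
  using val_scale[where d = "-1" and V = V and f = f, OF assms] by (simp add: neg_def scale_def)

definition F :: "word \<Rightarrow> 'a" where
  "F w = T (map \<rho> (tl w)) (\<rho> (hd w))"

lemma F_append: "w \<noteq> [] \<Longrightarrow> F (w @ r) = T (map \<rho> r) (F w)"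
  by (simp add: F_def)

lemma tail_letters: "tail S u k \<Longrightarrow> tail S (map \<rho> w @ u) (length w + k)"
proof (induction w)
  case (Cons l w)
  then have "tail S (\<rho> l # map \<rho> w @ u) (Suc 0 + (length w + k))"
    by (intro tail_Cons) (auto intro: lcs_base)
  then show ?case by simp
qed simp

lemma lcs_F: "w \<noteq> [] \<Longrightarrow> lcs S (length w) (F w)"
  using T_lcs[OF tail_letters[OF tail_Nil, of "tl w"], of "Suc 0" "\<rho> (hd w)"]
  by (cases w) (simp_all add: F_def lcs_base)

lemma length_asc_acc: "(\<And>c w. (c, w) \<in> set V \<Longrightarrow> length w = m) \<Longrightarrow> (c, w) \<in> set (asc_acc V q) \<Longrightarrow>
    length w = m + length q"
proof (induction q arbitrary: V m)
  case (Cons l q)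
  have "length w = Suc m + length q"
    by (rule Cons.IH[OF _ Cons.prems(2)[simplified]]) (use Cons.prems(1) in \<open>auto simp: wrap_def neg_def\<close>)
  then show ?case by simp
qed simp

lemma length_asc: "(c, w) \<in> set (asc q) \<Longrightarrow> q \<noteq> [] \<Longrightarrow> length w = length q"
  using length_asc_acc[of "[(1, [hd q])]" 1 c w "tl q"] by (cases q) (auto simp: asc_def)

text \<open>By repeated use of \<open>T_jacobi\<close>, a commutator with \<open>F q\<close> acts
  like the associative expansion of \<open>q\<close>, whose words append their letters one by one.
  Nested brackets thus become combinations of left-normed words.\<close>

lemma T_asc:
  assumes "q \<noteq> []" "tail S u k" "lcs S i p" "n \<le> i + length q + k"
  shows "T u [p; F q] = val (\<lambda>w. T (map \<rho> w @ u) p) (asc q)"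
  using assms
proof (induction q arbitrary: u k i p rule: rev_induct)
  case (snoc l q)
  show ?case
  proof (cases "q = []")
    case True
    then show ?thesis by (simp add: F_def asc_def)
  next
    case False
    have Fq: "F (q @ [l]) = [F q; \<rho> l]" using False by (simp add: F_append)
    have l: "lcs S (Suc 0) (\<rho> l)" by (simp add: lcs_base)
    note u = snoc.prems(2) and p = snoc.prems(3)
    have pl: "lcs S (Suc i) [p; \<rho> l]" using p by (intro lcs_cm) simp_all
    have lu: "tail S (\<rho> l # u) (Suc 0 + k)" using l u by (rule tail_Cons)
    have \<Gamma>2: "T (map \<rho> w @ u) [p; \<rho> l] \<in> \<Gamma>" if "(c, w) \<in> set (asc q)" for c w
      using T_lcs[OF tail_letters[OF u, of w] pl] length_asc[OF that False] snoc.prems(4) n5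
      unfolding \<Gamma>_def by (auto elim!: lcs_le)
    have "T u [p; F (q @ [l])] = T (\<rho> l # u) [p; F q] * (T (F q # u) [p; \<rho> l])\<^sup>-"
      unfolding Fq using u p lcs_F[OF False] l by (rule T_jacobi) (use snoc.prems in simp)
    also have "T (\<rho> l # u) [p; F q] = val (\<lambda>w. T (map \<rho> w @ \<rho> l # u) p) (asc q)"
      using False lu p by (rule snoc.IH) (use snoc.prems in simp)
    also have "T (F q # u) [p; \<rho> l] = T u [[p; \<rho> l]; F q]" by simp
    also have "\<dots> = val (\<lambda>w. T (map \<rho> w @ u) [p; \<rho> l]) (asc q)"
      using False u pl by (rule snoc.IH) (use snoc.prems in simp)
    also have "(\<dots>)\<^sup>- = val (\<lambda>w. T (map \<rho> w @ u) [p; \<rho> l]) (neg (asc q))"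
      using \<Gamma>2 by (simp add: val_neg)
    finally show ?thesis
      using False by (simp add: asc_snoc val_wrap) (simp add: neg_def wrap_def val_def foldr_map o_def case_prod_beta)
  qed
qed simp

lemma T_\<Gamma>: "tail S u k \<Longrightarrow> lcs S m p \<Longrightarrow> n \<le> m + k \<Longrightarrow> T u p \<in> \<Gamma>"
  using T_lcs[of u k m p] n5 unfolding \<Gamma>_def by (auto elim!: lcs_le)

text \<open>The Engel identity at \<open>g * y\<close>, expanded and stripped of all commutators of weight above \<open>n\<close>.\<close>
lemma engel_P:
  assumes c: "c \<in> R3" and g: "g \<in> S" and y: "lcs S j y" and j: "2 \<le> j"
    and u: "tail S u k" and n: "n = 3 + j + k"
  shows "T (y # u) [[c; g]; g] * T (g # u) [[c; g]; y] * T (g # g # u) [c; y] = 1"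
proof -
  have cS: "c \<in> S" using c by (rule R3_mem)
  have yS: "y \<in> S" using y by (rule lcs_mem)
  have c1: "lcs S (Suc 0) c" and g1: "lcs S (Suc 0) g" using cS g by (simp_all add: lcs_base)
  define v where "v = [c; g]"
  define t where "t = [v; g]"
  have v2: "lcs S 2 v" using lcs_cm[OF c1 g] by (simp add: v_def numeral_2_eq_2)
  have t3: "lcs S 3 t" using lcs_cm[OF v2 g] by (simp add: t_def numeral_3_eq_3)
  have cy: "lcs S (1 + j) [c; y]" using lcs_cm_add[OF y c1] by simp
  have vy: "lcs S (2 + j) [v; y]" using lcs_cm_add[OF y v2] .
  have ty: "lcs S (3 + j) [t; y]" using lcs_cm_add[OF y t3] .
  define w1 where "w1 = [c; y] \<up> v * [v; y]"
  have w1: "lcs S (1 + j) w1"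
    unfolding w1_def using cy lcs_mem[OF v2] by (intro lcs_mult lcs_cj lcs_le[OF vy]) auto
  have e1: "[c; g * y] = v * w1"
    by (simp add: w1_def v_def cm_def cj_def mult.assoc)
  define w2 where "w2 = [v; y] \<up> (w1 * t) * [t; y * w1] * [w1; g * y]"
  have e2: "[[c; g * y]; g * y] = t * w2"
    unfolding e1 by (simp add: w2_def t_def cm_def cj_def mult.assoc)
  \<comment> \<open>The weight \<open>1 + 2 * j\<close> is at least \<open>3 + j\<close> because of
    \<open>2 \<le> j\<close>; the same happens for \<open>w2y\<close> below.\<close>
  have w1y: "lcs S (2 + j + 1) [w1; y]"
    by (rule lcs_le[OF lcs_cm_add[OF y w1]]) (use j in auto)
  have w1g: "lcs S (2 + j) [w1; g]" using lcs_cm[OF w1 g] by simp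
  have yw1: "lcs S j (y * w1)" using y lcs_le[OF w1, of j] j by (intro lcs_mult) auto
  have tyw: "lcs S (3 + j) [t; y * w1]" using lcs_cm_add[OF yw1 t3] .
  have w1gy: "[w1; g * y] = [w1; y] * [w1; g] \<up> y" by (rule cm_mult_right)
  have l2: "lcs S (2 + j) [w1; g * y]"
    unfolding w1gy using w1g yS by (intro lcs_mult lcs_cj lcs_le[OF w1y]) auto
  have vyw: "lcs S (2 + j) ([v; y] \<up> (w1 * t))"
    using vy lcs_mem[OF w1] lcs_mem[OF t3] by (intro lcs_cj) auto
  have w2: "lcs S (2 + j) w2"
    unfolding w2_def by (intro lcs_mult vyw l2 lcs_le[OF tyw]) auto
  have gu: "tail S (g # u) (1 + k)" "tail S (g # g # u) (2 + k)"
    using tail_Cons[OF g1 u] tail_Cons[OF g1 tail_Cons[OF g1 u]] by simp_all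
  have "T (g # u) w2 = T (g # u) [v; y] * T (g # g # u) [c; y]"
  proof -
    have tyw': "lcs S (2 + j) [t; y * w1]" by (rule lcs_le[OF tyw]) auto
    have w1y': "lcs S (2 + j) [w1; y]" by (rule lcs_le[OF w1y]) auto
    have "T (g # u) w2 = T (g # u) ([v; y] \<up> (w1 * t)) * T (g # u) [t; y * w1] * T (g # u) [w1; g * y]"
      unfolding w2_def using gu(1) vyw tyw' l2 n
      by (simp add: T_hom[where m = "2 + j"] lcs_mult del: foldl_Cons)
    also have "T (g # u) ([v; y] \<up> (w1 * t)) = T (g # u) [v; y]"
      using gu(1) vy by (rule T_cj) (use n lcs_mem[OF w1] lcs_mem[OF t3] in auto)
    also have "T (g # u) [t; y * w1] = 1"
      using gu(1) tyw by (rule T_kill) (use n in simp)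
    also have "T (g # u) [w1; g * y] = T (g # u) [w1; y] * T (g # u) ([w1; g] \<up> y)"
      unfolding w1gy using gu(1) w1y' lcs_cj[OF w1g yS] by (rule T_hom) (use n in simp)
    also have "T (g # u) [w1; y] = 1"
      using gu(1) w1y by (rule T_kill) (use n in simp)
    also have "T (g # u) ([w1; g] \<up> y) = T (g # u) [w1; g]"
      using gu(1) w1g by (rule T_cj) (use n yS in auto)
    also have "T (g # u) [w1; g] = T (g # g # u) w1" by simp
    also have "\<dots> = T (g # g # u) ([c; y] \<up> v) * T (g # g # u) [v; y]"
      unfolding w1_def using gu(2) lcs_cj[OF cy lcs_mem[OF v2]] lcs_le[OF vy, of "1 + j"]
      by (intro T_hom[of _ _ "1 + j"]) (use n in auto)
    also have "T (g # g # u) ([c; y] \<up> v) = T (g # g # u) [c; y]"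
      using gu(2) cy by (rule T_cj) (use n lcs_mem[OF v2] in auto)
    also have "T (g # g # u) [v; y] = 1"
      using gu(2) vy by (rule T_kill) (use n in simp)
    finally show ?thesis by simp
  qed
  moreover have "T u [t; y] * T (g # u) w2 = 1"
  proof -
    have tg: "[t; g] = 1" unfolding t_def v_def using c g by (rule R3_D)
    have "[[[c; g * y]; g * y]; g * y] = 1" using c g yS by (intro R3_D) auto
    then have "[t * w2; g * y] = 1" by (simp only: e2)
    then have "[t; y] \<up> w2 * ([w2; y] * [w2; g] \<up> y) = 1"
      by (simp add: cm_mult_left cm_mult_right tg mult.assoc)
    then have 1: "T u ([t; y] \<up> w2 * ([w2; y] * [w2; g] \<up> y)) = 1" by simp
    have w2y: "lcs S (3 + j + 1) [w2; y]"
      by (rule lcs_le[OF lcs_cm_add[OF y w2]]) (use j in auto)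
    have w2y': "lcs S (3 + j) [w2; y]" by (rule lcs_le[OF w2y]) auto
    have w2g: "lcs S (3 + j) [w2; g]" using lcs_cm[OF w2 g] by (simp add: numeral_3_eq_3)
    have w2S: "w2 \<in> S" using w2 by (rule lcs_mem)
    have "T u ([t; y] \<up> w2 * ([w2; y] * [w2; g] \<up> y)) =
        T u ([t; y] \<up> w2) * (T u [w2; y] * T u ([w2; g] \<up> y))"
      using u ty w2S w2y' w2g yS n by (simp add: T_hom[where m = "3 + j"] lcs_mult lcs_cj)
    also have "T u ([t; y] \<up> w2) = T u [t; y]"
      using u ty by (rule T_cj) (use n w2S in auto)
    also have "T u [w2; y] = 1"
      using u w2y by (rule T_kill) (use n in simp)
    also have "T u ([w2; g] \<up> y) = T u [w2; g]"
      using u w2g by (rule T_cj) (use n yS in auto)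
    finally show ?thesis using 1 by simp
  qed
  ultimately show ?thesis by (simp add: t_def v_def mult.assoc)
qed

end

section \<open>Elimination certificates\<close>

text \<open>Letters are numbers, 0 and 1 denoting right 3-Engel elements, and every relation is followed by
  the letters of its last word. \<open>RA p q\<close> is \<open>[p; q][q; p] = 1\<close>, \<open>RZ c l\<close> is \<open>[c, l, l, l] = 1\<close>,
  \<open>RP c l y\<close> is \<open>[c, l, l, y][c, l, y, l][c, y, l, l] = 1\<close>, and \<open>RS c l m y\<close> is the polarisation
  of \<open>RP c l y\<close> in \<open>l\<close>.\<close>
datatype rel = RA word word word | RP nat nat word word | RS nat nat nat word word | RZ nat nat word

fun relvec :: "rel \<Rightarrow> vec" where
  "relvec (RA p q r) = wrap p r (asc q) @ wrap q r (asc p)"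
| "relvec (RP c l y r) = wrap [c, l, l] r (asc y) @ wrap [c, l] (l # r) (asc y) @ wrap [c] (l # l # r) (asc y)"
| "relvec (RS c l m y r) = wrap [c, l, m] r (asc y) @ wrap [c, m, l] r (asc y) @
    wrap [c, l] (m # r) (asc y) @ wrap [c, m] (l # r) (asc y) @
    wrap [c] (l # m # r) (asc y) @ wrap [c] (m # l # r) (asc y)"
| "relvec (RZ c l r) = [(1, c # l # l # l # r)]"

fun rel_ok :: "nat \<Rightarrow> rel \<Rightarrow> bool" where
  "rel_ok N (RA p q r) = (p \<noteq> [] \<and> q \<noteq> [] \<and> length p + length q + length r = N)"
| "rel_ok N (RP c l y r) = (c < 2 \<and> y \<noteq> [] \<and> 3 + length y + length r = N)"
| "rel_ok N (RS c l m y r) = (c < 2 \<and> y \<noteq> [] \<and> 3 + length y + length r = N)"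
| "rel_ok N (RZ c l r) = (c < 2 \<and> 4 + length r = N)"

primrec addc :: "int \<Rightarrow> word \<Rightarrow> vec \<Rightarrow> vec" where
  "addc c w [] = [(c, w)]"
| "addc c w (x # V) = (if snd x = w then (c + fst x, w) # V else x # addc c w V)"

definition norm :: "vec \<Rightarrow> vec" where
  "norm V = foldr (\<lambda>(c, w). addc c w) V []"

definition comb :: "(int \<times> rel) list \<Rightarrow> vec" where
  "comb cs = concat (map (\<lambda>(c, r). scale c (relvec r)) cs)"

text \<open>The finite list of exponents keeps the test executable; such factors can be divided out
  by \<open>\<Gamma>_power2\<close>.\<close>

definition pow2 :: "int \<Rightarrow> bool" where
  "pow2 d \<longleftrightarrow> list_ex (\<lambda>k. \<bar>d\<bar> = 2 ^ k) [0, 1, 2, 3]"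

text \<open>A certificate step derives that a word vanishes from an integer combination of relations
  whose other words are already known to vanish.\<close>
primrec certify :: "nat \<Rightarrow> word list \<Rightarrow> (word \<times> (int \<times> rel) list) list \<Rightarrow> word list" where
  "certify N K [] = K"
| "certify N K (s # ss) =
    (case filter (\<lambda>(c, w). c \<noteq> 0 \<and> w \<notin> set K) (norm (comb (snd s))) of
      [(d, w)] \<Rightarrow>
        if w = fst s \<and> pow2 d \<and> list_all (\<lambda>(c, r). rel_ok N r) (snd s) then certify N (w # K) ss else []
    | _ \<Rightarrow> [])"

section \<open>The linearised Engel relations\<close>

context engel_top
begin

lemma tail1: "tail S u k \<Longrightarrow> g \<in> S \<Longrightarrow> tail S (g # u) (Suc k)"
  using tail_Cons[OF lcs_base, of g S u k] by simp

lemma T_trilinear: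
  assumes c: "lcs S i c" and u: "tail S u k" and "n \<le> i + 1 + k" and gh: "g \<in> S" "h \<in> S"
  shows "T u [c; g * h] = T u [c; g] * T u [c; h]"
  using u c lcs_base[OF gh(1)] lcs_base[OF gh(2)] by (rule T_hom_right) (use assms in simp)

lemma polarize:
  assumes X: "\<And>g h. g \<in> S \<Longrightarrow> h \<in> S \<Longrightarrow> X g h \<in> \<Gamma>"
    "\<And>g g' h. g \<in> S \<Longrightarrow> g' \<in> S \<Longrightarrow> h \<in> S \<Longrightarrow> X (g * g') h = X g h * X g' h"
    "\<And>g h h'. g \<in> S \<Longrightarrow> h \<in> S \<Longrightarrow> h' \<in> S \<Longrightarrow> X g (h * h') = X g h * X g h'"
    and gh: "g \<in> S" "h \<in> S"
  shows "X (g * h) (g * h) = X g g * (X h h * (X g h * X h g))"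
  using gh X(1)[OF gh] X(1)[OF gh(2,1)] X(1)[OF gh(1,1)] X(1)[OF gh(2,2)]
  by (simp add: X(2,3) \<Gamma>_comm \<Gamma>_left_comm mult.assoc)

text \<open>The case \<open>j = 1\<close> left open by \<open>engel_P\<close>. Linearising
  \<open>X g g g = 1\<close> only yields \<open>Q g h * Q h g = 1\<close>. Here \<open>Q g h\<close>
  is linear in \<open>h\<close> and \<open>Q h g\<close> quadratic in \<open>h\<close>, so passing
  to \<open>h\<^sup>-\<close> inverts one factor only. Hence the two are equal, the square of
  \<open>Q g h\<close> is trivial, and the absence of involutions finishes the argument.\<close>

lemma engel_Q:
  assumes c: "c \<in> R3" and g: "g \<in> S" and h: "h \<in> S" and u: "tail S u k" and n: "n = 4 + k"
  shows "T u [[[c; g]; g]; h] * T u [[[c; g]; h]; g] * T u [[[c; h]; g]; g] = 1"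
proof -
  define X where "X g h l = T u [[[c; g]; h]; l]" for g h l
  have c1: "lcs S 1 c" using R3_mem[OF c] lcs_base by simp
  have c2: "lcs S 2 [c; g]" if "g \<in> S" for g
    using lcs_cm[OF c1 that] by (simp add: numeral_2_eq_2)
  have c3: "lcs S 3 [[c; g]; h]" if "g \<in> S" "h \<in> S" for g h
    using lcs_cm[OF c2[OF that(1)] that(2)] by (simp add: numeral_3_eq_3)
  have c4: "lcs S 4 [[[c; g]; h]; l]" if "g \<in> S" "h \<in> S" "l \<in> S" for g h l
    using lcs_cm[OF c3[OF that(1,2)] that(3)] by simp
  have X\<Gamma>: "X g h l \<in> \<Gamma>" if "g \<in> S" "h \<in> S" "l \<in> S" for g h l
    unfolding X_def using u c4[OF that] by (rule T_\<Gamma>) (use n in simp)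
  have X3: "X g h (l * l') = X g h l * X g h l'" if "g \<in> S" "h \<in> S" "l \<in> S" "l' \<in> S" for g h l l'
    unfolding X_def using c3[OF that(1,2)] u by (rule T_trilinear) (use n that in auto)
  have X2: "X g (h * h') l = X g h l * X g h' l" if "g \<in> S" "h \<in> S" "h' \<in> S" "l \<in> S" for g h h' l
    using T_trilinear[OF c2[OF that(1)] tail1[OF u that(4)] _ that(2,3)] n by (simp add: X_def)
  have X1: "X (g * g') h l = X g h l * X g' h l" if "g \<in> S" "g' \<in> S" "h \<in> S" "l \<in> S" for g g' h l
    using T_trilinear[OF c1 tail1[OF tail1[OF u that(4)] that(3)] _ that(1,2)] n by (simp add: X_def)
  have X0: "X g g g = 1" if "g \<in> S" for g
    using R3_D[OF c that] by (simp add: X_def)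
  define Q where "Q g h = X g g h * X g h g * X h g g" for g h
  have Q\<Gamma>: "Q g h \<in> \<Gamma>" if "g \<in> S" "h \<in> S" for g h
    using X\<Gamma> that by (simp add: Q_def)
  have QQ: "Q g h * Q h g = 1" if gh: "g \<in> S" "h \<in> S" for g h
  proof -
    note G = X\<Gamma>[OF gh(1,1,2)] X\<Gamma>[OF gh(1,2,1)] X\<Gamma>[OF gh(2,1,1)] X\<Gamma>[OF gh(1,2,2)] X\<Gamma>[OF gh(2,1,2)] X\<Gamma>[OF gh(2,2,1)]
    have "X (g * h) (g * h) (g * h) = Q g h * Q h g"
      using gh G by (simp add: X1 X2 X3 X0[OF gh(1)] X0[OF gh(2)] Q_def mult.assoc \<Gamma>_comm \<Gamma>_left_comm)
    moreover have "X (g * h) (g * h) (g * h) = 1" using gh by (intro X0) simp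
    ultimately show ?thesis by simp
  qed
  have minv: "X (g\<^sup>-) h l = (X g h l)\<^sup>-" "X h (g\<^sup>-) l = (X h g l)\<^sup>-" "X h l (g\<^sup>-) = (X h l g)\<^sup>-"
    if "g \<in> S" "h \<in> S" "l \<in> S" for g h l
    using X1[of g "g\<^sup>-" h l] X2[of h g "g\<^sup>-" l] X3[of h l g "g\<^sup>-"] that
    by (simp_all add: minv_unique[symmetric] X_def)
  have Qi: "Q g (h\<^sup>-) = (Q g h)\<^sup>-"
    using g h X\<Gamma> by (simp add: Q_def minv \<Gamma>_comm \<Gamma>_left_comm mult.assoc)
  have Qi': "Q (h\<^sup>-) g = Q h g"
    using g h by (simp add: Q_def minv)
  have "Q g h = Q h g"
    using QQ[of g "h\<^sup>-"] g h by (simp add: Qi Qi') (metis minv_unique minv_minv)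
  then have "Q g h * Q g h = 1" using QQ[OF g h] by simp
  with Q\<Gamma>[OF g h] have "Q g h = 1" by (rule \<Gamma>_sqrt)
  then show ?thesis by (simp add: Q_def X_def)
qed

lemma engel_RP:
  assumes c: "c \<in> R3" and g: "g \<in> S" and y: "lcs S j y"
    and u: "tail S u k" and n: "n = 3 + j + k"
  shows "T (y # u) [[c; g]; g] * T (g # u) [[c; g]; y] * T (g # g # u) [c; y] = 1"
proof (cases "j = 1")
  case True
  then show ?thesis using engel_Q[OF c g lcs_mem[OF y] u] n by simp
next
  case False
  then have "2 \<le> j" using lcs_pos[OF y] by simp
  then show ?thesis using c g y u n by (intro engel_P)
qed

text \<open>Expands \<open>engel_RP\<close> at \<open>g * h\<close>; the parts pure in
  \<open>g\<close> or \<open>h\<close> are again instances of \<open>engel_RP\<close> and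
  cancel.\<close>

lemma engel_RS:
  assumes c: "c \<in> R3" and g: "g \<in> S" and h: "h \<in> S" and y: "lcs S j y"
    and u: "tail S u k" and n: "n = 3 + j + k"
  shows "T (y # u) [[c; g]; h] * (T (y # u) [[c; h]; g] * (T (h # u) [[c; g]; y] *
    (T (g # u) [[c; h]; y] * (T (g # h # u) [c; y] * T (h # g # u) [c; y])))) = 1"
proof -
  have c1: "lcs S 1 c" using R3_mem[OF c] lcs_base by simp
  have c2: "lcs S 2 [c; g]" if "g \<in> S" for g
    using lcs_cm[OF c1 that] by (simp add: numeral_2_eq_2)
  have c3: "lcs S 3 [[c; g]; h]" if "g \<in> S" "h \<in> S" for g h
    using lcs_cm[OF c2[OF that(1)] that(2)] by (simp add: numeral_3_eq_3)
  have cy: "lcs S (1 + j) [c; y]" using lcs_cm_add[OF y c1] .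
  have cgy: "lcs S (2 + j) [[c; g]; y]" if "g \<in> S" for g using lcs_cm_add[OF y c2[OF that]] .
  have cyg: "lcs S (2 + j) [[c; y]; g]" if "g \<in> S" for g using lcs_cm[OF cy that] by simp
  have yu: "tail S (y # u) (j + k)" using y u by (rule tail_Cons)
  define A where "A g h = T (y # u) [[c; g]; h]" for g h
  define B where "B g h = T (h # u) [[c; g]; y]" for g h
  define C where "C g h = T (g # h # u) [c; y]" for g h
  have \<Gamma>: "A g h \<in> \<Gamma>" "B g h \<in> \<Gamma>" "C g h \<in> \<Gamma>" if "g \<in> S" "h \<in> S" for g h
    unfolding A_def B_def C_def
    using T_\<Gamma>[OF yu c3[OF that]] T_\<Gamma>[OF tail1[OF u that(2)] cgy[OF that(1)]]
      T_\<Gamma>[OF tail1[OF tail1[OF u that(2)] that(1)] cy] n by simp_all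
  have A: "A (g * h) (g * h) = A g g * (A h h * (A g h * A h g))"
  proof (rule polarize[of A, OF \<Gamma>(1) _ _ g h])
    show "A (g * g') h = A g h * A g' h" if "g \<in> S" "g' \<in> S" "h \<in> S" for g g' h
      using T_trilinear[OF c1 tail1[OF yu that(3)] _ that(1,2)] n by (simp add: A_def)
    show "A g (h * h') = A g h * A g h'" if "g \<in> S" "h \<in> S" "h' \<in> S" for g h h'
      using T_trilinear[OF c2[OF that(1)] yu _ that(2,3)] n by (simp add: A_def)
  qed
  have B: "B (g * h) (g * h) = B g g * (B h h * (B g h * B h g))"
  proof (rule polarize[of B, OF \<Gamma>(2) _ _ g h])
    show "B (g * g') h = B g h * B g' h" if "g \<in> S" "g' \<in> S" "h \<in> S" for g g' h
      using T_trilinear[OF c1 tail_Cons[OF y tail1[OF u that(3)]] _ that(1,2)] n by (simp add: B_def)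
    show "B g (h * h') = B g h * B g h'" if "g \<in> S" "h \<in> S" "h' \<in> S" for g h h'
      using T_trilinear[OF cgy[OF that(1)] u _ that(2,3)] n by (simp add: B_def)
  qed
  have C: "C (g * h) (g * h) = C g g * (C h h * (C g h * C h g))"
  proof (rule polarize[of C, OF \<Gamma>(3) _ _ g h])
    show "C (g * g') h = C g h * C g' h" if "g \<in> S" "g' \<in> S" "h \<in> S" for g g' h
      using T_trilinear[OF cy tail1[OF u that(3)] _ that(1,2)] n by (simp add: C_def)
    show "C g (h * h') = C g h * C g h'" if "g \<in> S" "h \<in> S" "h' \<in> S" for g h h'
      using T_trilinear[OF cyg[OF that(1)] u _ that(2,3)] n by (simp add: C_def)
  qed
  have P: "A g g * B g g * C g g = 1" if "g \<in> S" for g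
    unfolding A_def B_def C_def using c that y u n by (rule engel_RP)
  have "A (g * h) (g * h) * B (g * h) (g * h) * C (g * h) (g * h) = 1"
    using g h by (intro P) simp
  also have "A (g * h) (g * h) * B (g * h) (g * h) * C (g * h) (g * h) =
      (A g g * B g g * C g g) * (A h h * B h h * C h h) *
      (A g h * (A h g * (B g h * (B h g * (C g h * C h g)))))"
    unfolding A B C using g h by (simp add: mult.assoc \<Gamma> \<Gamma>_comm \<Gamma>_left_comm)
  finally show ?thesis
    using P[OF g] P[OF h] by (simp add: A_def B_def C_def)
qed

end

section \<open>Soundness of the certificates\<close>

lemma set_addc: "(d, w) \<in> set (addc c v V) \<Longrightarrow> w = v \<or> w \<in> snd ` set V"
  by (induction V) (force split: if_splits)+

lemma set_norm: "(d, w) \<in> set (norm V) \<Longrightarrow> w \<in> snd ` set V"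
proof (induction V arbitrary: d)
  case (Cons x V)
  obtain c v where x: "x = (c, v)" by (cases x)
  from Cons.prems have "(d, w) \<in> set (addc c v (norm V))" by (simp add: norm_def x)
  from set_addc[OF this] show ?case using Cons.IH by (auto simp: x)
qed (simp add: norm_def)

context engel_top
begin

lemma val_addc:
  assumes "f w \<in> \<Gamma>" "\<And>v. v \<in> snd ` set V \<Longrightarrow> f v \<in> \<Gamma>"
  shows "val f (addc c w V) = zp (f w) c * val f V"
  using assms(2)
proof (induction V)
  case (Cons x V)
  obtain d v where x: "x = (d, v)" by (cases x)
  have v: "f v \<in> \<Gamma>" and V: "\<And>v. v \<in> snd ` set V \<Longrightarrow> f v \<in> \<Gamma>"
    using Cons.prems by (auto simp: x)
  have "val f (addc c w V) = zp (f w) c * val f V" using V by (rule Cons.IH)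
  then show ?case
    using assms(1) v by (simp add: x zp_add mult.assoc \<Gamma>_left_comm)
qed simp

lemma val_norm:
  assumes "\<And>v. v \<in> snd ` set V \<Longrightarrow> f v \<in> \<Gamma>"
  shows "val f (norm V) = val f V"
  using assms
proof (induction V)
  case (Cons x V)
  obtain d v where x: "x = (d, v)" by (cases x)
  have v: "f v \<in> \<Gamma>" and V: "\<And>v. v \<in> snd ` set V \<Longrightarrow> f v \<in> \<Gamma>"
    using Cons.prems by (auto simp: x)
  have "val f (addc d v (norm V)) = zp (f v) d * val f (norm V)"
    using v V set_norm by (intro val_addc) auto
  moreover have "val f (norm V) = val f V" using V by (rule Cons.IH)
  ultimately show ?case by (simp add: x norm_def)
qed (simp add: norm_def)

lemma val_filter:
  assumes "\<forall>w \<in> set K. f w = 1"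
  shows "val f (filter (\<lambda>(c, w). c \<noteq> 0 \<and> w \<notin> set K) V) = val f V"
  using assms by (induction V) auto

lemma zp_pow2: "x \<in> \<Gamma> \<Longrightarrow> zp x d = 1 \<Longrightarrow> pow2 d \<Longrightarrow> x = 1"
proof -
  assume x: "x \<in> \<Gamma>" "zp x d = 1" and d: "pow2 d"
  from d obtain k where k: "\<bar>d\<bar> = 2 ^ k" unfolding pow2_def list_ex_iff by blast
  have "zp x \<bar>d\<bar> = zp x d \<or> zp x \<bar>d\<bar> = (zp x d)\<^sup>-"
    unfolding abs_if by (simp add: zp_minus)
  then have "zp x \<bar>d\<bar> = 1" unfolding x(2) by simp
  moreover have "zp x (2 ^ k) = x ^ (2 ^ k)"
    unfolding zp_def by (simp add: nat_power_eq)
  ultimately have "x ^ (2 ^ k) = 1" unfolding k by simp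
  with x(1) show "x = 1" by (rule \<Gamma>_power2)
qed

end

text \<open>The tail \<open>v\<close> fills up the weight beyond \<open>N\<close>, so that one
  certificate for words of length \<open>N\<close> serves every larger \<open>n\<close>.\<close>

locale engel_words = engel_top +
  fixes v :: "'a list" and k N :: nat
  assumes tail_v: "tail S v k" and N: "0 < N" "n = N + k"
begin

definition f0 :: "word \<Rightarrow> 'a" where "f0 w = T v (F w)"

lemma f0_\<Gamma>: "length w = N \<Longrightarrow> f0 w \<in> \<Gamma>"
  unfolding f0_def using tail_v N by (intro T_\<Gamma>[OF tail_v lcs_F]) auto

lemma f0_eq: "p \<noteq> [] \<Longrightarrow> f0 (p @ w @ r) = T (map \<rho> w @ map \<rho> r @ v) (F p)"
  by (simp add: f0_def F_append flip: append_assoc)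

lemma T_cm_F:
  assumes "p \<noteq> []" "q \<noteq> []" "length p + length q + length r = N"
  shows "T (map \<rho> r @ v) [F p; F q] = val f0 (wrap p r (asc q))"
  using T_asc[OF assms(2) tail_letters[OF tail_v, of r] lcs_F[OF assms(1)]] assms N
  by (simp add: val_wrap f0_eq)

lemma relvec_length: "rel_ok N r \<Longrightarrow> (c, w) \<in> set (relvec r) \<Longrightarrow> length w = N"
  by (cases r) (auto simp: wrap_def dest: length_asc)

lemma relvec_sound:
  assumes "rel_ok N r"
  shows "val f0 (relvec r) = 1"
proof (cases r)
  case (RA p q s)
  then have pq: "p \<noteq> []" "q \<noteq> []" and l: "length p + length q + length s = N"
    using assms by auto
  have lc: "lcs S (length p + length q) [F p; F q]" "lcs S (length p + length q) [F q; F p]"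
    using lcs_cm_add[OF lcs_F[OF pq(2)] lcs_F[OF pq(1)]] lcs_cm_add[OF lcs_F[OF pq(1)] lcs_F[OF pq(2)]]
    by (simp_all add: add.commute)
  have "T (map \<rho> s @ v) ([F p; F q] * [F q; F p]) = T (map \<rho> s @ v) [F p; F q] * T (map \<rho> s @ v) [F q; F p]"
    using tail_letters[OF tail_v, of s] lc by (rule T_hom) (use l N in simp)
  moreover have "[F p; F q] * [F q; F p] = 1" by (metis cm_minv minv_right)
  ultimately show ?thesis
    using T_cm_F[OF pq, of s] T_cm_F[OF pq(2,1), of s] l by (simp add: RA)
next
  case (RP c l y s)
  then have c: "\<rho> c \<in> R3" and y: "y \<noteq> []" and len: "3 + length y + length s = N"
    using assms \<rho>_R3 by (auto simp: less_2_cases_iff)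
  have "n = 3 + length y + (length s + k)" using len N by simp
  from engel_RP[OF c \<rho>_mem[of l] lcs_F[OF y] tail_letters[OF tail_v, of s] this]
  show ?thesis
    using T_cm_F[OF _ y, of "[c, l, l]" s] T_cm_F[OF _ y, of "[c, l]" "l # s"] T_cm_F[OF _ y, of "[c]" "l # l # s"] len
    by (simp add: RP F_def mult.assoc)
next
  case (RS c l m y s)
  then have c: "\<rho> c \<in> R3" and y: "y \<noteq> []" and len: "3 + length y + length s = N"
    using assms \<rho>_R3 by (auto simp: less_2_cases_iff)
  have "n = 3 + length y + (length s + k)" using len N by simp
  from engel_RS[OF c \<rho>_mem[of l] \<rho>_mem[of m] lcs_F[OF y] tail_letters[OF tail_v, of s] this]
  show ?thesis
    using T_cm_F[OF _ y, of "[c, l, m]" s] T_cm_F[OF _ y, of "[c, m, l]" s]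
      T_cm_F[OF _ y, of "[c, l]" "m # s"] T_cm_F[OF _ y, of "[c, m]" "l # s"]
      T_cm_F[OF _ y, of "[c]" "l # m # s"] T_cm_F[OF _ y, of "[c]" "m # l # s"] len
    by (simp add: RS F_def mult.assoc)
next
  case (RZ c l s)
  then have "\<rho> c \<in> R3" using assms \<rho>_R3 by (auto simp: less_2_cases_iff)
  then have "[[[\<rho> c; \<rho> l]; \<rho> l]; \<rho> l] = 1" by (rule R3_D) simp
  then show ?thesis by (simp add: RZ f0_def F_def)
qed

lemma comb_sound:
  assumes "list_all (\<lambda>(c, r). rel_ok N r) cs"
  shows "val f0 (comb cs) = 1 \<and> (\<forall>w \<in> snd ` set (comb cs). length w = N)"
  using assms
proof (induction cs)
  case (Cons x cs)
  obtain d r where x: "x = (d, r)" by (cases x)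
  have r: "rel_ok N r" using Cons.prems by (simp add: x)
  have "val f0 (scale d (relvec r)) = zp (val f0 (relvec r)) d"
    using relvec_length[OF r] by (intro val_scale f0_\<Gamma>)
  then have "val f0 (scale d (relvec r)) = 1" by (simp add: relvec_sound[OF r])
  moreover have "comb (x # cs) = scale d (relvec r) @ comb cs" by (simp add: comb_def x)
  moreover have "snd ` set (scale d (relvec r)) = snd ` set (relvec r)"
    by (force simp: scale_def)
  ultimately show ?case
    using Cons.IH Cons.prems relvec_length[OF r] by (simp add: ball_Un image_Un) force
qed (simp add: comb_def)

lemma certify_sound:
  assumes "\<forall>w \<in> set K. f0 w = 1"
  shows "\<forall>w \<in> set (certify N K ss). f0 w = 1"
  using assms
proof (induction ss arbitrary: K)
  case (Cons s ss)
  define V where "V = filter (\<lambda>(c, w). c \<noteq> 0 \<and> w \<notin> set K) (norm (comb (snd s)))"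
  show ?case
  \<comment> \<open>A rejected step returns the empty list, for which nothing has to be
    shown.\<close>
  proof (cases "certify N K (s # ss) = []")
    case False
    then obtain d w where V: "V = [(d, w)]"
      by (auto simp: V_def[symmetric] split: list.splits)
    with False have ok: "w = fst s" "pow2 d" "list_all (\<lambda>(c, r). rel_ok N r) (snd s)"
      and cert: "certify N K (s # ss) = certify N (w # K) ss"
      by (auto simp: V_def[symmetric] split: if_splits)
    note sound = comb_sound[OF ok(3)]
    have "(d, w) \<in> set (norm (comb (snd s)))"
      using arg_cong[OF V, of set] unfolding V_def by auto
    then have w: "length w = N" using sound by (auto dest: set_norm)
    have "val f0 V = val f0 (norm (comb (snd s)))"
      unfolding V_def using Cons.prems by (rule val_filter)
    also have "\<dots> = val f0 (comb (snd s))"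
      using sound f0_\<Gamma> by (intro val_norm) blast
    finally have "zp (f0 w) d = 1" using sound by (simp add: V)
    then have "f0 w = 1" using zp_pow2[OF f0_\<Gamma>[OF w]] ok(2) by blast
    then have "\<forall>w \<in> set (w # K). f0 w = 1" using Cons.prems by simp
    then show ?thesis unfolding cert by (rule Cons.IH)
  qed simp
qed simp

end

section \<open>Vanishing of the sixth term\<close>

text \<open>Every relation is homogeneous in each letter, so the linear system splits into blocks
  given by the letter counts. For \<open>n = i + j + k\<close> this enumerates one block.\<close>

primrec arrange :: "nat \<Rightarrow> nat \<Rightarrow> nat \<Rightarrow> nat \<Rightarrow> word list" where
  "arrange 0 i j k = [[]]"
| "arrange (Suc n) i j k =
    (if i = 0 then [] else map ((#) 0) (arrange n (i - 1) j k)) @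
    (if j = 0 then [] else map ((#) 1) (arrange n i (j - 1) k)) @
    (if k = 0 then [] else map ((#) 2) (arrange n i j (k - 1)))"

lemma mem_arrange:
  "set w \<subseteq> {0, 1, 2} \<Longrightarrow>
    w \<in> set (arrange (length w) (count_list w 0) (count_list w 1) (count_list w 2))"
  by (induction w) auto

text \<open>Found by Gaussian elimination. The entry \<open>(i, j, _)\<close> treats the words that start with 0 and
  contain \<open>i\<close> zeros and \<open>j\<close> ones.\<close>
definition certs6 :: "(nat \<times> nat \<times> (word \<times> (int \<times> rel) list) list) list" where
  "certs6 = [
    (1, 0, [
      ([0,2,2,2,2,2], [(1, RZ 0 2 [2,2])])]),
    (2, 0, [
      ([0,0,2,2,2,2], [(1, RA [0] [0] [2,2,2,2])]), ([0,2,2,2,0,2], [(1, RP 0 2 [0,2] [2])]),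
      ([0,2,2,2,2,0], [(1, RZ 0 2 [2,0])]), ([0,2,0,2,2,2], [(1, RP 0 2 [0,2,2] [])]), ([0,2,2,0,2,2], [(1,
      RA [0,2] [0,2] [2,2])])]),
    (3, 0, [
      ([0,0,0,2,2,2], [(1, RA [0] [0] [0,2,2,2])]), ([0,0,2,0,2,2], [(1, RA [0] [0] [2,0,2,2])]),
      ([0,0,2,2,0,2], [(1, RA [0] [0] [2,2,0,2])]), ([0,0,2,2,2,0], [(1, RA [0] [0] [2,2,2,0])]),
      ([0,2,0,0,2,2], [(1, RP 0 0 [2] [2,2])]), ([0,2,2,2,0,0], [(1, RP 0 2 [0,2] [0])]), ([0,2,2,0,2,0],
      [(1, RA [0,2,2] [0,2] [0]), (-1, RP 0 2 [0] [2,0])]), ([0,2,0,2,2,0], [(1, RA [0,2] [0,2] [2,0])]),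
      ([0,2,0,2,0,2], [(-1, RA [0,2,0] [0,2] [2]), (1, RS 0 0 2 [0,2] [2])]), ([0,2,2,0,0,2], [(1, RA [0,2]
      [0,2] [0,2])])]),
    (4, 0, [
      ([0,0,0,0,2,2], [(1, RA [0] [0] [0,0,2,2])]), ([0,0,0,2,0,2], [(1, RA [0] [0] [0,2,0,2])]),
      ([0,0,0,2,2,0], [(1, RA [0] [0] [0,2,2,0])]), ([0,0,2,0,0,2], [(1, RA [0] [0] [2,0,0,2])]),
      ([0,0,2,0,2,0], [(1, RA [0] [0] [2,0,2,0])]), ([0,0,2,2,0,0], [(1, RA [0] [0] [2,2,0,0])]),
      ([0,2,0,0,0,2], [(1, RP 0 0 [0,2] [2])]), ([0,2,0,0,2,0], [(1, RP 0 0 [2] [2,0])]), ([0,2,0,2,0,0],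
      [(1, RA [0,2,0] [0,2,0] [])]), ([0,2,2,0,0,0], [(1, RA [0,2] [0,2] [0,0])])]),
    (5, 0, [
      ([0,0,0,0,0,2], [(1, RA [0] [0] [0,0,0,2])]), ([0,0,0,0,2,0], [(1, RA [0] [0] [0,0,2,0])]),
      ([0,0,0,2,0,0], [(1, RA [0] [0] [0,2,0,0])]), ([0,0,2,0,0,0], [(1, RA [0] [0] [2,0,0,0])]),
      ([0,2,0,0,0,0], [(1, RP 0 0 [0,2] [0])])]),
    (1, 1, [
      ([0,2,2,2,1,2], [(1, RZ 0 2 [1,2])]), ([0,1,2,2,2,2], [(1, RP 0 2 [1,2] [2])]), ([0,2,2,2,2,1], [(1,
      RZ 0 2 [2,1])]), ([0,2,1,2,2,2], [(1, RP 0 2 [1,2,2] [])]), ([0,2,2,1,2,2], [(1, RP 0 2 [1] [2,2])])]),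
    (1, 2, [
      ([0,2,2,2,1,1], [(1, RZ 0 2 [1,1])]), ([0,1,2,2,2,1], [(1, RP 0 2 [1,2] [1])]), ([0,2,2,1,2,1], [(1,
      RS 1 1 2 [0,2,2] []), (1, RA [1,1,2] [0] [2,2]), (1, RA [1,1,2,2] [0] [2]), (-1, RA [1,1,2,2,2] [0]
      []), (-1, RA [1,2,1] [0] [2,2]), (2, RA [1,2,1,2] [0] [2]), (-1, RA [1,2,1,2,2] [0] []), (-1, RA [1,1]
      [0] [2,2,2]), (1, RA [1,2] [0] [2,2,1]), (1, RA [1,2,2] [0] [2,1]), (-1, RA [1,2,2,2] [0] [1]), (-1,
      RA [1] [0] [2,2,1,2]), (2, RA [1,2] [0] [2,1,2]), (-1, RA [1,2,2] [0] [1,2]), (-1, RA [1] [0]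
      [2,2,2,1])]), ([0,2,1,2,2,1], [(1, RP 0 2 [1] [2,1])]), ([0,2,1,2,1,2], [(-1, RP 1 2 [0,1] [2]), (1,
      RA [1,2,2] [0] [1,2]), (-1, RA [1,2,2,1] [0] [2]), (1, RA [1,2] [0] [1,2,2]), (-1, RA [1,2,1] [0]
      [2,2]), (1, RA [1] [0] [1,2,2,2]), (-1, RA [1,1] [0] [2,2,2]), (-1, RP 0 2 [1] [1,2]), (4, RP 0 1 [2]
      [2,2]), (2, RP 0 2 [1,2,1] []), (-5, RS 0 1 2 [1,2] [2])]), ([0,2,2,1,1,2], [(1, RS 1 1 2 [0,2] [2]),
      (1, RA [1,1,2,2] [0] [2]), (-1, RA [1,2,1] [0] [2,2]), (1, RA [1,2,1,2] [0] [2]), (-1, RA [1,1] [0]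
      [2,2,2]), (1, RA [1,2,2] [0] [1,2]), (-1, RA [1] [0] [2,1,2,2]), (1, RA [1,2] [0] [1,2,2]), (-1, RA
      [1] [0] [2,2,1,2])]), ([0,1,2,2,1,2], [(1, RP 0 2 [1] [1,2])]), ([0,2,1,1,2,2], [(1, RP 0 1 [2]
      [2,2]), (-1, RS 0 1 2 [1,2] [2])]), ([0,1,2,1,2,2], [(1, RS 1 0 1 [2] [2,2]), (-1, RA [1] [0]
      [1,2,2,2]), (-1, RA [1,1] [0] [2,2,2]), (-1, RA [1] [0] [2,1,2,2]), (-1, RA [1,1,2] [0] [2,2]), (-1,
      RA [1,2] [0] [1,2,2]), (-1, RA [1,2,1] [0] [2,2])]), ([0,1,1,2,2,2], [(1, RP 0 1 [2] [2,2])])]),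
    (1, 3, [
      ([0,1,1,1,2,2], [(1, RZ 0 1 [2,2])]), ([0,2,1,1,1,2], [(1, RP 0 1 [1,2] [2])]), ([0,1,2,1,1,2], [(1,
      RS 1 0 1 [2] [1,2]), (-1, RA [1] [0] [1,2,1,2]), (-1, RA [1,1] [0] [2,1,2]), (-1, RA [1] [0]
      [2,1,1,2]), (-1, RA [1,1,2] [0] [1,2]), (-1, RA [1,2] [0] [1,1,2]), (-1, RA [1,2,1] [0] [1,2])]),
      ([0,1,1,2,1,2], [(1, RP 0 1 [2] [1,2])]), ([0,1,1,2,2,1], [(1, RP 1 2 [0,1,1] []), (-1, RA [1,2,2] [0]
      [1,1]), (2, RA [1,2,2,1] [0] [1]), (-1, RA [1,2,2,1,1] [0] []), (-1, RA [1,2] [0] [1,1,2]), (2, RA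
      [1,2,1] [0] [1,2]), (-1, RA [1,2,1,1] [0] [2]), (-1, RA [1] [0] [1,1,2,2]), (2, RA [1,1] [0] [1,2,2]),
      (-1, RA [1,1,1] [0] [2,2])]), ([0,2,2,1,1,1], [(1, RP 1 1 [0,2,2] []), (-1, RA [1,1,1] [0] [2,2]), (2,
      RA [1,1,1,2] [0] [2]), (-1, RA [1,1,1,2,2] [0] []), (-1, RA [1,1] [0] [2,2,1]), (2, RA [1,1,2] [0]
      [2,1]), (-1, RA [1,1,2,2] [0] [1]), (-1, RA [1] [0] [2,2,1,1]), (2, RA [1,2] [0] [2,1,1]), (-1, RA
      [1,2,2] [0] [1,1])]), ([0,2,1,2,1,1], [(1, RS 1 1 2 [0,2] [1]), (1, RA [1,1,2,2] [0] [1]), (-1, RA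
      [1,2,1] [0] [2,1]), (1, RA [1,2,1,2] [0] [1]), (-1, RA [1,1] [0] [2,2,1]), (1, RA [1,2,2] [0] [1,1]),
      (-1, RA [1] [0] [2,1,2,1]), (1, RA [1,2] [0] [1,2,1]), (-1, RA [1] [0] [2,2,1,1])]), ([0,1,2,1,2,1],
      [(1, RS 0 1 2 [1,2] [1])]), ([0,1,2,2,1,1], [(1, RP 0 1 [1,2,2] [])]), ([0,2,1,1,2,1], [(1, RP 0 1 [2]
      [2,1])])]),
    (1, 4, [
      ([0,1,1,1,1,2], [(1, RZ 0 1 [1,2])]), ([0,1,1,1,2,1], [(1, RZ 0 1 [2,1])]), ([0,2,1,1,1,1], [(1, RP 0
      1 [1,2] [1])]), ([0,1,2,1,1,1], [(1, RP 0 1 [1,2,1] [])]), ([0,1,1,2,1,1], [(1, RP 0 1 [2] [1,1])])]),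
    (2, 2, [
      ([0,0,1,1,2,2], [(1, RA [0] [0] [1,1,2,2])]), ([0,0,1,2,1,2], [(1, RA [0] [0] [1,2,1,2])]),
      ([0,0,1,2,2,1], [(1, RA [0] [0] [1,2,2,1])]), ([0,0,2,1,1,2], [(1, RA [0] [0] [2,1,1,2])]),
      ([0,0,2,1,2,1], [(1, RA [0] [0] [2,1,2,1])]), ([0,0,2,2,1,1], [(1, RA [0] [0] [2,2,1,1])]),
      ([0,2,2,0,1,1], [(1, RP 0 2 [0] [1,1]), (-1, RA [0,2,1] [0,2] [1])]), ([0,2,0,2,1,1], [(1, RA [0,2]
      [0,2] [1,1])]), ([0,1,1,0,2,2], [(1, RA [0,1,2] [0,1] [2]), (-1, RP 0 1 [0] [2,2])]), ([0,1,0,1,2,2],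
      [(1, RA [0,1] [0,1] [2,2])]), ([0,2,1,2,1,0], [(16, RP 0 2 [0,1,1] []), (4, RP 1 2 [0] [1,0]), (-4, RA
      [1,2,2] [0] [1,0]), (-4, RA [1,2] [0] [2,1,0]), (-4, RA [1] [0] [2,2,1,0]), (4, RP 0 2 [1] [1,0]), (8,
      RS 0 0 1 [1,2] [2]), (16, RP 0 1 [0,2] [2]), (-4, RA [0,2,2] [0,1] [1]), (-8, RP 0 2 [0,1] [1]), (4,
      RA [0,1] [0,2] [2,1]), (4, RS 0 0 2 [1,2] [1]), (8, RS 0 1 2 [0,1,2] []), (16, RS 0 0 1 [2] [1,2]),
      (-16, RA [0,1] [0,2] [1,2]), (8, RP 1 0 [2] [1,2]), (-8, RA [1] [0] [0,2,1,2]), (-8, RA [1] [0]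
      [2,0,1,2]), (-8, RA [1,2] [0] [0,1,2]), (8, RA [0,2,1,2] [0,1] []), (-8, RP 0 1 [2] [0,2]), (8, RS 0 1
      2 [1,2] [0]), (8, RA [0,1,1,2] [0,2] [])]), ([0,2,2,1,1,0], [(1, RS 1 1 2 [0,2] [0]), (1, RA [1,1,2,2]
      [0] [0]), (-1, RA [1,2,1] [0] [2,0]), (1, RA [1,2,1,2] [0] [0]), (-1, RA [1,1] [0] [2,2,0]), (1, RA
      [1,2,2] [0] [1,0]), (-1, RA [1] [0] [2,1,2,0]), (1, RA [1,2] [0] [1,2,0]), (-1, RA [1] [0]
      [2,2,1,0])]), ([0,1,2,2,1,0], [(1, RP 0 2 [1] [1,0])]), ([0,2,1,1,2,0], [(1, RP 0 1 [2] [2,0]), (-1,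
      RS 0 1 2 [1,2] [0])]), ([0,1,2,1,2,0], [(1, RS 1 0 1 [2] [2,0]), (-1, RA [1] [0] [1,2,2,0]), (-1, RA
      [1,1] [0] [2,2,0]), (-1, RA [1] [0] [2,1,2,0]), (-1, RA [1,1,2] [0] [2,0]), (-1, RA [1,2] [0]
      [1,2,0]), (-1, RA [1,2,1] [0] [2,0])]), ([0,1,1,2,2,0], [(1, RP 0 1 [2] [2,0])]), ([0,1,1,2,0,2],
      [(-2, RS 1 0 1 [0,2,2] []), (2, RA [1] [0] [1,0,2,2]), (-4, RA [1] [0] [1,2,0,2]), (2, RA [1] [0]
      [1,2,2,0]), (2, RA [1,1] [0] [0,2,2]), (-4, RA [1,1] [0] [2,0,2]), (4, RA [1,1] [0] [2,2,0]), (2, RA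
      [1] [0] [0,2,2,1]), (-4, RA [1] [0] [2,0,2,1]), (4, RA [1] [0] [2,2,0,1]), (-4, RA [1,1,2] [0] [2,0]),
      (2, RA [1,1,2,2] [0] [0]), (-4, RA [1,2] [0] [2,0,1]), (2, RA [1,2,2] [0] [0,1]), (2, RA [1] [0]
      [2,2,1,0]), (-4, RA [1,2] [0] [2,1,0]), (2, RA [1,2,2] [0] [1,0]), (1, RA [0,1,1] [0,2,2] []), (-2, RP
      0 1 [0,2,2] [])]), ([0,2,2,1,0,1], [(1, RA [0,1,1] [0,2,2] [])]), ([0,1,0,2,2,1], [(-1, RA [0,1,2]
      [0,2,1] []), (-1, RP 0 1 [2] [0,2]), (1, RP 0 2 [1] [0,1]), (1, RS 0 0 1 [2] [1,2]), (1, RP 0 1 [0,2]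
      [2]), (-1, RA [0,1] [0,2] [2,1]), (1, RP 0 2 [0,1] [1]), (2, RS 0 1 2 [0,1,2] []), (2, RA [0,2,1,1]
      [0] [2]), (4, RA [0,1] [0,2] [1,2])]), ([0,1,0,2,1,2], [(1, RP 1 0 [1,2,2] []), (-1, RA [1] [0]
      [0,1,2,2]), (2, RA [1] [0] [0,2,1,2]), (-1, RA [1] [0] [0,2,2,1]), (-1, RA [1] [0] [1,2,2,0]), (2, RA
      [1] [0] [2,1,2,0]), (-1, RA [1] [0] [2,2,1,0]), (-1, RA [1,1,2,2] [0] [0]), (2, RA [1,2,1,2] [0] [0]),
      (-1, RA [1,2,2,1] [0] [0])]), ([0,2,1,0,1,2], [(-1, RS 0 0 1 [2] [1,2]), (-1, RP 0 1 [0,2] [2])]),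
      ([0,1,2,0,1,2], [(1, RP 1 0 [2] [1,2]), (-1, RA [1] [0] [0,2,1,2]), (-1, RA [1] [0] [2,0,1,2]), (-1,
      RA [1,2] [0] [0,1,2])]), ([0,2,0,1,1,2], [(1, RA [0,1] [0,2] [1,2])]), ([0,2,1,1,0,2], [(1, RA [0,1,1]
      [0,2] [2])]), ([0,1,2,1,0,2], [(1, RP 0 1 [2] [0,2])]), ([0,1,2,2,0,1], [(1, RA [0,1,2] [0,1,2] [])]),
      ([0,1,2,0,2,1], [(1, RA [0,2,2] [0,1] [1])]), ([0,2,0,1,2,1], [(1, RS 0 0 2 [1,2,1] [])]),
      ([0,2,1,0,2,1], [(1, RA [0,1] [0,2] [2,1])]), ([0,2,1,2,0,1], [(1, RA [0,1,2] [0,2,1] [])])]),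
    (2, 3, [
      ([0,0,1,1,1,2], [(1, RA [0] [0] [1,1,1,2])]), ([0,0,1,1,2,1], [(1, RA [0] [0] [1,1,2,1])]),
      ([0,0,1,2,1,1], [(1, RA [0] [0] [1,2,1,1])]), ([0,0,2,1,1,1], [(1, RA [0] [0] [2,1,1,1])]),
      ([0,1,1,1,0,2], [(1, RP 0 1 [0,1] [2])]), ([0,1,1,1,2,0], [(1, RZ 0 1 [2,0])]), ([0,2,0,1,1,1], [(1,
      RP 0 1 [0,2,1] [])]), ([0,2,1,1,1,0], [(1, RP 0 1 [1,2] [0])]), ([0,1,2,1,1,0], [(1, RS 1 0 1 [2]
      [1,0]), (-1, RA [1] [0] [1,2,1,0]), (-1, RA [1,1] [0] [2,1,0]), (-1, RA [1] [0] [2,1,1,0]), (-1, RA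
      [1,1,2] [0] [1,0]), (-1, RA [1,2] [0] [1,1,0]), (-1, RA [1,2,1] [0] [1,0])]), ([0,1,1,2,1,0], [(1, RP
      0 1 [2] [1,0])]), ([0,1,1,0,1,2], [(1, RA [0,1,1] [0,1] [2]), (-1, RP 0 1 [0] [1,2])]),
      ([0,1,0,1,1,2], [(1, RA [0,1] [0,1] [1,2])]), ([0,1,1,0,2,1], [(1, RA [0,1,2] [0,1] [1]), (-1, RP 0 1
      [0] [2,1])]), ([0,1,0,1,2,1], [(1, RA [0,1] [0,1] [2,1])]), ([0,1,0,2,1,1], [(1, RP 1 0 [1,2,1] []),
      (-2, RA [1] [0] [0,1,2,1]), (1, RA [1] [0] [0,1,1,2]), (1, RA [1] [0] [0,2,1,1]), (-2, RA [1] [0]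
      [1,2,1,0]), (1, RA [1] [0] [1,1,2,0]), (1, RA [1] [0] [2,1,1,0]), (-2, RA [1,1,2,1] [0] [0]), (1, RA
      [1,1,1,2] [0] [0]), (1, RA [1,2,1,1] [0] [0])]), ([0,2,1,1,0,1], [(-1, RA [0,1,1] [0,2,1] []), (1, RS
      0 0 1 [2] [1,1]), (1, RP 0 1 [0,2] [1])]), ([0,1,2,1,0,1], [(1, RS 1 0 1 [2] [0,1]), (-1, RA [1] [0]
      [1,2,0,1]), (-1, RA [1,1] [0] [2,0,1]), (-1, RA [1] [0] [2,1,0,1]), (-1, RA [1,1,2] [0] [0,1]), (-1,
      RA [1,2] [0] [1,0,1]), (-1, RA [1,2,1] [0] [0,1])]), ([0,1,1,2,0,1], [(1, RP 0 1 [2] [0,1])]),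
      ([0,1,2,0,1,1], [(1, RA [0,1,1] [0,1,2] [])]), ([0,2,1,0,1,1], [(1, RA [0,1] [0,2] [1,1])])])
  ]"

text \<open>The leading 0 is split off, hence the length 5 and the count \<open>i - 1\<close>; the
  number of letters 2 is what remains of 6.\<close>

lemma certs6_check:
  "list_all (\<lambda>(i, j, ss). set (map ((#) 0) (arrange 5 (i - 1) j (6 - i - j))) \<subseteq> set (certify 6 [] ss)) certs6"
  by code_simp

lemma count_asc_acc: "(\<And>c w. (c, w) \<in> set V \<Longrightarrow> count_list w l = m) \<Longrightarrow> (c, w) \<in> set (asc_acc V q) \<Longrightarrow>
    count_list w l = m + count_list q l"
proof (induction q arbitrary: V m)
  case (Cons x q)
  have "count_list w l = (m + count_list [x] l) + count_list q l"
    by (rule Cons.IH[OF _ Cons.prems(2)[simplified]]) (use Cons.prems(1) in \<open>auto simp: wrap_def neg_def\<close>)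
  then show ?case by simp
qed simp

lemma count_asc: "(c, w) \<in> set (asc q) \<Longrightarrow> q \<noteq> [] \<Longrightarrow> count_list w l = count_list q l"
  using count_asc_acc[of "[(1, [hd q])]" l "count_list [hd q] l" c w "tl q"] by (cases q) (auto simp: asc_def)

lemma count_sum: "set w \<subseteq> {0, 1, 2} \<Longrightarrow> count_list w 0 + count_list w 1 + count_list w 2 = length (w :: nat list)"
  by (induction w) auto

context engel_words
begin

lemma val_1: "(\<And>c w. (c, w) \<in> set V \<Longrightarrow> f w = 1) \<Longrightarrow> val f V = 1"
  by (induction V) force+

lemma f0_hd:
  assumes N: "N = 6" and w: "length w = 6" "set w \<subseteq> {0, 1, 2}" "hd w = 0" "2 \<in> set w"
    and c: "1 \<notin> set w \<or> count_list w 0 \<le> count_list w 1"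
  shows "f0 w = 1"
proof -
  obtain w' where w': "w = 0 # w'" using w by (cases w) auto
  define i j where "i = count_list w 0" and "j = count_list w 1"
  have c2: "count_list w 2 = 6 - i - j"
    using count_sum[OF w(2)] w(1) by (simp add: i_def j_def)
  have ij: "0 < i" "i + j < 6" "j = 0 \<or> i \<le> j"
    using w c count_sum[OF w(2)] count_notin[of 1 w] count_list_0_iff[of w 2]
    by (auto simp: i_def j_def w')
  \<comment> \<open>All counts with at least one 0 and one 2, and with either no 1 or at least as
    many letters 1 as 0.\<close>
  have "(i, j) \<in> {(1, 0), (2, 0), (3, 0), (4, 0), (5, 0), (1, 1), (1, 2), (1, 3), (1, 4), (2, 2), (2, 3)}"
    using ij by (simp; presburger)
  then have "(i, j) \<in> (\<lambda>(i, j, ss). (i, j)) ` set certs6"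
    by (simp add: certs6_def)
  then obtain ss where ss: "(i, j, ss) \<in> set certs6" by auto
  have "w' \<in> set (arrange (length w') (count_list w' 0) (count_list w' 1) (count_list w' 2))"
    using w(2) by (intro mem_arrange) (simp add: w')
  moreover have "length w' = 5" "count_list w' 0 = i - 1" "count_list w' 1 = j" "count_list w' 2 = 6 - i - j"
    using w(1) c2 by (simp_all add: w' i_def j_def)
  ultimately have "w' \<in> set (arrange 5 (i - 1) j (6 - i - j))" by simp
  then have "w \<in> set (certify N [] ss)"
    using certs6_check ss by (fastforce simp: list_all_iff N w')
  then show ?thesis using certify_sound[of "[]" ss] by simp
qed

text \<open>Antisymmetry brings a 0 to the front: a word starting with \<open>p\<close> followed by
  0 is minus the commutator of 0 with \<open>F p\<close>, whose expansion has the same letter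
  counts.\<close>

lemma f0_words:
  assumes N: "N = 6" and w: "length w = 6" "set w \<subseteq> {0, 1, 2}" "0 \<in> set w" "2 \<in> set w"
    and c: "1 \<notin> set w \<or> count_list w 0 \<le> count_list w 1"
  shows "f0 w = 1"
proof -
  obtain p r where pr: "w = p @ 0 # r" using w(3) by (meson split_list)
  show ?thesis
  proof (cases "p = []")
    case True
    then show ?thesis using assms pr by (intro f0_hd) auto
  next
    case False
    have "val f0 (relvec (RA p [0] r)) = 1"
      using False w(1) pr by (intro relvec_sound) (simp add: N)
    moreover have "val f0 (wrap [0] r (asc p)) = 1"
    proof (rule val_1)
      fix d u assume "(d, u) \<in> set (wrap [0] r (asc p))"
      then obtain q where q: "(d, q) \<in> set (asc p)" and u: "u = 0 # q @ r"
        by (auto simp: wrap_def)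
      have "length q = length p" and cq: "count_list q l = count_list p l" for l
        using length_asc[OF q False] count_asc[OF q False] by auto
      then have cu: "length u = 6" "count_list u l = count_list w l" for l
        using w(1) by (simp_all add: u pr)
      have "set u = set w"
        using cu(2) count_list_0_iff by (metis subsetI subset_antisym)
      moreover have "hd u = 0" by (simp add: u)
      ultimately show "f0 u = 1"
        using N cu w c by (intro f0_hd) (simp_all only: )
    qed
    ultimately show ?thesis by (simp add: pr asc_def wrap_def)
  qed
qed

end

context engel_grp
begin

context
  fixes n :: nat and v :: "'a list"
  assumes n: "6 \<le> n" and kill: "\<And>z. lcs S (Suc n) z \<Longrightarrow> z = 1" and v: "tail S v (n - 6)"
begin

lemma T_word:
  assumes \<rho>: "\<And>l. \<rho> l \<in> S" "\<rho> 0 \<in> R3" "\<rho> 1 \<in> R3"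
    and u: "length u = 6" "set u \<subseteq> {0, 1, 2}" "0 \<in> set u" "2 \<in> set u"
      "1 \<notin> set u \<or> count_list u 0 \<le> count_list u (1 :: nat)"
  shows "T v (T (tl (map \<rho> u)) (hd (map \<rho> u))) = 1"
proof -
  interpret engel_words S n \<rho> v "n - 6" 6
    using n kill v \<rho> by unfold_locales auto
  have "f0 u = 1" using u by (intro f0_words) auto
  moreover have "u \<noteq> []" using u by auto
  ultimately show ?thesis by (simp add: f0_def F_def hd_map map_tl)
qed

text \<open>Renaming reduces to the tabulated counts: 0 and 1 may be exchanged, both being Engel
  letters; if 2 is absent, the second Engel element takes the role of the arbitrary one; and a word
  in a single letter begins with \<open>[g; g]\<close>.\<close>

lemma T_word3:
  assumes \<rho>: "\<And>l. \<rho> l \<in> S" "\<rho> 0 \<in> R3" "\<rho> 1 \<in> R3"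
    and u: "length u = 6" "set u \<subseteq> {0, 1, 2 :: nat}"
  shows "T v (T (tl (map \<rho> u)) (hd (map \<rho> u))) = 1"
proof -
  define sw :: "nat \<Rightarrow> nat" where "sw l = (if l = 0 then 1 else if l = 1 then 0 else l)" for l
  have sw: "inj sw" "sw (sw l) = l" "sw ` set u \<subseteq> {0, 1, 2}" for l
    using u(2) by (auto simp: sw_def inj_def split: if_splits)
  consider "0 \<in> set u" "2 \<in> set u" "1 \<notin> set u \<or> count_list u 0 \<le> count_list u 1"
    | "1 \<in> set u" "2 \<in> set u" "0 \<notin> set u \<or> count_list u 1 \<le> count_list u 0"
    | "0 \<in> set u" "1 \<in> set u" "2 \<notin> set u"
    | l where "set u \<subseteq> {l}"
    using u(2) by (cases "0 \<in> set u"; cases "1 \<in> set u"; cases "2 \<in> set u") fastforce+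
  then show ?thesis
  proof cases
    case 1
    then show ?thesis using assms by (intro T_word) auto
  next
    case 2
    have "T v (T (tl (map (\<rho> \<circ> sw) (map sw u))) (hd (map (\<rho> \<circ> sw) (map sw u)))) = 1"
    proof (rule T_word)
      show "1 \<notin> set (map sw u) \<or> count_list (map sw u) 0 \<le> count_list (map sw u) 1"
        using 2(3) count_list_map_conv[OF sw(1), of u 0] count_list_map_conv[OF sw(1), of u 1]
        by (auto simp: sw_def)
      show "0 \<in> set (map sw u)" "2 \<in> set (map sw u)"
        using 2 by (force simp: sw_def)+
    qed (use assms sw in \<open>auto simp: sw_def\<close>)
    then show ?thesis by (simp add: sw(2) o_def)
  next
    case 3
    define s :: "nat \<Rightarrow> nat" where "s l = (if l = 1 then 2 else l)" for l
    define r where "r l = (if l = 2 then \<rho> 1 else \<rho> 0)" for l :: nat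
    have "T v (T (tl (map r (map s u))) (hd (map r (map s u)))) = 1"
    proof (rule T_word)
      show "0 \<in> set (map s u)" "2 \<in> set (map s u)"
        using 3 by (force simp: s_def)+
    qed (use assms 3 in \<open>auto simp: s_def r_def\<close>)
    moreover have "map r (map s u) = map \<rho> u"
      using 3 u(2) by (auto simp: s_def r_def)
    ultimately show ?thesis by (simp only:)
  next
    case 4
    obtain g h w where "u = g # h # w"
      using u(1) by (cases u rule: remdups_adj.cases) auto
    then show ?thesis using 4 by simp
  qed
qed

end

text \<open>In the last term, multilinearity reduces everything to left-normed commutators in the
  generators. The tail is kept general because the last entry of a commutator is moved to the front
  of \<open>v\<close>.\<close>

lemma lcs_letters:
  assumes n: "5 \<le> n" and kill: "\<And>z. lcs S (Suc n) z \<Longrightarrow> z = 1" and S: "S = Collect (gen X)"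
    and z: "lcs S m z" and v: "tail S v k" "n = m + k"
    and X: "\<And>u. length u = m \<Longrightarrow> set u \<subseteq> X \<Longrightarrow> T v (T (tl u) (hd u)) = 1"
  shows "T v z = 1"
proof -
  \<comment> \<open>Only the weight calculus is wanted here, so all letters are interpreted as 1,
    which is trivially right 3-Engel.\<close>
  interpret engel_top S n "\<lambda>_. 1"
    using n kill by unfold_locales (auto simp: R3_def)
  have XS: "X \<subseteq> S" unfolding S by (auto intro: gen_base)
  show ?thesis using z v X
  proof (induction arbitrary: v k rule: lcs.induct)
    case (lcs_base z)
    note v = lcs_base.prems(1) and m = lcs_base.prems(2) and X = lcs_base.prems(3)
    have m1: "n \<le> Suc 0 + k" using m by simp
    have "gen X z" using \<open>z \<in> S\<close> by (simp add: S)
    then show ?case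
    proof induction
      case (gen_base x)
      then show ?case using X[of "[x]"] by simp
    next
      case (gen_mult x y)
      then show ?case using T_hom[OF v, of "Suc 0" x y] m1 by (simp add: S lcs.lcs_base)
    next
      case (gen_minv x)
      then show ?case using T_minv[OF v, of "Suc 0" x] m1 by (simp add: S lcs.lcs_base)
    qed simp
  next
    case (lcs_cm m y g)
    note v = lcs_cm.prems(1) and m = lcs_cm.prems(2) and X = lcs_cm.prems(3) and y = \<open>lcs S m y\<close>
    have m1: "n \<le> m + Suc 0 + k" using m by simp
    have "gen X g" using \<open>g \<in> S\<close> by (simp add: S)
    then show ?case
    proof induction
      case (gen_base x)
      have "T (x # v) y = 1"
      proof (rule lcs_cm.IH)
        show "tail S (x # v) (Suc 0 + k)" using gen_base XS v by (intro tail_Cons) (auto intro: lcs.lcs_base)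
        show "n = m + (Suc 0 + k)" using m by simp
        show "T (x # v) (T (tl u) (hd u)) = 1" if "length u = m" "set u \<subseteq> X" for u
          using X[of "u @ [x]"] that gen_base lcs_pos[OF y] by (cases u) auto
      qed
      then show ?case by simp
    next
      case (gen_mult g h)
      then show ?case using T_hom_right[OF v y, of "Suc 0" g h] m1 by (simp add: S lcs.lcs_base)
    next
      case (gen_minv g)
      then show ?case using T_minv_right[OF v y, of "Suc 0" g] m1 by (simp add: S lcs.lcs_base)
    qed simp
  next
    case (lcs_mult m x y)
    have "T v (x * y) = T v x * T v y"
      using lcs_mult.prems(1) lcs_mult.hyps by (rule T_hom) (use lcs_mult.prems in simp)
    then show ?case using lcs_mult.IH[OF lcs_mult.prems] by simp
  next
    case (lcs_minv m x)
    have "T v (x\<^sup>-) = (T v x)\<^sup>-"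
      using lcs_minv.prems(1) lcs_minv.hyps by (rule T_minv) (use lcs_minv.prems in simp)
    then show ?case using lcs_minv.IH[OF lcs_minv.prems] by simp
  qed
qed

lemma tail_list: "set u \<subseteq> S \<Longrightarrow> tail S u (length u)"
proof (induction u)
  case (Cons g u)
  then have "tail S (g # u) (Suc 0 + length u)" by (intro tail_Cons) (auto intro: lcs_base)
  then show ?case by simp
qed (simp add: tail_Nil)

text \<open>The first six entries of a left-normed commutator in the generators form a word covered
  by \<open>T_word3\<close>, with the remaining entries as its tail.\<close>

lemma lcs_collapse:
  assumes S: "S = Collect (gen {a, b, x})" and a: "a \<in> R3" and b: "b \<in> R3"
    and n: "6 \<le> n" and kill: "\<And>z. lcs S (Suc n) z \<Longrightarrow> z = 1" and z: "lcs S n z"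
  shows "z = 1"
proof -
  have XS: "{a, b, x} \<subseteq> S" unfolding S by (auto intro: gen_base)
  have "T [] z = 1"
  proof (rule lcs_letters[OF _ kill S z])
    fix u assume u: "length u = n" "set u \<subseteq> {a, b, x}"
    define \<rho> where "\<rho> l = (if l = 0 then a else if l = 1 then b else x)" for l :: nat
    have "\<rho> ` {0, 1, 2} = {a, b, x}" by (auto simp: \<rho>_def)
    then have "u \<in> map \<rho> ` lists {0, 1, 2}"
      using u(2) by (simp only: lists_image[symmetric] in_lists_conv_set) auto
    then obtain w where w: "set w \<subseteq> {0, 1, 2}" "map \<rho> w = u" by auto
    have u6: "take 6 u = map \<rho> (take 6 w)" using take_map[of 6 \<rho> w] w(2) by simp
    have "T (drop 6 u) (T (tl (take 6 u)) (hd (take 6 u))) = 1"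
      unfolding u6
    proof (rule T_word3[OF n kill])
      have "tail S (drop 6 u) (length (drop 6 u))"
        using u(2) XS set_drop_subset[of 6 u] by (intro tail_list) auto
      then show "tail S (drop 6 u) (n - 6)" by (simp add: u)
      show "\<rho> l \<in> S" for l using XS by (simp add: \<rho>_def)
      show "length (take 6 w) = 6" using u n w by auto
      show "set (take 6 w) \<subseteq> {0, 1, 2}" using w set_take_subset[of 6 w] by blast
    qed (use a b in \<open>simp_all add: \<rho>_def\<close>)
    moreover have "tl u = tl (take 6 u) @ drop 6 u" "hd (take 6 u) = hd u"
      using u n by (cases u; simp)+
    ultimately show "T [] (T (tl u) (hd u)) = 1" by simp
  qed (use n in \<open>auto intro: tail_Nil\<close>)
  then show ?thesis by simp
qed

text \<open>Descending induction from the nilpotency class, which is finite but unknown; each round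
  makes one more term trivial.\<close>

lemma lcs6:
  assumes S: "S = Collect (gen {a, b, x})" and a: "a \<in> R3" and b: "b \<in> R3" and z: "lcs S 6 z"
  shows "z = 1"
proof -
  obtain c where c: "\<And>z. lcs S (Suc c) z \<Longrightarrow> z = 1" using nilpotent[OF S a b] by blast
  \<comment> \<open>Starting at \<open>6 + c\<close> keeps every index at 6 or above, as
    \<open>lcs_collapse\<close> demands.\<close>
  have "lcs S (6 + c - k) z \<longrightarrow> z = 1" if "k \<le> c" for k z
    using that
  proof (induction k arbitrary: z)
    case 0
    show ?case using c lcs_le[of "6 + c" z "Suc c"] by auto
  next
    case (Suc k)
    show ?case
    proof
      assume z: "lcs S (6 + c - Suc k) z"
      show "z = 1"
      proof (rule lcs_collapse[OF S a b _ _ z])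
        have "Suc (6 + c - Suc k) = 6 + c - k" using Suc.prems by simp
        then show "z = 1" if "lcs S (Suc (6 + c - Suc k)) z" for z
          using Suc that by simp
      qed (use Suc.prems in simp)
    qed
  qed
  from this[of c z] show ?thesis using z by simp
qed

end

section \<open>Products in class five\<close>

text \<open>All words are linear in the letters 0 and 1 and cubic in 2. The word
  \<open>[0,1,2,2,2]\<close> is an intermediate result.\<close>

definition cert5 :: "(word \<times> (int \<times> rel) list) list" where
  "cert5 = [
    ([0,2,2,2,1], [(1, RZ 0 2 [1])]), ([0,1,2,2,2], [(1, RP 0 2 [1,2] [])]),
    ([0,2,1,2,2], [(1, RP 1 2 [0] [2]), (-1, RA [1,2,2] [0] [2]), (-1, RA [1,2] [0] [2,2]),
      (-1, RA [1] [0] [2,2,2]), (1, RP 0 2 [1] [2])]),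
    ([0,2,2,1,2], [(1, RP 0 2 [1] [2])])]"

lemma cert5_check:
  "set [[0,2,2,2,1], [0,2,1,2,2], [0,2,2,1,2]] \<subseteq> set (certify 5 [] cert5)"
  by code_simp

context engel_grp
begin

text \<open>\<open>[a * b; x]\<close> is \<open>v * w * v'\<close> with \<open>w = [a, x, b]\<close>
  of weight 3. In class 5 the only cross terms that survive further commutation with
  \<open>x\<close> are \<open>[t; v']\<close> and \<open>[[w; x]; x]\<close>, and
  \<open>cert5\<close> annihilates both.\<close>

lemma R3_mult:
  assumes S: "S = Collect (gen {a, b, x})" and a: "a \<in> R3" and b: "b \<in> R3"
  shows "[[[a * b; x]; x]; x] = 1"
proof -
  have mem: "a \<in> S" "b \<in> S" "x \<in> S" unfolding S by (auto intro: gen_base)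
  define \<rho> where "\<rho> l = (if l = 0 then a else if l = 1 then b else x)" for l :: nat
  interpret engel_words S 5 \<rho> "[]" 0 5
    using lcs6[OF S a b] a b mem by unfold_locales (auto simp: \<rho>_def intro: tail_Nil)
  have words: "f0 [0,2,2,2,1] = 1" "f0 [0,2,1,2,2] = 1" "f0 [0,2,2,1,2] = 1"
    using certify_sound[of "[]" cert5] cert5_check by auto
  define v v' where "v = [a; x]" and "v' = [b; x]"
  define w t t' where "w = [v; b]" and "t = [v; x]" and "t' = [v'; x]"
  have c1: "lcs S 1 a" "lcs S 1 b" using mem by (auto intro: lcs_base)
  have c2: "lcs S 2 v" "lcs S 2 v'"
    using lcs_cm[OF c1(1) mem(3)] lcs_cm[OF c1(2) mem(3)] by (simp_all add: v_def v'_def numeral_2_eq_2)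
  have c3: "lcs S 3 w" "lcs S 3 t"
    using lcs_cm[OF c2(1) mem(2)] lcs_cm[OF c2(1) mem(3)] by (simp_all add: w_def t_def numeral_3_eq_3)
  have c4: "lcs S 4 [w; x]" using lcs_cm[OF c3(1) mem(3)] by simp
  \<comment> \<open>Expanding \<open>[b, x]\<close> makes this the difference of the certified words
    \<open>[0,2,2,1,2]\<close> and \<open>[0,2,2,2,1]\<close>.\<close>
  have tv: "[t; v'] = 1"
  proof -
    have "T [] [F [0,2,2]; F [1,2]] = val f0 (wrap [0,2,2] [] (asc [1,2]))"
      using T_cm_F[of "[0,2,2]" "[1,2]" "[]"] by simp
    moreover have "val f0 (wrap [0,2,2] [] (asc [1,2])) = 1"
      using words by (simp add: asc_def wrap_def neg_def)
    ultimately show ?thesis by (simp add: F_def \<rho>_def t_def v_def v'_def)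
  qed
  have tw: "[t; w] = 1" using lcs6[OF S a b] lcs_cm_add[OF c3] by simp
  have wv: "[[w; x]; v'] = 1" using lcs6[OF S a b] lcs_cm_add[OF c2(2) c4] by simp
  have "[a * b; x] = v * w * v'"
    by (simp add: v_def v'_def w_def cm_mult_left cj_eq_mult_cm[of "[a; x]"])
  moreover have "[v * w * v'; x] = t * [w; x] * t'"
    using tv tw wv by (simp add: cm_mult_left t_def t'_def cm_eq_1_iff)
  moreover have "[t; x] = 1" "[t'; x] = 1"
    using R3_D[OF a mem(3)] R3_D[OF b mem(3)] by (simp_all add: t_def t'_def v_def v'_def)
  moreover have "[[w; x]; x] = 1"
    using words(2) by (simp add: f0_def F_def \<rho>_def w_def v_def)
  ultimately show ?thesis by (simp add: cm_mult_left)
qed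

end

section \<open>Transfer to a group with a carrier\<close>

text \<open>Right multiplication, in accordance with the order of composition chosen for
  \<open>sym\<close>.\<close>

definition cayley :: "('a, 'b) monoid_scheme \<Rightarrow> 'a \<Rightarrow> 'a sym" where
  "cayley G g = sym_restrict (carrier G) (\<lambda>y. y \<otimes>\<^bsub>G\<^esub> g)"

context group
begin

lemma bij_betw_mult_right: "g \<in> carrier G \<Longrightarrow> bij_betw (\<lambda>y. y \<otimes> g) (carrier G) (carrier G)"
  by (rule bij_betw_byWitness[where f' = "\<lambda>y. y \<otimes> inv g"]) (auto simp: m_assoc)

lemma cayley_mult:
  "g \<in> carrier G \<Longrightarrow> h \<in> carrier G \<Longrightarrow> cayley G (g \<otimes> h) = cayley G g * cayley G h"
  unfolding cayley_def by (rule sym_restrict_mult) (auto simp: bij_betw_mult_right m_assoc)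

lemma cayley_eq_iff [simp]:
  assumes "g \<in> carrier G" "h \<in> carrier G"
  shows "cayley G g = cayley G h \<longleftrightarrow> g = h"
  unfolding cayley_def sym_restrict_eq_iff[OF bij_betw_mult_right[OF assms(1)] bij_betw_mult_right[OF assms(2)]]
  using assms by auto

lemma cayley_one [simp]: "cayley G \<one> = 1"
  using cayley_mult[of \<one> \<one>, symmetric] by simp

lemma cayley_eq_1_iff [simp]: "g \<in> carrier G \<Longrightarrow> cayley G g = 1 \<longleftrightarrow> g = \<one>"
  using cayley_eq_iff[of g \<one>] by simp

lemma cayley_inv: "g \<in> carrier G \<Longrightarrow> cayley G (inv g) = (cayley G g)\<^sup>-"
  using cayley_mult[of g "inv g"] by (simp add: minv_unique)

lemma commutator_closed [simp]:
  "g \<in> carrier G \<Longrightarrow> h \<in> carrier G \<Longrightarrow> commutator G g h \<in> carrier G"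
  by (simp add: commutator_def)

lemma cayley_commutator:
  "g \<in> carrier G \<Longrightarrow> h \<in> carrier G \<Longrightarrow> cayley G (commutator G g h) = [cayley G g; cayley G h]"
  by (simp add: commutator_def cm_def cayley_mult cayley_inv)

lemma subgroup_lower_central: "subgroup (lower_central G n) G"
proof (induction n)
  case (Suc n)
  then show ?case
    using subgroup.mem_carrier by (cases n) (fastforce intro!: generate_is_subgroup subgroup_self)+
qed (simp add: subgroup_self)

lemma gen_cayley:
  assumes "gen (cayley G ` X) z" "X \<subseteq> carrier G"
  shows "z \<in> cayley G ` carrier G"
  using assms
proof (induction rule: gen.induct)
  case gen_one
  show ?case by (rule image_eqI[of _ _ \<one>]) simp_all
next
  case (gen_mult y z)
  then obtain g h where gh: "g \<in> carrier G" "h \<in> carrier G" "y = cayley G g" "z = cayley G h" by auto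
  then show ?case by (intro image_eqI[of _ _ "g \<otimes> h"]) (simp_all add: cayley_mult)
next
  case (gen_minv y)
  then obtain g where "g \<in> carrier G" "y = cayley G g" by auto
  then show ?case by (intro image_eqI[of _ _ "inv g"]) (simp_all add: cayley_inv)
qed auto

text \<open>The series of a subgroup lies in the series of the group; through this the torsion
  hypothesis on \<open>G\<close> reaches \<open>S\<close>.\<close>

lemma lcs_cayley:
  assumes "lcs S n z" "S \<subseteq> cayley G ` carrier G"
  shows "z \<in> cayley G ` lower_central G n"
  using assms
proof (induction rule: lcs.induct)
  case (lcs_base y)
  then show ?case by auto
next
  case (lcs_cm n y s)
  obtain g h where gh: "g \<in> lower_central G n" "h \<in> carrier G" "y = cayley G g" "s = cayley G h"
    using lcs_cm by blast
  \<comment> \<open>Excludes the dummy index 0 of \<open>lower_central\<close>, whose successor is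
    not formed by commutators.\<close>
  have "n \<noteq> 0" using lcs_cm.hyps(1) by (induction rule: lcs.induct) auto
  then obtain m where n: "n = Suc m" by (cases n) auto
  have "commutator G g h \<in> lower_central G (Suc n)"
    using gh unfolding n by (auto intro!: generate.incl)
  moreover have "[y; s] = cayley G (commutator G g h)"
    using gh subgroup.mem_carrier[OF subgroup_lower_central] by (simp add: cayley_commutator)
  ultimately show ?case by blast
next
  case (lcs_mult n y z)
  then obtain g h where gh: "g \<in> lower_central G n" "h \<in> lower_central G n" "y = cayley G g" "z = cayley G h"
    by auto
  then show ?case
    using subgroup.m_closed[OF subgroup_lower_central] subgroup.subset[OF subgroup_lower_central]
    by (intro image_eqI[of _ _ "g \<otimes> h"]) (auto simp: cayley_mult subset_iff)
next
  case (lcs_minv n y)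
  then obtain g where "g \<in> lower_central G n" "y = cayley G g" by auto
  then show ?case
    using subgroup.m_inv_closed[OF subgroup_lower_central] subgroup.subset[OF subgroup_lower_central]
    by (intro image_eqI[of _ _ "inv g"]) (auto simp: cayley_inv subset_iff)
qed

lemma cayley_engel:
  assumes "g \<in> carrier G" "h \<in> carrier G"
  shows "engel_commutator G g 3 h = \<one> \<longleftrightarrow>
    [[[cayley G g; cayley G h]; cayley G h]; cayley G h] = 1"
  using assms by (simp add: numeral_3_eq_3 flip: cayley_commutator)

context
  fixes a b x and S :: "'a sym set"
  assumes tf: "\<forall>z \<in> lower_central G 5. ord z \<noteq> 2"
    and a: "a \<in> right_engel G 3" and b: "b \<in> right_engel G 3" and x: "x \<in> carrier G"
    and S: "S = Collect (gen {cayley G a, cayley G b, cayley G x})"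
begin

lemma carrier_abx: "a \<in> carrier G" "b \<in> carrier G" "x \<in> carrier G"
  using a b x by (auto simp: right_engel_def)

lemma S_subset: "S \<subseteq> cayley G ` carrier G"
  using gen_cayley[of "{a, b, x}"] carrier_abx by (auto simp: S)

lemma engel_grp_S: "engel_grp S"
proof (intro engel_grp.intro engel_grp_axioms.intro)
  show "subgrp S" unfolding S by (rule subgrp_gen)
  fix z assume z: "lcs S 5 z" "z * z = 1"
  then obtain w where w: "w \<in> lower_central G 5" "z = cayley G w"
    using lcs_cayley[OF z(1) S_subset] by blast
  have wG: "w \<in> carrier G" using w(1) subgroup.subset[OF subgroup_lower_central] by blast
  then have "w \<otimes> w = \<one>" using z w by (simp flip: cayley_mult)
  then have "ord w dvd 2" using wG by (simp add: pow_eq_id[symmetric] numeral_2_eq_2)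
  \<comment> \<open>The value 0 stands for infinite order and does not divide 2.\<close>
  then have "ord w = 1" using dvd_imp_le[of "ord w" 2] tf w(1) by (cases "ord w = 0") auto
  then show "z = 1" using ord_eq_1[OF wG] wG w(2) by simp
qed

interpretation E: engel_grp S by (rule engel_grp_S)

lemma right_engel_R3:
  assumes "g \<in> right_engel G 3" "cayley G g \<in> S"
  shows "cayley G g \<in> E.R3"
  using assms S_subset cayley_engel[of g] by (fastforce simp: E.R3_def right_engel_def)

lemma right_engel_ab: "cayley G a \<in> E.R3" "cayley G b \<in> E.R3"
  using right_engel_R3[OF a] right_engel_R3[OF b] by (simp_all add: S gen_base)

lemma right_engel_product:
  "engel_commutator G (a \<otimes> b) 3 x = \<one>" "engel_commutator G (inv a) 3 x = \<one>"
proof -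
  have "cayley G x \<in> S" by (auto simp: S intro: gen_base)
  with E.R3_mult[OF S right_engel_ab] E.R3_D[OF E.R3_minv[OF right_engel_ab(1)]]
  show "engel_commutator G (a \<otimes> b) 3 x = \<one>" "engel_commutator G (inv a) 3 x = \<one>"
    using carrier_abx by (simp_all add: cayley_engel cayley_mult cayley_inv)
qed

end

end

theorem theorem2p2:
  fixes G (structure)
  assumes "group G"
    and "\<And>x. x \<in> lower_central G 5 \<Longrightarrow> group.ord G x \<noteq> 2"
  shows "subgroup (right_engel G 3) G"
proof -
  interpret group G by (rule assms)
  have "\<forall>z \<in> lower_central G 5. ord z \<noteq> 2" using assms(2) by blast
  \<comment> \<open>\<open>refl\<close> takes for \<open>S\<close> the subgroup generated by the
    images of \<open>a\<close>, \<open>b\<close> and \<open>x\<close>.\<close>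
  note closed = right_engel_product[OF this _ _ _ refl]
  have sub: "right_engel G 3 \<subseteq> carrier G" by (auto simp: right_engel_def)
  show ?thesis
  proof (rule subgroupI[OF sub])
    have "\<one> \<in> right_engel G 3"
      by (simp add: right_engel_def cayley_engel)
    then show "right_engel G 3 \<noteq> {}" by blast
    show "inv a \<in> right_engel G 3" if a: "a \<in> right_engel G 3" for a
      using closed(2)[OF a a] sub a by (auto simp: right_engel_def)
    show "a \<otimes> b \<in> right_engel G 3" if a: "a \<in> right_engel G 3" and b: "b \<in> right_engel G 3" for a b
      using closed(1)[OF a b] sub a b by (auto simp: right_engel_def)
  qed
qed

end
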